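(* There exists a symplectic $C^1$ twist map $g$ of the annulus $\mathbb{A}=\mathbb{T}\times\mathbb{R}$ that has a non-differentiable essential invariant curve $\Gamma$ such that the restriction of $g$ to $\Gamma$ is minimal.
   Context: $\mathbb{T}=\mathbb{R}/\mathbb{Z}$ is the circle and $\mathbb{A}=\mathbb{T}\times\mathbb{R}$ is the annulus, with coordinates $(\theta,r)$. Symplectic means preserving the area form $d\theta\wedge dr$. A $C^1$ diffeomorphism $g$ of $\mathbb{A}$ that is isotopic to the identity is a positive (resp. negative) twist map if, for any given lift $\tilde g:\mathbb{R}^2\to\mathbb{R}^2$ of $g$ and for every $\theta\in\mathbb{R}$, the map $r\mapsto\tilde\pi\circ\tilde g(\theta,r)$ is an increasing (resp. decreasing) diffeomorphism of $\mathbb{R}$, where $\tilde\pi:\mathbb{R}^2\to\mathbb{R}$, $\tilde\pi(\theta,r)=\theta$, is the lift of the first projection. A twist map is a map that is a positive or a negative twist map. An essential invariant curve of $g$ is a homotopically non-trivial simple loop in $\mathbb{A}$ that is invariant by $g$. By Birkhoff theory, any essential invariant curve of a symplectic $C^1$ twist map is the graph of a Lipschitz map $\psi:\mathbb{T}\to\mathbb{R}$; the curve is non-differentiable if $\psi$ is not differentiable at some point of $\mathbb{T}$. A homeomorphism is minimal if all its orbits are dense. *)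

theory Defs
  imports "HOL-Analysis.Analysis"
begin

quotient_type circle = real / "\<lambda>x y. x - y \<in> \<int>"
  morphisms rep_circle to_circle
proof (rule equivpI)
  show "reflp (\<lambda>x y::real. x - y \<in> \<int>)"
    by (simp add: reflp_def)
  show "symp (\<lambda>x y::real. x - y \<in> \<int>)"
    by (metis (no_types, lifting) Ints_minus minus_diff_eq sympI)
  show "transp (\<lambda>x y::real. x - y \<in> \<int>)"
    by (rule transpI) (metis (no_types, lifting) Ints_add diff_add_cancel add_diff_eq)
qed

instantiation circle :: topological_space
begin

definition open_circle :: "circle set \<Rightarrow> bool" where
  "open_circle U \<longleftrightarrow> open (to_circle -` U)"

instance
  by standard (auto simp: open_circle_def vimage_Union)

end

lemma to_circle_eq_iff: "to_circle x = to_circle y \<longleftrightarrow> x - y \<in> \<int>"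
  by (rule circle.abs_eq_iff)

lemma continuous_on_to_circle: "continuous_on S to_circle"
  by (rule continuous_on_subset [of UNIV])
     (auto simp: continuous_on_open_vimage open_circle_def)

type_synonym annulus = "circle \<times> real"

definition to_annulus :: "real \<times> real \<Rightarrow> annulus" where
  "to_annulus z = (to_circle (fst z), snd z)"

definition is_lift :: "(real \<times> real \<Rightarrow> real \<times> real) \<Rightarrow> (annulus \<Rightarrow> annulus) \<Rightarrow> bool" where
  "is_lift G g \<longleftrightarrow> continuous_on UNIV G \<and> to_annulus \<circ> G = g \<circ> to_annulus"

definition C1_map :: "('a::real_normed_vector \<Rightarrow> 'b::real_normed_vector) \<Rightarrow> bool" where
  "C1_map f \<longleftrightarrow> (\<exists>f' :: 'a \<Rightarrow> 'a \<Rightarrow>\<^sub>L 'b.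
      (\<forall>x. (f has_derivative blinfun_apply (f' x)) (at x)) \<and> continuous_on UNIV f')"

definition C1_diffeo :: "('a::real_normed_vector \<Rightarrow> 'b::real_normed_vector) \<Rightarrow> bool" where
  "C1_diffeo f \<longleftrightarrow> bij f \<and> C1_map f \<and> C1_map (inv f)"

text \<open>
  The differentiable structure of the annulus is the one for which the covering
  \<^term>\<open>to_annulus\<close> is a local diffeomorphism. As the plane is simply connected, every
  continuous self-map of the annulus has a lift, and two lifts differ by an integer
  translation of the first coordinate; so a self-map is of class \<open>C\<^sup>1\<close> iff some (equivalently,
  every) lift is.
\<close>

definition annulus_C1_map :: "(annulus \<Rightarrow> annulus) \<Rightarrow> bool" where
  "annulus_C1_map g \<longleftrightarrow> (\<exists>G. is_lift G g \<and> C1_map G)"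

definition annulus_C1_diffeo :: "(annulus \<Rightarrow> annulus) \<Rightarrow> bool" where
  "annulus_C1_diffeo g \<longleftrightarrow> bij g \<and> annulus_C1_map g \<and> annulus_C1_map (inv g)"

text \<open>
  An isotopy is a path of \<open>C\<^sup>1\<close> diffeomorphisms that is continuous for the \<open>C\<^sup>1\<close> compact-open
  topology; equivalently, it lifts to a family of maps of the plane which is jointly continuous
  in time and space together with its space derivative.
\<close>

definition isotopic_to_id :: "(annulus \<Rightarrow> annulus) \<Rightarrow> bool" where
  "isotopic_to_id g \<longleftrightarrow>
    (\<exists>h :: real \<Rightarrow> annulus \<Rightarrow> annulus.
       h 0 = id \<and> h 1 = g \<and> (\<forall>t\<in>{0..1}. annulus_C1_diffeo (h t)) \<and>
       (\<exists>(H :: real \<Rightarrow> real \<times> real \<Rightarrow> real \<times> real)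
          (H' :: real \<Rightarrow> real \<times> real \<Rightarrow> (real \<times> real) \<Rightarrow>\<^sub>L (real \<times> real)).
          (\<forall>t\<in>{0..1}. is_lift (H t) (h t) \<and>
             (\<forall>z. (H t has_derivative blinfun_apply (H' t z)) (at z))) \<and>
          continuous_on ({0..1} \<times> UNIV) (\<lambda>(t, z). H t z) \<and>
          continuous_on ({0..1} \<times> UNIV) (\<lambda>(t, z). H' t z)))"

definition positive_twist_map :: "(annulus \<Rightarrow> annulus) \<Rightarrow> bool" where
  "positive_twist_map g \<longleftrightarrow> annulus_C1_diffeo g \<and> isotopic_to_id g \<and>
    (\<forall>G. is_lift G g \<longrightarrow> (\<forall>\<theta>. C1_diffeo (\<lambda>r. fst (G (\<theta>, r))) \<and>
                                strict_mono (\<lambda>r. fst (G (\<theta>, r)))))"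

definition negative_twist_map :: "(annulus \<Rightarrow> annulus) \<Rightarrow> bool" where
  "negative_twist_map g \<longleftrightarrow> annulus_C1_diffeo g \<and> isotopic_to_id g \<and>
    (\<forall>G. is_lift G g \<longrightarrow> (\<forall>\<theta>. C1_diffeo (\<lambda>r. fst (G (\<theta>, r))) \<and>
                                strict_antimono_on UNIV (\<lambda>r. fst (G (\<theta>, r)))))"

definition twist_map :: "(annulus \<Rightarrow> annulus) \<Rightarrow> bool" where
  "twist_map g \<longleftrightarrow> positive_twist_map g \<or> negative_twist_map g"

text \<open>The area form \<open>d\<theta> \<and> dr\<close>, evaluated on a pair of tangent vectors.\<close>

definition area_form :: "real \<times> real \<Rightarrow> real \<times> real \<Rightarrow> real" where
  "area_form u v = fst u * snd v - snd u * fst v"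

definition symplectic :: "(annulus \<Rightarrow> annulus) \<Rightarrow> bool" where
  "symplectic g \<longleftrightarrow> (\<exists>G. is_lift G g \<and>
    (\<forall>z. \<exists>D. (G has_derivative D) (at z) \<and>
         (\<forall>u v. area_form (D u) (D v) = area_form u v)))"

definition essential_curve :: "annulus set \<Rightarrow> bool" where
  "essential_curve \<Gamma> \<longleftrightarrow>
    (\<exists>\<gamma>. simple_path \<gamma> \<and> pathfinish \<gamma> = pathstart \<gamma> \<and> path_image \<gamma> = \<Gamma> \<and>
         \<not> (\<exists>a. homotopic_loops UNIV \<gamma> (\<lambda>_. a)))"

definition essential_invariant_curve :: "(annulus \<Rightarrow> annulus) \<Rightarrow> annulus set \<Rightarrow> bool" where
  "essential_invariant_curve g \<Gamma> \<longleftrightarrow> essential_curve \<Gamma> \<and> g ` \<Gamma> = \<Gamma>"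

text \<open>
  Functions on the circle are Lipschitz, or differentiable at a point, iff the periodic
  functions on the line they induce are.
\<close>

definition nondifferentiable_curve :: "annulus set \<Rightarrow> bool" where
  "nondifferentiable_curve \<Gamma> \<longleftrightarrow>
    (\<exists>\<psi> :: circle \<Rightarrow> real. \<Gamma> = range (\<lambda>t. (t, \<psi> t)) \<and>
       (\<exists>L. L-lipschitz_on UNIV (\<psi> \<circ> to_circle)) \<and>
       (\<exists>\<theta>. \<not> (\<psi> \<circ> to_circle) differentiable (at \<theta>)))"

definition minimal_homeomorphism_on :: "'a::topological_space set \<Rightarrow> ('a \<Rightarrow> 'a) \<Rightarrow> bool" where
  "minimal_homeomorphism_on S f \<longleftrightarrow>
    (\<exists>f'. homeomorphism S S f f' \<and>
       (\<forall>x\<in>S. S \<subseteq> closure (range (\<lambda>n. (f ^^ n) x) \<union> range (\<lambda>n. (f' ^^ n) x))))"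

end

theory Submission
  imports Defs "HOL-Complex_Analysis.Winding_Numbers"
begin

text \<open>
The twist map is of standard type, \<open>(\<theta>, r) \<mapsto> (\<theta> + r, r + \<phi> (\<theta> + r))\<close> with \<open>\<phi>\<close> periodic of class
\<open>C\<^sup>1\<close>. It maps the graph of \<open>h - id\<close> to itself exactly when \<open>\<phi> = h + inverse h - 2 id\<close>. What is needed
is therefore a minimal homeomorphism \<open>h\<close> of the circle which fails to be differentiable somewhere
although \<open>h + inverse h\<close> is of class \<open>C\<^sup>1\<close>; it is then Lipschitz, because \<open>h\<close> and its inverse both
increase (\<open>circle_map_of_conjugacy\<close>, \<open>circle_map_to_twist_map\<close>).

The homeomorphism is sought as \<open>h (K x) = K (x + \<alpha>)\<close> with \<open>\<alpha>\<close> irrational, which makes minimality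
automatic. If \<open>K\<close> has a density \<open>k > 0\<close>, then at \<open>K x\<close> the derivative of \<open>h\<close> is \<open>k (x + \<alpha>) / k x\<close>,
and that of \<open>h + inverse h\<close> is the potential \<open>V x = (k (x + \<alpha>) + k (x - \<alpha>)) / k x\<close>. So \<open>V\<close> has to
be continuous while the quotient \<open>k (x + \<alpha>) / k x\<close> oscillates as \<open>x\<close> tends to \<open>0\<close>. Along one orbit
\<open>k\<^sub>j = k (y + j * \<alpha>)\<close> the relation with \<open>V\<close> is a discrete Schroedinger equation; its other solutions
are \<open>k\<^sub>j * (1 + s * D\<^sub>j)\<close>, where \<open>D\<^sub>j\<^sub>+\<^sub>1 - D\<^sub>j = 1 / (k\<^sub>j * k\<^sub>j\<^sub>+\<^sub>1)\<close> and \<open>D\<^sub>0 = 0\<close>. Letting \<open>s\<close> depend on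
\<open>y\<close> near \<open>0\<close>, one changes the quotient by \<open>s / k(y)\<^sup>2\<close> and leaves \<open>V\<close> as it is. The obstacle is that
positivity asks for bounded \<open>D\<close>, whereas \<open>1 / (k\<^sub>j * k\<^sub>j\<^sub>+\<^sub>1)\<close> is bounded below by a positive constant
for continuous periodic \<open>k\<close>.

This is overcome by an induction in which each stage only treats a finite piece of the orbits near
\<open>0\<close>. Stage \<open>n\<close> first makes \<open>k\<close> grow along the orbit of \<open>0\<close>, beyond the piece already treated, at
the relative rate \<open>2\<^sup>-\<^sup>n\<close>; this changes \<open>V\<close> by a relative error of at most \<open>2\<^sup>-\<^sup>n\<close> and keeps the sum of
all \<open>1 / (k\<^sub>j * k\<^sub>j\<^sub>+\<^sub>1)\<close> met so far below \<open>3\<close> (\<open>growth_step\<close>). It then applies the change of solution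
with \<open>s\<close> between \<open>0\<close> and \<open>1/6\<close>, vanishing at \<open>0\<close>, stops \<open>D\<close> far along the orbit, where \<open>k\<close> is
large, and lets it fade out slowly, which again costs only \<open>2\<^sup>-\<^sup>n\<close> (\<open>shear_step\<close>). Both changes
are special cases of
\<open>tower_modification\<close>, which confines them to so small a neighbourhood of a finite piece of the orbit
of \<open>0\<close> that the primitive \<open>K\<close> hardly moves.

In the limit \<open>V\<close> converges uniformly and \<open>K\<close> locally uniformly, while nothing is claimed about
\<open>k\<close>. The mean value theorem turns the relation between \<open>K\<close> and \<open>V\<close> into one about increments, which
survives the limit; the difference quotients of \<open>h\<close> at \<open>K 0\<close> reach \<open>1 + 1/10000\<close> and fall to
\<open>1 + 1/20000\<close> at arbitrarily small scales, since each stage creates such quotients and all later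
stages are small enough to preserve them (\<open>singular_conjugacy\<close>).
\<close>

section \<open>Periodic functions and their primitives\<close>

lemma periodic_add_of_int:
  fixes f :: "real \<Rightarrow> 'a"
  assumes "\<And>x. f (x + 1) = f x"
  shows "f (x + of_int m) = f x"
proof (induction m rule: int_induct [of _ 0])
  case (step1 i)
  then show ?case using assms [of "x + of_int i"] by (simp add: algebra_simps)
next
  case (step2 i)
  then show ?case using assms [of "x + of_int (i - 1)"] by (simp add: algebra_simps)
qed simp

definition circle_fun :: "(real \<Rightarrow> real) \<Rightarrow> bool" where
  "circle_fun f \<longleftrightarrow> continuous_on UNIV f \<and> (\<forall>x. f (x + 1) = f x)"

lemma circle_fun_cont: "circle_fun f \<Longrightarrow> continuous_on UNIV f"
  and circle_fun_per: "circle_fun f \<Longrightarrow> f (x + 1) = f x"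
  by (auto simp: circle_fun_def)

lemma circle_fun_const [intro, simp]: "circle_fun (\<lambda>x. c)"
  by (auto simp: circle_fun_def)

lemma circle_fun_add [intro]: "circle_fun f \<Longrightarrow> circle_fun g \<Longrightarrow> circle_fun (\<lambda>x. f x + g x)"
  and circle_fun_diff [intro]: "circle_fun f \<Longrightarrow> circle_fun g \<Longrightarrow> circle_fun (\<lambda>x. f x - g x)"
  and circle_fun_mult [intro]: "circle_fun f \<Longrightarrow> circle_fun g \<Longrightarrow> circle_fun (\<lambda>x. f x * g x)"
  and circle_fun_minus [intro]: "circle_fun f \<Longrightarrow> circle_fun (\<lambda>x. - f x)"
  and circle_fun_abs [intro]: "circle_fun f \<Longrightarrow> circle_fun (\<lambda>x. \<bar>f x\<bar>)"
  by (auto simp: circle_fun_def intro!: continuous_intros)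

lemma circle_fun_divide [intro]:
  "circle_fun f \<Longrightarrow> circle_fun g \<Longrightarrow> (\<And>x. g x \<noteq> 0) \<Longrightarrow> circle_fun (\<lambda>x. f x / g x)"
  by (auto simp: circle_fun_def intro!: continuous_intros)

lemma circle_fun_sum [intro]:
  "(\<And>i. i \<in> I \<Longrightarrow> circle_fun (f i)) \<Longrightarrow> circle_fun (\<lambda>x. \<Sum>i\<in>I. f i x)"
  by (auto simp: circle_fun_def intro!: continuous_intros)

lemma circle_fun_shift: "circle_fun f \<Longrightarrow> circle_fun (\<lambda>x. f (x + c))"
  unfolding circle_fun_def
  by (auto simp: add.commute add.left_commute intro!: continuous_intros continuous_on_compose2 [of UNIV f UNIV "\<lambda>x. x + c"])
    (metis add.commute add.left_commute)

lemma circle_fun_add_of_int: "circle_fun f \<Longrightarrow> f (x + of_int m) = f x"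
  by (rule periodic_add_of_int [of f]) (rule circle_fun_per)

lemma circle_fun_frac: "circle_fun f \<Longrightarrow> f (frac x) = f x"
  using circle_fun_add_of_int [of f x "- \<lfloor>x\<rfloor>"] by (simp add: frac_def)

lemma circle_fun_bounded:
  assumes "circle_fun f"
  obtains C where "C > 0" "\<And>x. \<bar>f x\<bar> \<le> C"
proof -
  have "compact (f ` {0..1})"
    using assms by (intro compact_continuous_image) (auto simp: circle_fun_def intro: continuous_on_subset)
  then obtain C where C: "\<And>x. x \<in> {0..1} \<Longrightarrow> \<bar>f x\<bar> \<le> C"
    by (metis bounded_iff compact_imp_bounded imageI real_norm_def)
  have "\<bar>f x\<bar> \<le> \<bar>C\<bar> + 1" for x
    using C [of "frac x"] circle_fun_frac [OF assms, of x] frac_lt_1 [of x] by (auto simp: less_imp_le)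
  then show thesis by (intro that [of "\<bar>C\<bar> + 1"]) auto
qed

lemma primitive_exists:
  fixes f :: "real \<Rightarrow> real"
  assumes "continuous_on UNIV f"
  obtains F where "\<And>x. (F has_real_derivative f x) (at x)" "F 0 = 0"
proof -
  obtain F where F: "\<And>x. (F has_vector_derivative f x) (at x)"
    using einterval_antiderivative [of "-\<infinity>" \<infinity> f] assms
    by (auto simp: continuous_on_eq_continuous_at)
  have "((\<lambda>x. F x - F 0) has_real_derivative f x) (at x)" for x
    using F [of x] by (auto simp: has_real_derivative_iff_has_vector_derivative intro!: derivative_eq_intros)
  then show thesis by (intro that [of "\<lambda>x. F x - F 0"]) auto
qed

lemma primitive_add_one:
  assumes "\<And>x. (F has_real_derivative f x) (at x)" "\<And>x. f (x + 1) = f x"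
  shows "F (x + 1) - F x = F 1 - F 0"
proof -
  have "((\<lambda>x. F (x + 1) - F x) has_real_derivative 0) (at x)" for x
    using assms(1)[of "x+1"] assms(1)[of x] assms(2)[of x]
    by (auto intro!: derivative_eq_intros simp: DERIV_shift)
  then have "(\<lambda>x. F (x + 1) - F x) x = (\<lambda>x. F (x + 1) - F x) 0"
    by (intro DERIV_isconst_all) auto
  then show ?thesis by simp
qed

section \<open>Distance to the integers and localised bumps\<close>

text \<open>
A substitute for the distance to the nearest integer: it is subadditive and, by the concavity
of the sine, comparable to \<open>\<bar>y\<bar>\<close> on \<open>[-1/2, 1/2]\<close>, but its continuity and periodicity are immediate.
\<close>

definition circle_norm :: "real \<Rightarrow> real" where
  "circle_norm y = \<bar>sin (pi * y)\<bar>"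

lemma circle_norm_nonneg [simp]: "0 \<le> circle_norm y"
  by (simp add: circle_norm_def)

lemma circle_norm_0 [simp]: "circle_norm 0 = 0"
  by (simp add: circle_norm_def)

lemma circle_fun_circle_norm: "circle_fun circle_norm"
  by (auto simp: circle_fun_def circle_norm_def ring_distribs intro!: continuous_intros)

lemma circle_norm_add_le: "circle_norm (x + y) \<le> circle_norm x + circle_norm y"
proof -
  have "circle_norm (x + y) = \<bar>sin (pi*x) * cos (pi*y) + cos (pi*x) * sin (pi*y)\<bar>"
    by (simp add: circle_norm_def ring_distribs sin_add)
  also have "\<dots> \<le> \<bar>sin (pi*x) * cos (pi*y)\<bar> + \<bar>cos (pi*x) * sin (pi*y)\<bar>"
    by (rule abs_triangle_ineq)
  also have "\<dots> \<le> circle_norm x + circle_norm y"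
    unfolding abs_mult circle_norm_def
    by (intro add_mono mult_left_le mult_left_le_one_le) auto
  finally show ?thesis .
qed

lemma circle_norm_minus [simp]: "circle_norm (- x) = circle_norm x"
  by (simp add: circle_norm_def)

lemma circle_norm_eq_0_iff: "circle_norm x = 0 \<longleftrightarrow> x \<in> \<int>"
proof -
  have "sin (pi * x) = 0 \<longleftrightarrow> (\<exists>i::int. pi * x = of_int i * pi)"
    by (simp add: sin_zero_iff_int2)
  also have "\<dots> \<longleftrightarrow> x \<in> \<int>" by (auto simp: Ints_def)
  finally show ?thesis by (simp add: circle_norm_def)
qed

text \<open>
On \<open>[0, pi/2]\<close> the sine lies above its chord.
\<close>

lemma circle_norm_ge:
  assumes "\<bar>t\<bar> \<le> 1/2"
  shows "2 * \<bar>t\<bar> \<le> circle_norm t"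
proof -
  have "convex_on {0..pi} (\<lambda>x. - sin x)"
    by (rule f''_ge0_imp_convex [where f' = "\<lambda>x. - cos x" and f'' = sin])
       (auto intro!: derivative_eq_intros sin_ge_zero)
  from convex_onD [OF this, of "2*\<bar>t\<bar>" 0 "pi/2"] assms
  have "2 * \<bar>t\<bar> \<le> sin (pi * \<bar>t\<bar>)" by (simp add: mult.commute)
  also have "\<dots> \<le> circle_norm t"
    by (auto simp: circle_norm_def abs_if)
  finally show ?thesis .
qed

lemma circle_norm_le: "circle_norm t \<le> pi * \<bar>t\<bar>"
  using abs_sin_x_le_abs_x [of "pi * t"] by (simp add: circle_norm_def abs_mult)

lemma eventually_circle_norm_0:
  "eventually P (filtercomap circle_norm (nhds 0)) \<longleftrightarrow> (\<exists>\<delta>>0. \<forall>y. circle_norm y < \<delta> \<longrightarrow> P y)"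
proof
  assume "eventually P (filtercomap circle_norm (nhds 0))"
  then obtain d where "d > 0" "\<And>y. dist (circle_norm y) 0 < d \<Longrightarrow> P y"
    by (auto simp: eventually_filtercomap eventually_nhds_metric)
  then show "\<exists>\<delta>>0. \<forall>y. circle_norm y < \<delta> \<longrightarrow> P y"
    by (intro exI [of _ d]) (simp add: dist_real_def)
next
  assume "\<exists>\<delta>>0. \<forall>y. circle_norm y < \<delta> \<longrightarrow> P y"
  then obtain d where d: "d > 0" "\<And>y. circle_norm y < d \<Longrightarrow> P y" by blast
  show "eventually P (filtercomap circle_norm (nhds 0))"
    unfolding eventually_filtercomap eventually_nhds_metric
    by (intro exI [of _ "\<lambda>r. r < d"] conjI exI [of _ d]) (auto simp: d dist_real_def)
qed

lemma circle_fun_near_0: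
  assumes f: "circle_fun f" and "f 0 < c"
  shows "eventually (\<lambda>y. f y < c) (filtercomap circle_norm (nhds 0))"
proof -
  have "isCont f 0" using f by (simp add: circle_fun_def continuous_on_eq_continuous_at)
  then have "eventually (\<lambda>y. f y < c) (nhds 0)"
    using \<open>f 0 < c\<close> by (metis isCont_def order_tendstoD(2) tendsto_at_iff_tendsto_nhds)
  then obtain d where d: "d > 0" "\<And>y. \<bar>y\<bar> < d \<Longrightarrow> f y < c"
    by (auto simp: eventually_nhds_metric dist_real_def)
  have "f y < c" if y: "circle_norm y < d" for y
  proof -
    define y' where "y' = y + of_int (- round y)"
    have "\<bar>y'\<bar> \<le> 1/2" using of_int_round_abs_le [of y] by (simp add: y'_def abs_minus_commute)
    then have "2 * \<bar>y'\<bar> \<le> circle_norm y'" by (rule circle_norm_ge)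
    also have "\<dots> = circle_norm y" unfolding y'_def by (rule circle_fun_add_of_int [OF circle_fun_circle_norm])
    finally have "\<bar>y'\<bar> < d" using y by linarith
    then have "f y' < c" by (rule d)
    then show "f y < c" unfolding y'_def by (simp only: circle_fun_add_of_int [OF f])
  qed
  then show ?thesis using d(1) by (auto simp: eventually_circle_norm_0)
qed

definition bump :: "real \<Rightarrow> (real \<Rightarrow> real) \<Rightarrow> bool" where
  "bump \<delta> s \<longleftrightarrow> circle_fun s \<and> (\<forall>y. 0 \<le> s y \<and> s y \<le> 1 \<and> (s y \<noteq> 0 \<longrightarrow> circle_norm y < \<delta>))"

text \<open>
Within one period the support of \<open>s\<close> has length at most \<open>\<delta>\<close>. This is how the smallness of a
modification of a density is measured; the bound by the length of the interval plus one covers all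
translates at once.
\<close>

lemma bump_primitive_le:
  assumes s: "bump \<delta> s" and \<delta>: "0 < \<delta>" "\<delta> \<le> 1"
    and T: "\<And>x. (T has_real_derivative s x) (at x)" and "a \<le> b"
  shows "0 \<le> T b - T a" "T b - T a \<le> \<delta> * (b - a + 1)"
proof -
  have mono: "T x \<le> T y" if "x \<le> y" for x y
    using DERIV_nonneg_imp_nondecreasing [OF that, of T] T s by (auto simp: bump_def)
  then show "0 \<le> T b - T a" using \<open>a \<le> b\<close> by simp
  have zero: "s y = 0" if "\<delta>/2 \<le> \<bar>y\<bar>" "\<bar>y\<bar> \<le> 1/2" for y
    using circle_norm_ge [of y] that s unfolding bump_def by force
  have "T 1 - T 0 = T (-1/2 + 1) - T (-1/2)"
    using primitive_add_one [OF T, of "-1/2"] s by (simp add: bump_def circle_fun_per)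
  also have "\<dots> \<le> \<delta>"
  proof -
    have 1: "T (-\<delta>/2) \<le> T (-1/2)"
      by (rule DERIV_nonpos_imp_nonincreasing) (use \<delta> T zero in \<open>auto intro!: exI[of _ "s _"]\<close>)
    have 2: "T (1/2) \<le> T (\<delta>/2)"
      by (rule DERIV_nonpos_imp_nonincreasing) (use \<delta> T zero in \<open>auto intro!: exI[of _ "s _"]\<close>)
    have 3: "T (\<delta>/2) - \<delta>/2 \<le> T (-\<delta>/2) - (-\<delta>/2)"
    proof (rule DERIV_nonpos_imp_nonincreasing [where f = "\<lambda>x. T x - x"])
      fix x
      have "((\<lambda>x. T x - x) has_real_derivative s x - 1) (at x)"
        by (auto intro!: derivative_eq_intros T)
      then show "\<exists>y. ((\<lambda>x. T x - x) has_real_derivative y) (at x) \<and> y \<le> 0"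
        using s by (auto simp: bump_def)
    qed (use \<delta> in auto)
    show ?thesis using 1 2 3 by simp
  qed
  finally have one: "T 1 - T 0 \<le> \<delta>" .
  have iter: "T (a + real n) \<le> T a + real n * \<delta>" for n
  proof (induction n)
    case (Suc n)
    have "T (a + real n + 1) - T (a + real n) \<le> \<delta>"
      using primitive_add_one [OF T, of "a + real n"] s one by (simp add: bump_def circle_fun_per)
    then show ?case using Suc by (simp add: algebra_simps)
  qed simp
  define n where "n = nat \<lceil>b - a\<rceil>"
  have n: "b \<le> a + real n" "real n \<le> b - a + 1"
    using \<open>a \<le> b\<close> unfolding n_def by linarith+
  have "T b \<le> T a + real n * \<delta>" using mono [OF n(1)] iter [of n] by linarith
  also have "real n * \<delta> \<le> (b - a + 1) * \<delta>" using n \<delta> by simp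
  finally show "T b - T a \<le> \<delta> * (b - a + 1)" by (simp add: mult.commute)
qed

section \<open>Weights modified along the orbits of a rotation\<close>

definition weight :: "(real \<Rightarrow> real) \<Rightarrow> bool" where
  "weight k \<longleftrightarrow> circle_fun k \<and> (\<forall>x. 0 < k x)"

locale irrational_rotation =
  fixes \<alpha> :: real
  assumes irrational: "\<alpha> \<notin> \<rat>"
begin

text \<open>
If \<open>k\<close> is the density of \<open>K\<close> and \<open>h (K x) = K (x + \<alpha>)\<close>, this is the derivative of \<open>h\<close> plus its inverse
at \<open>K x\<close>. It does not change when \<open>k\<close> is multiplied by a constant.
\<close>

definition potential :: "(real \<Rightarrow> real) \<Rightarrow> real \<Rightarrow> real" where
  "potential k x = (k (x + \<alpha>) + k (x - \<alpha>)) / k x"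

text \<open>
The factor by which a weight is multiplied. Near the point \<open>y + j * \<alpha>\<close>, with \<open>y\<close> in the support of
\<open>s\<close>, it equals \<open>1 + s y * E j y\<close> as soon as that support is small enough for its first translates to
be disjoint; summing over all translates makes it a continuous periodic function without further
ado.
\<close>

definition tower :: "int \<Rightarrow> (int \<Rightarrow> real \<Rightarrow> real) \<Rightarrow> (real \<Rightarrow> real) \<Rightarrow> real \<Rightarrow> real" where
  "tower P E s x = 1 + (\<Sum>j\<in>{-P..P}. s (x - of_int j * \<alpha>) * E j (x - of_int j * \<alpha>))"

lemma mult_alpha_notin_Ints: "j \<noteq> 0 \<Longrightarrow> of_int j * \<alpha> \<notin> \<int>"
proof
  assume j: "j \<noteq> 0" and "of_int j * \<alpha> \<in> \<int>"
  then obtain m where "of_int j * \<alpha> = of_int m" by (auto elim: Ints_cases)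
  then have "\<alpha> = of_int m / of_int j" using j by (simp add: field_simps)
  then show False using irrational by (metis Rats_divide Rats_of_int)
qed

text \<open>
Finitely many nonzero multiples of \<open>\<alpha>\<close> stay away from the integers.
\<close>

lemma orbit_separated:
  obtains \<delta> where "0 < \<delta>" "\<delta> \<le> 1"
    "\<And>j y. j \<noteq> 0 \<Longrightarrow> \<bar>j\<bar> \<le> P \<Longrightarrow> circle_norm y < \<delta> \<Longrightarrow> \<delta> \<le> circle_norm (y + of_int j * \<alpha>)"
proof -
  define S where "S = insert 2 ((\<lambda>j. circle_norm (of_int j * \<alpha>)) ` ({-P..P} - {0}))"
  have pos: "\<forall>d\<in>S. 0 < d"
    using mult_alpha_notin_Ints circle_norm_eq_0_iff
    by (fastforce simp: S_def less_le eq_commute[of 0])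
  have fin: "finite S" "S \<noteq> {}" by (auto simp: S_def)
  define \<delta> where "\<delta> = Min S / 2"
  have "0 < \<delta>" using pos fin by (simp add: \<delta>_def)
  moreover have "\<delta> \<le> 1"
    using fin by (simp add: \<delta>_def S_def)
  moreover have "\<delta> \<le> circle_norm (y + of_int j * \<alpha>)" if "j \<noteq> 0" "\<bar>j\<bar> \<le> P" "circle_norm y < \<delta>" for j y
  proof -
    have "circle_norm (of_int j * \<alpha>) \<in> S"
      using that unfolding S_def by (intro insertI2 image_eqI [of _ _ j]) auto
    then have "2 * \<delta> \<le> circle_norm (of_int j * \<alpha>)"
      using fin by (simp add: \<delta>_def)
    also have "\<dots> \<le> circle_norm (y + of_int j * \<alpha>) + circle_norm (- y)"
      using circle_norm_add_le [of "y + of_int j * \<alpha>" "-y"] by simp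
    finally show ?thesis using that by simp
  qed
  ultimately show thesis by (rule that)
qed

text \<open>
One step of the construction, with relative error \<open>\<rho>\<close> for the potential and error \<open>\<eta>\<close> for the
primitive. The primitives grow linearly at rates that change with \<open>k\<close>, so their distance is
measured against \<open>1 + \<bar>x\<bar>\<close>.
\<close>

definition perturbation :: "real \<Rightarrow> real \<Rightarrow> (real \<Rightarrow> real) \<Rightarrow> (real \<Rightarrow> real) \<Rightarrow> bool" where
  "perturbation \<rho> \<eta> k k' \<longleftrightarrow>
     weight k' \<and> (\<forall>x. k x / 2 \<le> k' x) \<and> (\<forall>x. \<bar>potential k' x - potential k x\<bar> \<le> \<rho> * potential k x) \<and>
     (\<forall>K K'. (\<forall>x. (K has_real_derivative k x) (at x)) \<longrightarrow> (\<forall>x. (K' has_real_derivative k' x) (at x)) \<longrightarrow>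
        K 0 = 0 \<longrightarrow> K' 0 = 0 \<longrightarrow> (\<forall>x. \<bar>K' x - K x\<bar> \<le> \<eta> * (1 + \<bar>x\<bar>)))"

text \<open>
Where \<open>k\<close> is multiplied by \<open>w\<close>, the potential at \<open>x\<close> changes by
\<open>(k (x + \<alpha>) * (w (x + \<alpha>) - w x) + k (x - \<alpha>) * (w (x - \<alpha>) - w x)) / (k x * w x)\<close>. The two
alternatives in the hypothesis are the two ways of keeping this small: either the two terms cancel,
which says that \<open>k\<^sub>j * k\<^sub>j\<^sub>+\<^sub>1 * (w\<^sub>j\<^sub>+\<^sub>1 - w\<^sub>j)\<close> is locally constant in \<open>j\<close>, or \<open>w\<close> has small relative
increments along the orbit. The conditions concern \<open>E\<close> near the origin only, and hold for every
height \<open>\<sigma>\<close> of the bump; the bump may then be chosen as narrow as desired, which makes the change of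
the primitive small.
\<close>

lemma tower_modification:
  fixes E :: "int \<Rightarrow> real \<Rightarrow> real"
  assumes k: "weight k" and E: "\<And>j. circle_fun (E j)" and P: "\<And>j y. \<bar>j\<bar> > P \<Longrightarrow> E j y = 0" "P \<ge> 0"
    and "\<delta>\<^sub>0 > 0" "\<rho> \<ge> 0" "\<eta> > 0"
    and half: "\<And>j y \<sigma>. circle_norm y < \<delta>\<^sub>0 \<Longrightarrow> 0 \<le> \<sigma> \<Longrightarrow> \<sigma> \<le> 1 \<Longrightarrow> 1/2 \<le> 1 + \<sigma> * E j y"
    and cost: "\<And>j y \<sigma>. circle_norm y < \<delta>\<^sub>0 \<Longrightarrow> 0 \<le> \<sigma> \<Longrightarrow> \<sigma> \<le> 1 \<Longrightarrow>
       k (y + of_int (j+1) * \<alpha>) * (E (j+1) y - E j y) = k (y + of_int (j-1) * \<alpha>) * (E j y - E (j-1) y) \<or>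
       \<sigma> * \<bar>E (j+1) y - E j y\<bar> \<le> \<rho> * (1 + \<sigma> * E j y) \<and> \<sigma> * \<bar>E (j-1) y - E j y\<bar> \<le> \<rho> * (1 + \<sigma> * E j y)"
  obtains \<delta>\<^sub>1 where "0 < \<delta>\<^sub>1" "\<delta>\<^sub>1 \<le> 1"
    "\<And>\<delta> s k'. \<lbrakk>0 < \<delta>; \<delta> \<le> \<delta>\<^sub>1; bump \<delta> s; k' = (\<lambda>x. k x * tower P E s x)\<rbrakk> \<Longrightarrow>
        perturbation \<rho> \<eta> k k' \<and>
        (\<forall>j y. circle_norm y < \<delta> \<longrightarrow> \<bar>j\<bar> \<le> P \<longrightarrow>
           k' (y + of_int j * \<alpha>) = k (y + of_int j * \<alpha>) * (1 + s y * E j y))"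
proof -
  have "circle_fun k" using k by (simp add: weight_def)
  have kpos: "0 < k x" for x using k by (simp add: weight_def)
  obtain \<delta>\<^sub>2 where \<delta>2: "0 < \<delta>\<^sub>2" "\<delta>\<^sub>2 \<le> 1"
    and sep2: "\<And>j y. j \<noteq> 0 \<Longrightarrow> \<bar>j\<bar> \<le> 2*P+2 \<Longrightarrow> circle_norm y < \<delta>\<^sub>2 \<Longrightarrow> \<delta>\<^sub>2 \<le> circle_norm (y + of_int j * \<alpha>)"
    using orbit_separated [where P = "2*P+2"] by blast
  have "\<exists>C. \<forall>j\<in>{-P..P}. C j > 0 \<and> (\<forall>x. k x * \<bar>E j (x - of_int j * \<alpha>)\<bar> \<le> C j)"
  proof (intro bchoice ballI)
    fix j
    have "circle_fun (\<lambda>x. k x * \<bar>E j (x + - (of_int j * \<alpha>))\<bar>)"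
      using E \<open>circle_fun k\<close> by (intro circle_fun_mult circle_fun_abs circle_fun_shift)
    then obtain C where "C > 0" "\<And>x. \<bar>k x * \<bar>E j (x + - (of_int j * \<alpha>))\<bar>\<bar> \<le> C"
      by (rule circle_fun_bounded) blast
    then show "\<exists>C. C > 0 \<and> (\<forall>x. k x * \<bar>E j (x - of_int j * \<alpha>)\<bar> \<le> C)"
      by (auto intro!: exI [of _ C] intro: order_trans [OF abs_ge_self])
  qed
  then obtain C where C: "\<And>j. j \<in> {-P..P} \<Longrightarrow> C j > 0"
      "\<And>j x. j \<in> {-P..P} \<Longrightarrow> k x * \<bar>E j (x - of_int j * \<alpha>)\<bar> \<le> C j"
    by blast
  \<comment> \<open>The change of the density is at most \<open>C j\<close> times the
    \<open>j\<close>-th translate of the bump, so over an interval of length \<open>L\<close> the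
    primitive changes by at most \<open>S * \<delta> * (L + 1)\<close>.\<close>
  define S where "S = sum C {-P..P}"
  have "S > 0" unfolding S_def using C P(2) by (intro sum_pos) auto
  define \<delta>\<^sub>1 where "\<delta>\<^sub>1 = min (min \<delta>\<^sub>0 \<delta>\<^sub>2) (\<eta> / S)"
  have "0 < \<delta>\<^sub>1" "\<delta>\<^sub>1 \<le> 1" using \<open>\<delta>\<^sub>0 > 0\<close> \<delta>2 \<open>\<eta> > 0\<close> \<open>S > 0\<close> by (auto simp: \<delta>\<^sub>1_def)
  show thesis
  proof (rule that [OF \<open>0 < \<delta>\<^sub>1\<close> \<open>\<delta>\<^sub>1 \<le> 1\<close>])
    fix \<delta> s k'
    assume \<delta>: "0 < \<delta>" "\<delta> \<le> \<delta>\<^sub>1" and s: "bump \<delta> s" and k': "k' = (\<lambda>x. k x * tower P E s x)"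
    have \<delta>le: "\<delta> \<le> \<delta>\<^sub>0" "\<delta> \<le> \<delta>\<^sub>2" "\<delta> \<le> 1" "S * \<delta> \<le> \<eta>"
      using \<delta> \<delta>2 \<open>S > 0\<close> by (auto simp: \<delta>\<^sub>1_def field_simps)
    have s01: "0 \<le> s y" "s y \<le> 1" and s0: "circle_norm y \<ge> \<delta> \<Longrightarrow> s y = 0" for y
      using s by (auto simp: bump_def not_less [symmetric])
    have sep: "s (y + of_int j * \<alpha>) = 0" if "j \<noteq> 0" "\<bar>j\<bar> \<le> 2*P+2" "circle_norm y < \<delta>" for j y
      using sep2 [of j y] that \<delta>le by (intro s0) linarith
    \<comment> \<open>The range reaches \<open>P + 2\<close> because the potential next to the
      outermost level involves one level more.\<close>
    have inside: "tower P E s (y + of_int j * \<alpha>) = 1 + s y * E j y"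
      if y: "circle_norm y < \<delta>" and j: "\<bar>j\<bar> \<le> P + 2" for y j
    proof -
      have "(\<Sum>i\<in>{-P..P}. s (y + of_int j * \<alpha> - of_int i * \<alpha>) * E i (y + of_int j * \<alpha> - of_int i * \<alpha>))
          = (\<Sum>i\<in>{-P..P}. if i = j then s y * E j y else 0)"
      proof (rule sum.cong)
        fix i assume i: "i \<in> {-P..P}"
        show "s (y + of_int j * \<alpha> - of_int i * \<alpha>) * E i (y + of_int j * \<alpha> - of_int i * \<alpha>)
            = (if i = j then s y * E j y else 0)"
          using sep [of "j - i" y] y i j by (auto simp: algebra_simps)
      qed simp
      also have "\<dots> = s y * E j y" using P(1) [of j] by (auto simp: abs_le_iff)
      finally show ?thesis by (simp add: tower_def)
    qed
    have outside: "tower P E s x = 1" if "\<And>j. \<bar>j\<bar> \<le> P \<Longrightarrow> \<delta> \<le> circle_norm (x - of_int j * \<alpha>)" for x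
      unfolding tower_def using that by (simp add: s0 abs_le_iff)
    have tower_half: "1/2 \<le> tower P E s x" for x
    proof (cases "\<exists>j. \<bar>j\<bar> \<le> P \<and> circle_norm (x - of_int j * \<alpha>) < \<delta>")
      case True
      then obtain j where j: "\<bar>j\<bar> \<le> P" "circle_norm (x - of_int j * \<alpha>) < \<delta>" by blast
      show ?thesis
        using inside [OF j(2), of j] j half [of "x - of_int j * \<alpha>" "s (x - of_int j * \<alpha>)" j] s01 \<delta>le by simp
    next
      case False
      then show ?thesis using outside [of x] by force
    qed
    have tower_circle: "circle_fun (tower P E s)"
    proof -
      have "circle_fun (\<lambda>x. 1 + (\<Sum>j\<in>{-P..P}. s (x + - (of_int j * \<alpha>)) * E j (x + - (of_int j * \<alpha>))))"
      proof (intro circle_fun_add circle_fun_sum circle_fun_const)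
        fix j
        show "circle_fun (\<lambda>x. s (x + - (of_int j * \<alpha>)) * E j (x + - (of_int j * \<alpha>)))"
          using s E by (intro circle_fun_mult [OF circle_fun_shift circle_fun_shift]) (auto simp: bump_def)
      qed
      moreover have "tower P E s = (\<lambda>x. 1 + (\<Sum>j\<in>{-P..P}. s (x + - (of_int j * \<alpha>)) * E j (x + - (of_int j * \<alpha>))))"
        by (auto simp: tower_def)
      ultimately show ?thesis by simp
    qed
    have A: "weight k'"
      unfolding weight_def k'
    proof (intro conjI allI)
      show "circle_fun (\<lambda>x. k x * tower P E s x)"
        using tower_circle \<open>circle_fun k\<close> by (rule circle_fun_mult [rotated])
      show "0 < k x * tower P E s x" for x
        using kpos [of x] tower_half [of x] by (intro mult_pos_pos) auto
    qed
    have B: "k x / 2 \<le> k' x" for x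
      using mult_left_mono [OF tower_half [of x], of "k x"] kpos [of x] by (simp add: k')
    have D: "k' (y + of_int j * \<alpha>) = k (y + of_int j * \<alpha>) * (1 + s y * E j y)"
      if "circle_norm y < \<delta>" "\<bar>j\<bar> \<le> P" for j y
      using inside that by (simp add: k')
    have pot_diff: "\<bar>potential k' x - potential k x\<bar> \<le> \<rho> * potential k x" for x
    proof (cases "\<exists>j. \<bar>j\<bar> \<le> P + 1 \<and> circle_norm (x - of_int j * \<alpha>) < \<delta>")
      case False
      then have far: "\<delta> \<le> circle_norm (x - of_int j * \<alpha>)" if "\<bar>j\<bar> \<le> P + 1" for j
        using that by (meson not_le)
      have "tower P E s x = 1" by (intro outside far) linarith
      moreover have "tower P E s (x + \<alpha>) = 1"
        using far [of "j - 1" for j] by (intro outside) (force simp: algebra_simps)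
      moreover have "tower P E s (x - \<alpha>) = 1"
        using far [of "j + 1" for j] by (intro outside) (force simp: algebra_simps)
      ultimately have "potential k' x = potential k x" by (simp add: potential_def k')
      moreover have "0 \<le> \<rho> * potential k x"
        using \<open>\<rho> \<ge> 0\<close> kpos [of x] kpos [of "x + \<alpha>"] kpos [of "x - \<alpha>"] by (simp add: potential_def)
      ultimately show ?thesis by simp
    next
      case True
      then obtain j where j: "\<bar>j\<bar> \<le> P + 1" and "circle_norm (x - of_int j * \<alpha>) < \<delta>" by blast
      define y where "y = x - of_int j * \<alpha>"
      have y: "circle_norm y < \<delta>" using \<open>circle_norm (x - of_int j * \<alpha>) < \<delta>\<close> by (simp add: y_def)
      define w where "w = 1 + s y * E j y"
      define a where "a = k (x + \<alpha>)" 
      define b where "b = k (x - \<alpha>)"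
      define c where "c = k x"
      have pos: "a > 0" "b > 0" "c > 0" using kpos by (auto simp: a_def b_def c_def)
      have x: "y + of_int j * \<alpha> = x" "y + of_int (j+1) * \<alpha> = x + \<alpha>" "y + of_int (j-1) * \<alpha> = x - \<alpha>"
        by (auto simp: y_def algebra_simps)
      have w0: "tower P E s x = w"
        using inside [OF y, of j] j by (simp add: x w_def)
      have w1: "tower P E s (x + \<alpha>) = w + s y * (E (j+1) y - E j y)"
        using inside [OF y, of "j+1"] j unfolding x by (simp add: w_def algebra_simps)
      have w2: "tower P E s (x - \<alpha>) = w + s y * (E (j-1) y - E j y)"
        using inside [OF y, of "j-1"] j unfolding x by (simp add: w_def algebra_simps)
      have wpos: "w > 0" using tower_half [of x] w0 by simp
      \<comment> \<open>The formula for the change of the potential on which the two alternatives of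
        the hypothesis rest.\<close>
      have eq: "potential k' x - potential k x =
          s y * (a * (E (j+1) y - E j y) - b * (E j y - E (j-1) y)) / (c * w)"
        unfolding potential_def k' w0 w1 w2 a_def [symmetric] b_def [symmetric] c_def [symmetric]
        using pos wpos by (simp add: field_simps)
      have pot: "potential k x = (a + b) / c" by (simp add: potential_def a_def b_def c_def)
      consider "a * (E (j+1) y - E j y) = b * (E j y - E (j-1) y)"
        | "s y * \<bar>E (j+1) y - E j y\<bar> \<le> \<rho> * w" "s y * \<bar>E (j-1) y - E j y\<bar> \<le> \<rho> * w"
        using cost [of y "s y" j] y \<delta>le s01 unfolding x a_def b_def w_def by (meson less_le_trans)
      then show ?thesis
      proof cases
        case 1
        then show ?thesis using eq pos \<open>\<rho> \<ge> 0\<close> by (simp add: pot)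
      next
        case 2
        have "\<bar>s y * (a * (E (j+1) y - E j y) - b * (E j y - E (j-1) y))\<bar>
            = \<bar>a * (s y * (E (j+1) y - E j y)) + b * (s y * (E (j-1) y - E j y))\<bar>"
          by (simp add: algebra_simps)
        also have "\<dots> \<le> a * (s y * \<bar>E (j+1) y - E j y\<bar>) + b * (s y * \<bar>E (j-1) y - E j y\<bar>)"
          using pos s01 [of y] by (intro order_trans [OF abs_triangle_ineq]) (simp add: abs_mult)
        also have "\<dots> \<le> a * (\<rho> * w) + b * (\<rho> * w)"
          using 2 pos by (intro add_mono mult_left_mono) auto
        finally have *: "\<bar>s y * (a * (E (j+1) y - E j y) - b * (E j y - E (j-1) y))\<bar> \<le> \<rho> * (a + b) * w"
          by (simp add: algebra_simps)
        have "\<bar>potential k' x - potential k x\<bar> \<le> \<rho> * (a + b) * w / (c * w)"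
          unfolding eq abs_divide using * pos wpos by (intro frac_le) auto
        also have "\<dots> = \<rho> * potential k x" using pos wpos by (simp add: pot)
        finally show ?thesis .
      qed
    qed
    have close: "\<bar>K' x - K x\<bar> \<le> \<eta> * (1 + \<bar>x\<bar>)"
      if K: "\<And>x. (K has_real_derivative k x) (at x)" and K': "\<And>x. (K' has_real_derivative k' x) (at x)"
        and "K 0 = 0" "K' 0 = 0" for K K' x
    proof -
      obtain T where T: "\<And>x. (T has_real_derivative s x) (at x)"
        by (rule primitive_exists [of s]) (use s in \<open>auto simp: bump_def circle_fun_def\<close>)
      define H where "H x = (\<Sum>j\<in>{-P..P}. C j * T (x + - (of_int j * \<alpha>)))" for x
      have H: "(H has_real_derivative (\<Sum>j\<in>{-P..P}. C j * s (x - of_int j * \<alpha>))) (at x)" for x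
      proof -
        have "((\<lambda>x. C j * T (x + - (of_int j * \<alpha>))) has_real_derivative C j * s (x - of_int j * \<alpha>)) (at x)" for j
        proof -
          have "((\<lambda>x. T (x + - (of_int j * \<alpha>))) has_real_derivative s (x - of_int j * \<alpha>)) (at x)"
            using T [of "x - of_int j * \<alpha>"] DERIV_shift [of T "s (x - of_int j * \<alpha>)" x "- (of_int j * \<alpha>)"] by simp
          then show ?thesis by (rule DERIV_cmult)
        qed
        then show ?thesis unfolding H_def [abs_def] by (intro DERIV_sum)
      qed
      have der_le: "\<bar>k' x - k x\<bar> \<le> (\<Sum>j\<in>{-P..P}. C j * s (x - of_int j * \<alpha>))" for x
      proof -
        have "k' x - k x = (\<Sum>j\<in>{-P..P}. s (x - of_int j * \<alpha>) * (k x * E j (x - of_int j * \<alpha>)))"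
          by (simp add: k' tower_def algebra_simps sum_distrib_left)
        also have "\<bar>\<dots>\<bar> \<le> (\<Sum>j\<in>{-P..P}. \<bar>s (x - of_int j * \<alpha>) * (k x * E j (x - of_int j * \<alpha>))\<bar>)"
          by (rule sum_abs)
        also have "\<dots> \<le> (\<Sum>j\<in>{-P..P}. C j * s (x - of_int j * \<alpha>))"
        proof (rule sum_mono)
          fix j assume "j \<in> {-P..P}"
          then have "s (x - of_int j * \<alpha>) * (k x * \<bar>E j (x - of_int j * \<alpha>)\<bar>) \<le> s (x - of_int j * \<alpha>) * C j"
            using C(2) s01 by (intro mult_left_mono) auto
          then show "\<bar>s (x - of_int j * \<alpha>) * (k x * E j (x - of_int j * \<alpha>))\<bar> \<le> C j * s (x - of_int j * \<alpha>)"
            using s01 kpos [of x] by (simp add: abs_mult mult.commute)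
        qed
        finally show ?thesis .
      qed
      have Hle: "H b - H a \<le> \<eta> * (b - a + 1)" if "a \<le> b" for a b
      proof -
        have "H b - H a = (\<Sum>j\<in>{-P..P}. C j * (T (b + - (of_int j * \<alpha>)) - T (a + - (of_int j * \<alpha>))))"
          by (simp add: H_def sum_subtractf algebra_simps)
        also have "\<dots> \<le> (\<Sum>j\<in>{-P..P}. C j * (\<delta> * (b - a + 1)))"
        proof (intro sum_mono mult_left_mono)
          fix j assume "j \<in> {-P..P}"
          show "T (b + - (of_int j * \<alpha>)) - T (a + - (of_int j * \<alpha>)) \<le> \<delta> * (b - a + 1)"
            using bump_primitive_le(2) [OF s \<delta>(1) \<delta>le(3) T, of "a + - (of_int j * \<alpha>)" "b + - (of_int j * \<alpha>)"] that
            by simp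
        qed (use C in \<open>auto intro: less_imp_le\<close>)
        also have "\<dots> = (S * \<delta>) * (b - a + 1)" by (simp add: S_def sum_distrib_right mult.assoc)
        also have "\<dots> \<le> \<eta> * (b - a + 1)" using \<delta>le that by (intro mult_right_mono) auto
        finally show ?thesis .
      qed
      have main: "\<bar>(K' b - K b) - (K' a - K a)\<bar> \<le> H b - H a" if "a \<le> b" for a b
      proof -
        have "(K' b - K b) - H b \<le> (K' a - K a) - H a"
        proof (rule DERIV_nonpos_imp_nonincreasing [OF that, where f = "\<lambda>x. (K' x - K x) - H x"])
          fix x
          have "((\<lambda>x. (K' x - K x) - H x) has_real_derivative
              (k' x - k x) - (\<Sum>j\<in>{-P..P}. C j * s (x - of_int j * \<alpha>))) (at x)"
            by (intro DERIV_diff K K' H)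
          then show "\<exists>y. ((\<lambda>x. (K' x - K x) - H x) has_real_derivative y) (at x) \<and> y \<le> 0"
            using der_le [of x] by (intro exI conjI) (assumption, linarith)
        qed
        moreover have "(K' a - K a) + H a \<le> (K' b - K b) + H b"
        proof (rule DERIV_nonneg_imp_nondecreasing [OF that, where f = "\<lambda>x. (K' x - K x) + H x"])
          fix x
          have "((\<lambda>x. (K' x - K x) + H x) has_real_derivative
              (k' x - k x) + (\<Sum>j\<in>{-P..P}. C j * s (x - of_int j * \<alpha>))) (at x)"
            by (intro DERIV_add DERIV_diff K K' H)
          then show "\<exists>y. ((\<lambda>x. (K' x - K x) + H x) has_real_derivative y) (at x) \<and> 0 \<le> y"
            using der_le [of x] by (intro exI conjI) (assumption, linarith)
        qed
        ultimately show ?thesis by linarith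
      qed
      show ?thesis
      proof (cases "x \<ge> 0")
        case True
        then show ?thesis using main [of 0 x] Hle [of 0 x] that by (simp add: add.commute)
      next
        case False
        then show ?thesis using main [of x 0] Hle [of x 0] that by (simp add: add.commute abs_minus_commute)
      qed
    qed
    show "perturbation \<rho> \<eta> k k' \<and>
        (\<forall>j y. circle_norm y < \<delta> \<longrightarrow> \<bar>j\<bar> \<le> P \<longrightarrow>
           k' (y + of_int j * \<alpha>) = k (y + of_int j * \<alpha>) * (1 + s y * E j y))"
      unfolding perturbation_def using A B pot_diff D close by blast
  qed
qed

end

section \<open>Growth along the orbit of the origin\<close>

text \<open>
For \<open>f i = c * (1 + \<epsilon> * i)\<close> the sum telescopes, because
\<open>\<epsilon> / ((1 + \<epsilon> * i) * (1 + \<epsilon> * (i + 1)))\<close> is a difference of consecutive reciprocals.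
\<close>

lemma inverse_products_sum_le:
  fixes f :: "nat \<Rightarrow> real"
  assumes "c > 0" "\<epsilon> > 0" and f: "\<And>i. i \<le> M \<Longrightarrow> c * (1 + \<epsilon> * real i) \<le> f i"
  shows "(\<Sum>i<M. 1 / (f i * f (Suc i))) \<le> 1 / (c\<^sup>2 * \<epsilon>)"
proof -
  have "(\<Sum>i<m. 1 / (f i * f (Suc i))) \<le> 1 / (c\<^sup>2 * \<epsilon>) * (1 - 1 / (1 + \<epsilon> * real m))" if "m \<le> M" for m
    using that
  proof (induction m)
    case (Suc m)
    define a where "a = 1 + \<epsilon> * real m"
    have a: "a > 0" using \<open>\<epsilon> > 0\<close> by (simp add: a_def add_pos_nonneg)
    have a': "1 + \<epsilon> * real (Suc m) = a + \<epsilon>" by (simp add: a_def algebra_simps)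
    have fm: "c * a \<le> f m" "c * (a + \<epsilon>) \<le> f (Suc m)"
      using f [of m] f [of "Suc m"] Suc.prems unfolding a' a_def [symmetric] by simp_all
    moreover have ca: "0 < c * a" "0 < c * (a + \<epsilon>)" using a \<open>c > 0\<close> \<open>\<epsilon> > 0\<close> by simp_all
    ultimately have "(c * a) * (c * (a + \<epsilon>)) \<le> f m * f (Suc m)"
      by (intro mult_mono) linarith+
    then have "1 / (f m * f (Suc m)) \<le> 1 / ((c * a) * (c * (a + \<epsilon>)))"
      using mult_pos_pos [OF ca] by (intro divide_left_mono) (auto intro: mult_pos_pos less_le_trans)
    also have "\<dots> = 1 / (c\<^sup>2 * \<epsilon>) * (1 / a - 1 / (a + \<epsilon>))"
      using a \<open>c > 0\<close> \<open>\<epsilon> > 0\<close> by (simp add: field_simps power2_eq_square)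
    finally have "(\<Sum>i<Suc m. 1 / (f i * f (Suc i)))
        \<le> 1 / (c\<^sup>2 * \<epsilon>) * (1 - 1 / a) + 1 / (c\<^sup>2 * \<epsilon>) * (1 / a - 1 / (a + \<epsilon>))"
      using Suc by (simp add: a_def [symmetric])
    also have "\<dots> = 1 / (c\<^sup>2 * \<epsilon>) * (1 - 1 / (a + \<epsilon>))"
      by (simp flip: distrib_left add_divide_distrib)
    finally show ?case by (simp only: a')
  qed simp
  from this [of M] have "(\<Sum>i<M. 1 / (f i * f (Suc i))) \<le> 1 / (c\<^sup>2 * \<epsilon>) * (1 - 1 / (1 + \<epsilon> * real M))" by simp
  also have "\<dots> \<le> 1 / (c\<^sup>2 * \<epsilon>) * 1"
    using \<open>c > 0\<close> \<open>\<epsilon> > 0\<close> by (intro mult_left_mono) auto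
  finally show ?thesis by simp
qed

context irrational_rotation
begin

text \<open>
With \<open>k\<^sub>j * k\<^sub>j\<^sub>+\<^sub>1\<close> as the conductance between neighbours on the orbit of \<open>y\<close>, this is the resistance of
the first \<open>m\<close> links in the direction \<open>\<sigma>\<close>, which is \<open>1\<close> or \<open>-1\<close>.
\<close>

definition resistance :: "(real \<Rightarrow> real) \<Rightarrow> real \<Rightarrow> real \<Rightarrow> nat \<Rightarrow> real" where
  "resistance k \<sigma> y m = (\<Sum>i<m. 1 / (k (y + \<sigma> * real i * \<alpha>) * k (y + \<sigma> * real (Suc i) * \<alpha>)))"

text \<open>
The state before step \<open>n\<close>: the orbit of the origin has been treated up to time \<open>N\<close> in both
directions with total resistance below \<open>3\<close>, and beyond \<open>N\<close> there is a plateau of height \<open>2 ^ n\<close> on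
which the growth of the next step will take place. Starting from the lower bound \<open>(1/2) ^ n\<close> and
growing at rate \<open>(1/2) ^ n\<close>, that step reaches the height \<open>2 ^ (n + 1)\<close> after \<open>2 * 8 ^ n\<close> times, which
is why the plateau has this length. The values at \<open>0\<close> and \<open>\<alpha>\<close> are kept so that the quotient
\<open>k \<alpha> / k 0\<close> is \<open>1\<close> at all stages.
\<close>

definition stage :: "nat \<Rightarrow> (real \<Rightarrow> real) \<Rightarrow> nat \<Rightarrow> bool" where
  "stage n k N \<longleftrightarrow> weight k \<and> 1 \<le> N \<and> (\<forall>x. (1/2) ^ n \<le> k x) \<and> k 0 = 1 \<and> k \<alpha> = 1 \<and>
     (\<forall>j::int. int N \<le> \<bar>j\<bar> \<longrightarrow> \<bar>j\<bar> \<le> int N + 2 * 8 ^ n \<longrightarrow> 2 ^ n \<le> k (of_int j * \<alpha>)) \<and>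
     (\<forall>\<sigma>\<in>{-1, 1}. resistance k \<sigma> 0 N \<le> 3 - 2 * (1/2) ^ n) \<and>
     (\<forall>x. potential k x \<le> 2 * exp (6 - 6 * (1/2) ^ n))"

lemma stage_0: "stage 0 (\<lambda>_. 1) 1"
  by (auto simp: stage_def weight_def resistance_def potential_def)

lemma bump_peak:
  assumes "\<delta> > 0"
  obtains s where "bump \<delta> s" "s 0 = 1"
proof
  show "bump \<delta> (\<lambda>y. max 0 (1 - circle_norm y / \<delta>))"
    unfolding bump_def circle_fun_def
  proof (intro conjI allI impI)
    show "continuous_on UNIV (\<lambda>y. max 0 (1 - circle_norm y / \<delta>))"
      using circle_fun_cont [OF circle_fun_circle_norm] assms by (intro continuous_intros) auto
    fix y :: real
    show "max 0 (1 - circle_norm y / \<delta>) \<le> 1" using assms by simp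
    assume "max 0 (1 - circle_norm y / \<delta>) \<noteq> 0"
    then show "circle_norm y < \<delta>" using assms by (simp add: max_def field_simps split: if_splits)
  qed (simp_all add: circle_fun_per [OF circle_fun_circle_norm])
qed simp

text \<open>
The profile \<open>E\<close> is a tent in \<open>\<bar>j\<bar>\<close> of slope \<open>(1/2) ^ n\<close> that starts at \<open>N\<close>, so its relative increments
are at most \<open>(1/2) ^ n\<close> no matter how the old weight behaves. Over the old plateau it contributes at
most \<open>1 / (4 ^ n * (1/2) ^ n) = (1/2) ^ n\<close> to the resistance; at the end of it the weight has reached the
height of the next plateau, and the apex is put far enough for that plateau to have its full
length. The last assertion is what makes the shear step cheap at its cut-off.
\<close>

lemma growth_step:
  assumes st: "stage n k N" and "\<eta> > 0"
  obtains k' N' where "perturbation ((1/2)^n) \<eta> k k'" "1 \<le> N'" "\<And>x. k x \<le> k' x" "k' 0 = 1" "k' \<alpha> = 1"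
    "\<And>j::int. int N' \<le> \<bar>j\<bar> \<Longrightarrow> \<bar>j\<bar> \<le> int N' + 2 * 8 ^ Suc n \<Longrightarrow> 2 ^ Suc n \<le> k' (of_int j * \<alpha>)"
    "\<And>\<sigma>. \<sigma> \<in> {-1, 1} \<Longrightarrow> resistance k' \<sigma> 0 N' \<le> 3 - 2 * (1/2) ^ Suc n"
    "\<And>\<sigma>. \<sigma> \<in> {-1, 1} \<Longrightarrow> 4 ^ n \<le> k' (\<sigma> * real (N' - 1) * \<alpha>) * k' (\<sigma> * real N' * \<alpha>)"
proof -
  define \<epsilon> :: real where "\<epsilon> = (1/2)^n"
  have \<epsilon>: "\<epsilon> > 0" by (simp add: \<epsilon>_def)
  define M :: nat where "M = 2 * 8 ^ n"
  define N' where "N' = N + M"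
  have intN': "int N' = int N + int M" by (simp add: N'_def)
  \<comment> \<open>The tent starts at \<open>N\<close> and returns to zero at \<open>P\<close>; up
    to the end \<open>N' + 2 * 8 ^ Suc n\<close> of the new plateau it does not fall below its
    height at \<open>N'\<close>.\<close>
  define P where "P = 2 * int N' + 2 * 8 ^ Suc n"
  define e :: "int \<Rightarrow> int" where "e j = max 0 (min (\<bar>j\<bar> - int N) (P - \<bar>j\<bar>))" for j
  define E where "E j y = \<epsilon> * of_int (e j)" for j and y :: real
  have k: "weight k" "1 \<le> N" "\<And>x. \<epsilon> \<le> k x" "k 0 = 1" "k \<alpha> = 1"
    and plateau: "\<And>j::int. int N \<le> \<bar>j\<bar> \<Longrightarrow> \<bar>j\<bar> \<le> int N' \<Longrightarrow> 2 ^ n \<le> k (of_int j * \<alpha>)"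
    and res: "\<And>\<sigma>. \<sigma> \<in> {-1, 1} \<Longrightarrow> resistance k \<sigma> 0 N \<le> 3 - 2 * \<epsilon>"
    using st by (auto simp: stage_def \<epsilon>_def M_def N'_def)
  have kpos: "k x > 0" for x using k(1) by (simp add: weight_def)
  have e0: "0 \<le> e j" and e1: "\<bar>e (j+1) - e j\<bar> \<le> 1" "\<bar>e (j-1) - e j\<bar> \<le> 1" for j
    by (auto simp: e_def max_def min_def abs_if)
  have E0: "0 \<le> E j y" for j y using \<epsilon> e0 [of j] by (simp add: E_def)
  have E1: "\<bar>E (j+1) y - E j y\<bar> \<le> \<epsilon>" "\<bar>E (j-1) y - E j y\<bar> \<le> \<epsilon>" for j y
  proof -
    have "\<bar>E i y - E j y\<bar> = \<epsilon> * of_int \<bar>e i - e j\<bar>" for i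
      using \<epsilon> by (simp add: E_def abs_mult flip: right_diff_distrib)
    moreover have "of_int \<bar>e i - e j\<bar> \<le> (1::real)" if "\<bar>e i - e j\<bar> \<le> 1" for i
      using that by linarith
    ultimately show "\<bar>E (j+1) y - E j y\<bar> \<le> \<epsilon>" "\<bar>E (j-1) y - E j y\<bar> \<le> \<epsilon>"
      using e1 [of j] \<epsilon> by (metis mult.right_neutral mult_le_cancel_left_pos)+
  qed
  have Psupp: "E j y = 0" if "\<bar>j\<bar> > P" for j y using that by (simp add: E_def e_def)
  obtain \<delta> where \<delta>: "0 < \<delta>" "\<delta> \<le> 1"
    and tow: "\<And>s k'. \<lbrakk>bump \<delta> s; k' = (\<lambda>x. k x * tower P E s x)\<rbrakk> \<Longrightarrow>
        perturbation \<epsilon> \<eta> k k' \<and>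
        (\<forall>j y. circle_norm y < \<delta> \<longrightarrow> \<bar>j\<bar> \<le> P \<longrightarrow>
           k' (y + of_int j * \<alpha>) = k (y + of_int j * \<alpha>) * (1 + s y * E j y))"
  proof (rule tower_modification [of k E P 1 \<epsilon> \<eta>])
    show "circle_fun (E j)" for j by (simp add: E_def [abs_def])
  next
    fix j y \<sigma>
    assume \<sigma>: "0 \<le> (\<sigma>::real)" "\<sigma> \<le> 1"
    show "1 / 2 \<le> 1 + \<sigma> * E j y" using mult_nonneg_nonneg [OF \<sigma>(1) E0, of j y] by simp
    have "\<sigma> * \<bar>E i y - E j y\<bar> \<le> \<epsilon> * (1 + \<sigma> * E j y)" if "\<bar>E i y - E j y\<bar> \<le> \<epsilon>" for i
    proof -
      have "\<sigma> * \<bar>E i y - E j y\<bar> \<le> 1 * \<epsilon>" using that \<sigma> by (intro mult_mono) auto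
      also have "\<dots> \<le> \<epsilon> * (1 + \<sigma> * E j y)" using \<sigma> E0 [of j y] \<epsilon> by simp
      finally show ?thesis .
    qed
    then show "k (y + of_int (j + 1) * \<alpha>) * (E (j + 1) y - E j y) = k (y + of_int (j - 1) * \<alpha>) * (E j y - E (j - 1) y) \<or>
         \<sigma> * \<bar>E (j + 1) y - E j y\<bar> \<le> \<epsilon> * (1 + \<sigma> * E j y) \<and> \<sigma> * \<bar>E (j - 1) y - E j y\<bar> \<le> \<epsilon> * (1 + \<sigma> * E j y)"
      using E1 [of j y] by blast
  next
    fix \<delta>\<^sub>1 :: real
    assume "0 < \<delta>\<^sub>1" "\<delta>\<^sub>1 \<le> 1" and *: "\<And>\<delta> s k'. \<lbrakk>0 < \<delta>; \<delta> \<le> \<delta>\<^sub>1; bump \<delta> s; k' = (\<lambda>x. k x * tower P E s x)\<rbrakk> \<Longrightarrow>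
        perturbation \<epsilon> \<eta> k k' \<and>
        (\<forall>j y. circle_norm y < \<delta> \<longrightarrow> \<bar>j\<bar> \<le> P \<longrightarrow>
           k' (y + of_int j * \<alpha>) = k (y + of_int j * \<alpha>) * (1 + s y * E j y))"
    show thesis by (rule that [OF \<open>0 < \<delta>\<^sub>1\<close> \<open>\<delta>\<^sub>1 \<le> 1\<close>]) (rule * [OF \<open>0 < \<delta>\<^sub>1\<close> order_refl])
  qed (use k Psupp \<epsilon> \<open>\<eta> > 0\<close> in \<open>auto simp: P_def\<close>)
  obtain s where s: "bump \<delta> s" "s 0 = 1" using bump_peak [OF \<delta>(1)] .
  define k' where "k' = (\<lambda>x. k x * tower P E s x)"
  have pert: "perturbation \<epsilon> \<eta> k k'"
    using tow [OF s(1) k'_def] by blast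
  have orbit: "k' (of_int j * \<alpha>) = k (of_int j * \<alpha>) * (1 + \<epsilon> * of_int (e j))" if "\<bar>j\<bar> \<le> P" for j
  proof -
    have "k' (0 + of_int j * \<alpha>) = k (0 + of_int j * \<alpha>) * (1 + s 0 * E j 0)"
      using tow [OF s(1) k'_def] that \<delta>(1) circle_norm_0 by metis
    then show ?thesis by (simp add: E_def s(2))
  qed
  have NP: "int N' \<le> P" by (simp add: P_def)
  have ge: "k x \<le> k' x" for x
  proof -
    have "1 \<le> tower P E s x"
      using s(1) E0 by (auto simp: tower_def bump_def intro!: sum_nonneg mult_nonneg_nonneg)
    then show ?thesis using kpos [of x] by (simp add: k'_def)
  qed
  have low: "k' (of_int j * \<alpha>) = k (of_int j * \<alpha>)" if "\<bar>j\<bar> \<le> int N" for j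
  proof -
    have "int N \<le> P" by (simp add: P_def N'_def)
    then show ?thesis using orbit [of j] that by (simp add: e_def)
  qed
  have mid: "2 ^ n * (1 + \<epsilon> * of_int (\<bar>j\<bar> - int N)) \<le> k' (of_int j * \<alpha>)" if "int N \<le> \<bar>j\<bar>" "\<bar>j\<bar> \<le> int N'" for j
  proof -
    have "e j = \<bar>j\<bar> - int N"
    proof -
      have "0 \<le> (8::int) ^ Suc n" by simp
      then have "min (\<bar>j\<bar> - int N) (P - \<bar>j\<bar>) = \<bar>j\<bar> - int N"
        using that unfolding P_def by linarith
      then show ?thesis using that by (simp add: e_def)
    qed
    then have "k' (of_int j * \<alpha>) = k (of_int j * \<alpha>) * (1 + \<epsilon> * of_int (\<bar>j\<bar> - int N))"
      using orbit [of j] NP that by simp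
    moreover have "0 \<le> 1 + \<epsilon> * of_int (\<bar>j\<bar> - int N)" using \<epsilon> that by (intro add_nonneg_nonneg mult_nonneg_nonneg) auto
    ultimately show ?thesis using plateau [OF that] by (simp add: mult_right_mono)
  qed
  have far: "2 ^ Suc n \<le> k' (of_int j * \<alpha>)" if "int N' \<le> \<bar>j\<bar>" "\<bar>j\<bar> \<le> int N' + 2 * 8 ^ Suc n" for j
  proof -
    have "int M \<le> e j"
    proof -
      have "int M \<le> \<bar>j\<bar> - int N" "int M \<le> P - \<bar>j\<bar>"
        using that intN' unfolding P_def by linarith+
      then show ?thesis by (simp add: e_def)
    qed
    then have "real M \<le> of_int (e j)" by linarith
    then have "\<epsilon> * (\<epsilon> * real M) \<le> k (of_int j * \<alpha>) * (1 + \<epsilon> * of_int (e j))"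
      using k(3) \<epsilon> kpos [of "of_int j * \<alpha>"] by (intro mult_mono) (auto intro: add_increasing)
    moreover have "\<epsilon> * (\<epsilon> * real M) = 2 ^ Suc n"
    proof -
      have "(8::real) ^ n = 2 ^ n * 2 ^ n * 2 ^ n" by (simp flip: power_mult_distrib)
      then show ?thesis by (simp add: \<epsilon>_def M_def power_one_over field_simps)
    qed
    ultimately show ?thesis using orbit [of j] that by (simp add: P_def)
  qed
  show thesis
  proof (rule that [of k' N'])
    show "k' 0 = 1" using low [of 0] k by simp
    show "k' \<alpha> = 1" using low [of 1] k by simp
    fix \<sigma> :: real assume \<sigma>: "\<sigma> \<in> {-1, 1}"
    obtain z :: int where z: "\<sigma> = of_int z" "\<bar>z\<bar> = 1"
      using that [of 1] that [of "-1"] \<sigma> by auto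
    have zj: "\<sigma> * real i * \<alpha> = of_int (z * int i) * \<alpha>" for i by (simp add: z)
    have zabs: "\<bar>z * int i\<bar> = int i" for i using z by (simp add: abs_mult)
    define f where "f i = k' (\<sigma> * real (N + i) * \<alpha>)" for i
    have f: "2 ^ n * (1 + \<epsilon> * real i) \<le> f i" if "i \<le> M" for i
      using mid [of "z * int (N + i)"] that unfolding f_def zj zabs by (simp add: N'_def)
    have "resistance k' \<sigma> 0 N' = (\<Sum>i<N. 1 / (k' (\<sigma> * real i * \<alpha>) * k' (\<sigma> * real (Suc i) * \<alpha>)))
          + (\<Sum>i<M. 1 / (f i * f (Suc i)))"
      unfolding resistance_def N'_def f_def lessThan_atLeast0
      by (subst sum.atLeastLessThan_concat [symmetric, of 0 N])
         (use sum.shift_bounds_nat_ivl [of "\<lambda>i. 1 / (k' (\<sigma> * real i * \<alpha>) * k' (\<sigma> * real (Suc i) * \<alpha>))" 0 N M]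
          in \<open>simp_all add: add.commute\<close>)
    also have "(\<Sum>i<N. 1 / (k' (\<sigma> * real i * \<alpha>) * k' (\<sigma> * real (Suc i) * \<alpha>))) = resistance k \<sigma> 0 N"
    proof -
      have "k' (\<sigma> * real i * \<alpha>) = k (\<sigma> * real i * \<alpha>)" if "i \<le> N" for i
        unfolding zj using low [of "z * int i"] that by (simp only: zabs)
      then show ?thesis unfolding resistance_def by (intro sum.cong) (simp_all del: of_nat_Suc)
    qed
    also have "resistance k \<sigma> 0 N + (\<Sum>i<M. 1 / (f i * f (Suc i))) \<le> (3 - 2 * \<epsilon>) + 1 / ((2 ^ n)\<^sup>2 * \<epsilon>)"
      using f \<epsilon> res [OF \<sigma>] by (intro add_mono inverse_products_sum_le) auto
    also have "1 / ((2 ^ n)\<^sup>2 * \<epsilon>) = \<epsilon>"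
      by (simp add: \<epsilon>_def power_one_over power2_eq_square field_simps)
    finally show "resistance k' \<sigma> 0 N' \<le> 3 - 2 * (1/2) ^ Suc n" by (simp add: \<epsilon>_def)
    have "M \<ge> 1" by (simp add: M_def)
    have "2 ^ n \<le> f i" if "i \<le> M" for i
    proof -
      have "2 ^ n * 1 \<le> 2 ^ n * (1 + \<epsilon> * real i)" using \<epsilon> by (intro mult_left_mono) auto
      then show ?thesis using f [OF that] by linarith
    qed
    then have "2 ^ n \<le> f (M - 1)" "2 ^ n \<le> f M" by simp_all
    moreover from this(1) have "0 \<le> f (M - 1)" by (rule order_trans [rotated]) simp
    ultimately have "2 ^ n * 2 ^ n \<le> f (M - 1) * f M" by (intro mult_mono) auto
    then show "4 ^ n \<le> k' (\<sigma> * real (N' - 1) * \<alpha>) * k' (\<sigma> * real N' * \<alpha>)"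
      using \<open>M \<ge> 1\<close> by (simp add: f_def N'_def flip: power_mult_distrib)
  qed (use pert ge far k in \<open>auto simp: \<epsilon>_def N'_def\<close>)
qed


section \<open>Shear near the origin\<close>

lemma resistance_mono: "weight k \<Longrightarrow> m \<le> m' \<Longrightarrow> resistance k \<sigma> y m \<le> resistance k \<sigma> y m'"
  unfolding resistance_def
  by (intro sum_mono2) (auto simp: weight_def less_imp_le)

lemma resistance_nonneg: "weight k \<Longrightarrow> 0 \<le> resistance k \<sigma> y m"
  unfolding resistance_def by (intro sum_nonneg) (auto simp: weight_def less_imp_le)

lemma circle_fun_resistance: "weight k \<Longrightarrow> circle_fun (\<lambda>y. resistance k \<sigma> y m)"
  unfolding resistance_def weight_def
  by (intro circle_fun_sum circle_fun_divide circle_fun_const circle_fun_mult [OF circle_fun_shift circle_fun_shift])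
    (auto simp: less_imp_neq [THEN not_sym])

text \<open>
The sequence \<open>D\<close> for which \<open>k\<^sub>j * D\<^sub>j\<close> solves the same Schroedinger equation as \<open>k\<^sub>j\<close>, normalised
by \<open>D\<^sub>0 = 0\<close>.
\<close>

definition signed_resistance :: "(real \<Rightarrow> real) \<Rightarrow> int \<Rightarrow> real \<Rightarrow> real" where
  "signed_resistance k j y = (if 0 \<le> j then resistance k 1 y (nat j) else - resistance k (-1) y (nat (- j)))"

lemma signed_resistance_0 [simp]: "signed_resistance k 0 y = 0"
  by (simp add: signed_resistance_def resistance_def)

lemma signed_resistance_step:
  "signed_resistance k (j + 1) y - signed_resistance k j y = 1 / (k (y + of_int j * \<alpha>) * k (y + of_int (j + 1) * \<alpha>))"
proof (cases "0 \<le> j")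
  case True
  then have "nat (j + 1) = Suc (nat j)" by simp
  then show ?thesis using True by (simp add: signed_resistance_def resistance_def add.commute)
next
  case False
  define m where "m = nat (- (j + 1))"
  have m: "nat (- j) = Suc m" "j = - int m - 1" using False by (auto simp: m_def)
  have "signed_resistance k (j + 1) y = - resistance k (-1) y m"
    using False by (auto simp: signed_resistance_def m_def resistance_def)
  moreover have "signed_resistance k j y = - resistance k (-1) y (Suc m)"
    using False by (simp add: signed_resistance_def m(1))
  ultimately have "signed_resistance k (j + 1) y - signed_resistance k j y
      = 1 / (k (y + -1 * real m * \<alpha>) * k (y + -1 * real (Suc m) * \<alpha>))"
    by (simp add: resistance_def)
  also have "\<dots> = 1 / (k (y + of_int j * \<alpha>) * k (y + of_int (j + 1) * \<alpha>))"
    by (simp add: m(2) algebra_simps)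
  finally show ?thesis .
qed

lemma circle_fun_signed_resistance: "weight k \<Longrightarrow> circle_fun (signed_resistance k j)"
  using circle_fun_resistance by (cases "0 \<le> j") (auto simp: signed_resistance_def [abs_def])

text \<open>
The shear must vanish at the origin, so that the origin's orbit keeps its values for the later
stages, and be substantial on an interval next to it whose length is comparable to its distance
from the origin.
\<close>

lemma bump_ring:
  assumes "\<delta> > 0"
  obtains s where "bump \<delta> s" "s 0 = 0" "\<And>y. \<delta>/4 \<le> circle_norm y \<Longrightarrow> circle_norm y \<le> 4/5 * \<delta> \<Longrightarrow> 1/4 \<le> s y"
proof
  define u where "u y = circle_norm y / \<delta>" for y
  have u: "circle_fun u" "0 \<le> u y" for y
    using circle_fun_circle_norm assms by (auto simp: u_def [abs_def])
  show "bump \<delta> (\<lambda>y. max 0 (1 - \<bar>2 * u y - 1\<bar>))"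
    unfolding bump_def circle_fun_def
  proof (intro conjI allI impI)
    show "continuous_on UNIV (\<lambda>y. max 0 (1 - \<bar>2 * u y - 1\<bar>))"
      using circle_fun_cont [OF u(1)] by (intro continuous_intros)
    fix y
    assume "max 0 (1 - \<bar>2 * u y - 1\<bar>) \<noteq> 0"
    then have "u y < 1" by (simp add: max_def abs_if split: if_splits)
    then show "circle_norm y < \<delta>" using assms by (simp add: u_def)
  qed (simp_all add: circle_fun_per [OF u(1)])
  show "max 0 (1 - \<bar>2 * u 0 - 1\<bar>) = 0" by (simp add: u_def)
  fix y assume "\<delta>/4 \<le> circle_norm y" "circle_norm y \<le> 4/5 * \<delta>"
  then have "1/4 \<le> u y" "u y \<le> 4/5" using assms by (auto simp: u_def field_simps)
  then show "1/4 \<le> max 0 (1 - \<bar>2 * u y - 1\<bar>)" by (simp add: max_def abs_if)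
qed

text \<open>
Here \<open>E\<close> is one sixth of the signed resistance, stopped at \<open>N\<close> in both directions and then brought
down to zero linearly at rate \<open>(1/2) ^ n\<close>. Before \<open>N\<close> the increments balance exactly and cost nothing.
At \<open>N\<close> the flux, which is of order one, is stopped at once; relative to the product of the two large
weights there this is a small increment. Resistance below \<open>3\<close> gives \<open>\<bar>E\<bar> \<le> 1/2\<close> and hence
positivity.

Near the origin, where \<open>k\<close> and its translate by \<open>\<alpha>\<close> are almost \<open>1\<close>, the shear adds about \<open>s/6\<close> to the quotient
\<open>k (t + \<alpha>) / k t\<close>. Since \<open>s\<close> is at least \<open>1/4\<close> on an interval comparable to its distance from \<open>0\<close>, this
raises the difference quotient of \<open>K\<close> over \<open>[0, t]\<close> by a fixed amount, for which \<open>1/10000\<close> is a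
modest lower bound.
\<close>

lemma shear_step:
  fixes n N :: nat and Q :: int
  assumes k: "weight k" "k 0 = 1" "k \<alpha> = 1" and "1 \<le> N" "\<eta> > 0"
    and res: "\<And>\<sigma>. \<sigma> \<in> {-1, 1} \<Longrightarrow> resistance k \<sigma> 0 N < 3"
    and edge: "\<And>\<sigma>. \<sigma> \<in> {-1, 1} \<Longrightarrow> 4 ^ n \<le> k (\<sigma> * real (N - 1) * \<alpha>) * k (\<sigma> * real N * \<alpha>)"
  obtains k' where "perturbation ((1/2)^n) \<eta> k k'"
    "\<And>j. \<bar>j\<bar> \<le> Q \<Longrightarrow> k' (of_int j * \<alpha>) = k (of_int j * \<alpha>)"
    "\<And>K'. \<lbrakk>\<And>x. (K' has_real_derivative k' x) (at x)\<rbrakk> \<Longrightarrow>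
       \<exists>t. 0 < t \<and> t < (1/2)^n \<and> K' (t + \<alpha>) - K' \<alpha> > (1 + 1/10000) * (K' t - K' 0)"
proof -
  define \<epsilon> :: real where "\<epsilon> = (1/2)^n"
  have \<epsilon>: "\<epsilon> > 0" "\<epsilon> \<le> 1" by (simp_all add: \<epsilon>_def power_le_one)
  have kpos: "k x > 0" for x using k(1) by (simp add: weight_def)
  have kc: "circle_fun k" using k(1) by (simp add: weight_def)
  \<comment> \<open>\<open>c\<close> is the linear fade-out beyond \<open>N\<close> and
    \<open>q\<close> stops the signed resistance there.\<close>
  define c where "c j = max 0 (min 1 (1 - \<epsilon> * of_int (\<bar>j\<bar> - int N)))" for j :: int
  define q where "q j = max (- int N) (min (int N) j)" for j
  define E where "E j y = 1/6 * signed_resistance k (q j) y * c j" for j y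
  define P where "P = max (\<bar>Q\<bar>) (int N + 2 ^ n)"
  have c01: "0 \<le> c j" "c j \<le> 1" and c1: "\<bar>j\<bar> \<le> int N \<Longrightarrow> c j = 1" for j
    using \<epsilon> by (auto simp: c_def mult_nonneg_nonpos)
  have cstep: "\<bar>c (j+1) - c j\<bar> \<le> \<epsilon>" for j
  proof -
    have "\<bar>(1 - \<epsilon> * of_int (\<bar>j+1\<bar> - int N)) - (1 - \<epsilon> * of_int (\<bar>j\<bar> - int N))\<bar> = \<epsilon> * \<bar>of_int (\<bar>j+1\<bar> - \<bar>j\<bar>)\<bar>"
      using \<epsilon> by (simp add: abs_mult flip: right_diff_distrib)
    also have "\<bar>of_int (\<bar>j+1\<bar> - \<bar>j\<bar>)\<bar> \<le> (1::real)" by linarith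
    finally have "\<bar>(1 - \<epsilon> * of_int (\<bar>j+1\<bar> - int N)) - (1 - \<epsilon> * of_int (\<bar>j\<bar> - int N))\<bar> \<le> \<epsilon>"
      using \<epsilon> by simp
    then show ?thesis unfolding c_def by linarith
  qed
  have Psupp: "E j y = 0" if "\<bar>j\<bar> > P" for j y
  proof -
    have "2 ^ n \<le> \<bar>j\<bar> - int N" using that by (simp add: P_def)
    then have "(2::real) ^ n \<le> of_int (\<bar>j\<bar> - int N)" by (metis of_int_le_iff of_int_numeral of_int_power)
    then have "\<epsilon> * 2 ^ n \<le> \<epsilon> * of_int (\<bar>j\<bar> - int N)" using \<epsilon> by simp
    then have "1 \<le> \<epsilon> * of_int (\<bar>j\<bar> - int N)" by (simp add: \<epsilon>_def power_one_over)
    then have "c j = 0" unfolding c_def by linarith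
    then show ?thesis by (simp add: E_def)
  qed
  have "eventually (\<lambda>y.
      (\<forall>\<sigma>\<in>{-1, 1}. resistance k \<sigma> y N < 3) \<and>
      (\<forall>\<sigma>\<in>{-1, 1}. 1 / (k (y + \<sigma> * real (N - 1) * \<alpha>) * k (y + \<sigma> * real N * \<alpha>)) < 2 / 4 ^ n) \<and>
      \<bar>k y - 1\<bar> < 1/10000 \<and> \<bar>k (y + \<alpha>) - 1\<bar> < 1/10000) (filtercomap circle_norm (nhds 0))"
  proof (intro eventually_conj eventually_ball_finite ballI circle_fun_near_0)
    fix \<sigma> :: real assume \<sigma>: "\<sigma> \<in> {-1, 1}"
    show "circle_fun (\<lambda>y. resistance k \<sigma> y N)" by (rule circle_fun_resistance [OF k(1)])
    show "resistance k \<sigma> 0 N < 3" by (rule res [OF \<sigma>])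
    show "circle_fun (\<lambda>y. 1 / (k (y + \<sigma> * real (N - 1) * \<alpha>) * k (y + \<sigma> * real N * \<alpha>)))"
      by (intro circle_fun_divide circle_fun_const circle_fun_mult [OF circle_fun_shift circle_fun_shift] kc)
        (simp add: kpos less_imp_neq [THEN not_sym])
    have "1 / (k (\<sigma> * real (N - 1) * \<alpha>) * k (\<sigma> * real N * \<alpha>)) \<le> 1 / 4 ^ n"
      using edge [OF \<sigma>] by (intro divide_left_mono mult_pos_pos kpos) auto
    also have "\<dots> < 2 / 4 ^ n" by (simp add: divide_strict_right_mono)
    finally show "1 / (k (0 + \<sigma> * real (N - 1) * \<alpha>) * k (0 + \<sigma> * real N * \<alpha>)) < 2 / 4 ^ n" by simp
  next
    show "circle_fun (\<lambda>y. \<bar>k y - 1\<bar>)" "circle_fun (\<lambda>y. \<bar>k (y + \<alpha>) - 1\<bar>)"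
      by (rule circle_fun_abs circle_fun_diff circle_fun_const circle_fun_shift kc)+
  qed (use k in auto)
  then obtain \<delta>\<^sub>0 where \<delta>0: "\<delta>\<^sub>0 > 0"
    and res0: "\<And>y \<sigma>. circle_norm y < \<delta>\<^sub>0 \<Longrightarrow> \<sigma> \<in> {-1, 1} \<Longrightarrow> resistance k \<sigma> y N < 3"
    and edge0: "\<And>y \<sigma>. circle_norm y < \<delta>\<^sub>0 \<Longrightarrow> \<sigma> \<in> {-1, 1} \<Longrightarrow>
        1 / (k (y + \<sigma> * real (N - 1) * \<alpha>) * k (y + \<sigma> * real N * \<alpha>)) < 2 / 4 ^ n"
    and near1: "\<And>y. circle_norm y < \<delta>\<^sub>0 \<Longrightarrow> \<bar>k y - 1\<bar> < 1/10000"
    and near2: "\<And>y. circle_norm y < \<delta>\<^sub>0 \<Longrightarrow> \<bar>k (y + \<alpha>) - 1\<bar> < 1/10000"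
    unfolding eventually_circle_norm_0 by blast
  have cond3: "\<bar>signed_resistance k (q j) y\<bar> \<le> 3" if y: "circle_norm y < \<delta>\<^sub>0" for j y
  proof -
    have "resistance k \<sigma> y (nat \<bar>q j\<bar>) \<le> 3" "0 \<le> resistance k \<sigma> y (nat \<bar>q j\<bar>)" if "\<sigma> \<in> {-1, 1}" for \<sigma>
    proof -
      have "nat \<bar>q j\<bar> \<le> N" unfolding q_def by linarith
      from resistance_mono [OF k(1) this, of \<sigma> y] res0 [OF y that]
      show "resistance k \<sigma> y (nat \<bar>q j\<bar>) \<le> 3" by linarith
    qed (rule resistance_nonneg [OF k(1)])
    from this [of 1] this [of "-1"] show ?thesis by (auto simp: signed_resistance_def)
  qed
  have Ehalf: "\<bar>E j y\<bar> \<le> 1/2" if "circle_norm y < \<delta>\<^sub>0" for j y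
  proof -
    have "\<bar>signed_resistance k (q j) y\<bar> * c j \<le> 3 * 1"
      using cond3 [OF that] c01 by (intro mult_mono) auto
    then show ?thesis using c01 [of j] by (simp add: E_def abs_mult mult.commute)
  qed
  have pow24: "1/6 * (2 / 4 ^ n) \<le> \<epsilon> / 2"
  proof -
    have "(2::real) ^ n \<le> 4 ^ n" by (rule power_mono) auto
    then have "2 * 2 ^ n \<le> 3 * (4::real) ^ n" using zero_le_power [of "4::real" n] by linarith
    then show ?thesis by (simp add: \<epsilon>_def power_one_over field_simps)
  qed
  have Eedge: "\<bar>E (i+1) y - E i y\<bar> \<le> \<epsilon> / 2" if y: "circle_norm y < \<delta>\<^sub>0" and i: "int N - 1 \<le> i \<or> i \<le> - int N" for i y
  proof -
    consider "i = int N - 1" | "i = - int N" | "int N \<le> i \<or> i < - int N" using i by linarith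
    then show ?thesis
    proof cases
      case 3
      then have "q (i+1) = q i" by (auto simp: q_def)
      then have "E (i+1) y - E i y = 1/6 * signed_resistance k (q i) y * (c (i+1) - c i)"
        by (simp add: E_def algebra_simps)
      moreover have "\<bar>signed_resistance k (q i) y\<bar> * \<bar>c (i+1) - c i\<bar> \<le> 3 * \<epsilon>"
        using cond3 [OF y] cstep by (intro mult_mono) auto
      ultimately show ?thesis by (simp only: abs_mult)
    next
      case 1
      have "E (i+1) y - E i y = 1/6 * (signed_resistance k (i+1) y - signed_resistance k i y)"
        using 1 \<open>1 \<le> N\<close> by (simp add: E_def q_def c1)
      also have "\<dots> = 1/6 * (1 / (k (y + 1 * real (N - 1) * \<alpha>) * k (y + 1 * real N * \<alpha>)))"
        unfolding signed_resistance_step using 1 \<open>1 \<le> N\<close> by (simp add: of_nat_diff)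
      finally have *: "E (i+1) y - E i y = 1/6 * (1 / (k (y + 1 * real (N - 1) * \<alpha>) * k (y + 1 * real N * \<alpha>)))" .
      have "\<bar>E (i+1) y - E i y\<bar> \<le> 1/6 * (2 / 4 ^ n)"
        unfolding * using edge0 [OF y, of 1] kpos by (simp add: abs_mult abs_of_pos)
      also have "\<dots> \<le> \<epsilon> / 2"
        by (rule pow24)
      finally show ?thesis .
    next
      case 2
      have "E (i+1) y - E i y = 1/6 * (signed_resistance k (i+1) y - signed_resistance k i y)"
        using 2 \<open>1 \<le> N\<close> by (simp add: E_def q_def c1)
      also have "\<dots> = 1/6 * (1 / (k (y + (-1) * real (N - 1) * \<alpha>) * k (y + (-1) * real N * \<alpha>)))"
        unfolding signed_resistance_step using 2 \<open>1 \<le> N\<close> by (simp add: of_nat_diff algebra_simps)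
      finally have *: "E (i+1) y - E i y = 1/6 * (1 / (k (y + (-1) * real (N - 1) * \<alpha>) * k (y + (-1) * real N * \<alpha>)))" .
      have "\<bar>E (i+1) y - E i y\<bar> \<le> 1/6 * (2 / 4 ^ n)"
        unfolding * using edge0 [OF y, of "-1"] kpos by (simp add: abs_mult abs_of_pos)
      also have "\<dots> \<le> \<epsilon> / 2"
        by (rule pow24)
      finally show ?thesis .
    qed
  qed
  obtain \<delta>\<^sub>1 where \<delta>1: "0 < \<delta>\<^sub>1" "\<delta>\<^sub>1 \<le> 1"
    and tow: "\<And>\<delta> s k'. \<lbrakk>0 < \<delta>; \<delta> \<le> \<delta>\<^sub>1; bump \<delta> s; k' = (\<lambda>x. k x * tower P E s x)\<rbrakk> \<Longrightarrow>
        perturbation \<epsilon> \<eta> k k' \<and>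
        (\<forall>j y. circle_norm y < \<delta> \<longrightarrow> \<bar>j\<bar> \<le> P \<longrightarrow>
           k' (y + of_int j * \<alpha>) = k (y + of_int j * \<alpha>) * (1 + s y * E j y))"
  proof (rule tower_modification [of k E P \<delta>\<^sub>0 \<epsilon> \<eta>])
    show "circle_fun (E j)" for j
      unfolding E_def [abs_def] by (intro circle_fun_mult circle_fun_const circle_fun_signed_resistance k)
    fix j y \<sigma>
    assume y: "circle_norm y < \<delta>\<^sub>0" and \<sigma>: "0 \<le> (\<sigma>::real)" "\<sigma> \<le> 1"
    have "\<bar>\<sigma> * E j y\<bar> \<le> 1 * (1/2)"
      unfolding abs_mult using \<sigma> Ehalf [OF y] by (intro mult_mono) auto
    then show half: "1 / 2 \<le> 1 + \<sigma> * E j y" by linarith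
    have small: "\<sigma> * \<bar>d\<bar> \<le> \<epsilon> * (1 + \<sigma> * E j y)" if "\<bar>d\<bar> \<le> \<epsilon> / 2" for d
    proof -
      have "\<sigma> * \<bar>d\<bar> \<le> 1 * (\<epsilon> / 2)" using that \<sigma> by (intro mult_mono) auto
      also have "\<dots> \<le> \<epsilon> * (1 + \<sigma> * E j y)" using mult_left_mono [OF half, of \<epsilon>] \<epsilon> by simp
      finally show ?thesis .
    qed
    show "k (y + of_int (j + 1) * \<alpha>) * (E (j + 1) y - E j y) = k (y + of_int (j - 1) * \<alpha>) * (E j y - E (j - 1) y) \<or>
         \<sigma> * \<bar>E (j + 1) y - E j y\<bar> \<le> \<epsilon> * (1 + \<sigma> * E j y) \<and> \<sigma> * \<bar>E (j - 1) y - E j y\<bar> \<le> \<epsilon> * (1 + \<sigma> * E j y)"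
    proof (cases "\<bar>j\<bar> < int N")
      case True
      have "E i y = 1/6 * signed_resistance k i y" if "\<bar>i\<bar> \<le> int N" for i
        using that by (simp add: E_def q_def c1 abs_le_iff)
      then have "E (j + 1) y = 1/6 * signed_resistance k (j + 1) y" "E j y = 1/6 * signed_resistance k j y"
          "E (j - 1) y = 1/6 * signed_resistance k (j - 1) y"
        using True by auto
      then have "E (j + 1) y - E j y = 1/6 * (signed_resistance k (j + 1) y - signed_resistance k j y)"
          "E j y - E (j - 1) y = 1/6 * (signed_resistance k (j - 1 + 1) y - signed_resistance k (j - 1) y)"
        by simp_all
      then have "k (y + of_int (j + 1) * \<alpha>) * (E (j + 1) y - E j y) = k (y + of_int (j - 1) * \<alpha>) * (E j y - E (j - 1) y)"
        unfolding signed_resistance_step using kpos [of "y + of_int (j + 1) * \<alpha>"] kpos [of "y + of_int (j - 1) * \<alpha>"] by simp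
      then show ?thesis ..
    next
      case False
      then have "int N - 1 \<le> j \<or> j \<le> - int N" "int N - 1 \<le> j - 1 \<or> j - 1 \<le> - int N" by linarith+
      then have "\<bar>E (j + 1) y - E j y\<bar> \<le> \<epsilon> / 2" "\<bar>E (j - 1) y - E j y\<bar> \<le> \<epsilon> / 2"
        using Eedge [OF y, of j] Eedge [OF y, of "j - 1"] by (simp_all add: abs_minus_commute)
      then show ?thesis using small by blast
    qed
  qed (use k Psupp \<epsilon> \<delta>0 \<open>\<eta> > 0\<close> in \<open>auto simp: P_def\<close>)
  define \<delta> where "\<delta> = min (min \<delta>\<^sub>0 \<delta>\<^sub>1) \<epsilon>"
  have \<delta>: "0 < \<delta>" "\<delta> \<le> \<delta>\<^sub>1" "\<delta> \<le> \<delta>\<^sub>0" "\<delta> \<le> \<epsilon>" using \<delta>0 \<delta>1 \<epsilon> by (auto simp: \<delta>_def)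
  obtain s where s: "bump \<delta> s" "s 0 = 0"
    and ring: "\<And>y. \<delta>/4 \<le> circle_norm y \<Longrightarrow> circle_norm y \<le> 4/5 * \<delta> \<Longrightarrow> 1/4 \<le> s y"
    using bump_ring [OF \<delta>(1)] by blast
  have s01: "0 \<le> s y" for y using s(1) by (simp add: bump_def)
  define k' where "k' = (\<lambda>x. k x * tower P E s x)"
  note tow' = tow [OF \<delta>(1,2) s(1) k'_def]
  have k': "k' (y + of_int j * \<alpha>) = k (y + of_int j * \<alpha>) * (1 + s y * E j y)"
    if "circle_norm y < \<delta>" "\<bar>j\<bar> \<le> P" for j y
    using tow' that by blast
  show thesis
  proof (rule that [of k'])
    show "perturbation ((1/2)^n) \<eta> k k'" using tow' by (simp add: \<epsilon>_def)
    show "k' (of_int j * \<alpha>) = k (of_int j * \<alpha>)" if "\<bar>j\<bar> \<le> Q" for j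
      using k' [of 0 j] that \<delta>(1) s(2) by (simp add: P_def)
    fix K' assume K': "\<And>x. (K' has_real_derivative k' x) (at x)"
    have "P \<ge> 1"
      unfolding P_def using \<open>1 \<le> N\<close> zero_less_power [of "2::int" n] by linarith
    define F where "F t = K' (t + \<alpha>) - (1 + 1/10000) * K' t" for t
    have F: "(F has_real_derivative k' (t + \<alpha>) - (1 + 1/10000) * k' t) (at t)" for t
      unfolding F_def [abs_def]
      using K' [of "t + \<alpha>"] by (intro DERIV_diff DERIV_cmult K') (simp only: DERIV_shift)
    \<comment> \<open>Without the shear the two densities differ by at most the errors of size
      \<open>1/10000\<close>, and the shear contributes \<open>s t / (6 * k t)\<close>.\<close>
    have F': "s t / 7 - 4/10000 \<le> k' (t + \<alpha>) - (1 + 1/10000) * k' t" if t: "circle_norm t < \<delta>" for t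
    proof -
      define X where "X = s t / (6 * k t)"
      have 1: "k' t = k t" using k' [OF t, of 0] \<open>P \<ge> 1\<close> by (simp add: E_def q_def)
      have "E 1 t = 1/6 * (1 / (k t * k (t + \<alpha>)))"
        using signed_resistance_step [of k 0 t] \<open>1 \<le> N\<close> by (simp add: E_def q_def c1)
      then have 2: "k' (t + \<alpha>) = k (t + \<alpha>) + X"
        unfolding X_def using k' [OF t, of 1] \<open>P \<ge> 1\<close> kpos [of t] kpos [of "t + \<alpha>"] by (simp add: field_simps)
      have "\<bar>k t - 1\<bar> < 1/10000" "\<bar>k (t + \<alpha>) - 1\<bar> < 1/10000"
        using near1 near2 t \<delta>(3) by auto
      then have 3: "k t < 1 + 1/10000" "k (t + \<alpha>) > 1 - 1/10000" by linarith+
      then have "6 * k t \<le> 7" by linarith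
      then have "s t / 7 \<le> X"
        unfolding X_def using s01 [of t] kpos [of t] by (intro divide_left_mono) auto
      then show ?thesis unfolding 1 2 using 3 by (simp add: field_simps)
    qed
    have low: "F (\<delta>/8) + 4/10000 * (\<delta>/8) \<ge> F 0 + 4/10000 * 0"
    proof (rule DERIV_nonneg_imp_nondecreasing [where f = "\<lambda>t. F t + 4/10000 * t"])
      fix t assume t: "0 \<le> t" "t \<le> \<delta>/8"
      have "circle_norm t < \<delta>" 
      proof -
        have "pi * t \<le> 4 * (\<delta>/8)" using t pi_less_4 by (intro mult_mono) auto
        then show ?thesis using circle_norm_le [of t] t \<delta>(1) by simp
      qed
      then have "0 \<le> k' (t + \<alpha>) - (1 + 1/10000) * k' t + 4/10000 * 1"
        using F' [of t] s01 [of t] by linarith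
      moreover have "((\<lambda>t. F t + 4/10000 * t) has_real_derivative
          (k' (t + \<alpha>) - (1 + 1/10000) * k' t + 4/10000 * 1)) (at t)"
        by (rule DERIV_add [OF F DERIV_cmult [OF DERIV_ident]])
      ultimately show "\<exists>y. ((\<lambda>t. F t + 4/10000 * t) has_real_derivative y) (at t) \<and> 0 \<le> y"
        by (intro exI conjI)
    qed (use \<delta> in auto)
    \<comment> \<open>Between \<open>\<delta>/8\<close> and \<open>\<delta>/5\<close> the value of
      \<open>circle_norm\<close> lies in the range where the bump is at least \<open>1/4\<close>, by
      \<open>2 * t \<le> circle_norm t \<le> 4 * t\<close>.\<close>
    have up: "F (\<delta>/5) - 3/100 * (\<delta>/5) \<ge> F (\<delta>/8) - 3/100 * (\<delta>/8)"
    proof (rule DERIV_nonneg_imp_nondecreasing [where f = "\<lambda>t. F t - 3/100 * t"])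
      fix t assume t: "\<delta>/8 \<le> t" "t \<le> \<delta>/5"
      have 1: "circle_norm t \<le> 4/5 * \<delta>"
      proof -
        have "pi * t \<le> 4 * (\<delta>/5)" using t \<delta>(1) pi_less_4 by (intro mult_mono) auto
        then show ?thesis using circle_norm_le [of t] t \<delta>(1) by simp
      qed
      have 2: "\<delta>/4 \<le> circle_norm t"
        using circle_norm_ge [of t] t \<delta> \<epsilon> by linarith
      have "1/4 \<le> s t" using 1 2 by (rule ring [rotated])
      moreover have "circle_norm t < \<delta>" using 1 \<delta>(1) by simp
      ultimately have "0 \<le> k' (t + \<alpha>) - (1 + 1/10000) * k' t - 3/100 * 1"
        using F' [of t] by linarith
      moreover have "((\<lambda>t. F t - 3/100 * t) has_real_derivative
          (k' (t + \<alpha>) - (1 + 1/10000) * k' t - 3/100 * 1)) (at t)"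
        by (rule DERIV_diff [OF F DERIV_cmult [OF DERIV_ident]])
      ultimately show "\<exists>y. ((\<lambda>t. F t - 3/100 * t) has_real_derivative y) (at t) \<and> 0 \<le> y"
        by (intro exI conjI)
    qed (use \<delta> in auto)
    have "F (\<delta>/5) > F 0" using low up \<delta>(1) by linarith
    then have "K' (\<delta>/5 + \<alpha>) - K' \<alpha> > (1 + 1/10000) * (K' (\<delta>/5) - K' 0)"
      unfolding F_def by (simp add: right_diff_distrib)
    moreover have "0 < \<delta>/5" "\<delta>/5 < (1/2)^n" using \<delta> by (auto simp: \<epsilon>_def)
    ultimately show "\<exists>t. 0 < t \<and> t < (1/2)^n \<and> K' (t + \<alpha>) - K' \<alpha> > (1 + 1/10000) * (K' t - K' 0)"
      by blast
  qed
qed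

end

section \<open>The limit of the construction\<close>

lemma halving_limit:
  fixes a b :: "nat \<Rightarrow> real"
  assumes step: "\<And>n. \<bar>a (Suc n) - a n\<bar> \<le> b n" and half: "\<And>n. b (Suc n) \<le> b n / 2"
  obtains L where "a \<longlonglongrightarrow> L" "\<And>n. \<bar>a n - L\<bar> \<le> 2 * b n"
proof -
  have b0: "0 \<le> b n" for n using step [of n] by linarith
  have dist: "\<bar>a (n + m) - a n\<bar> \<le> 2 * b n - 2 * b (n + m)" for n m
  proof (induction m)
    case (Suc m)
    then show ?case using step [of "n + m"] half [of "n + m"] by simp
  qed simp
  have near: "\<bar>a m - a n\<bar> \<le> 2 * b n" if "n \<le> m" for m n
    using dist [of n "m - n"] b0 [of m] that by simp
  have b_le: "b n \<le> b 0 * (1/2) ^ n" for n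
  proof (induction n)
    case (Suc n)
    then show ?case using half [of n] by simp
  qed simp
  have "(\<lambda>n. b 0 * (1/2) ^ n) \<longlonglongrightarrow> b 0 * 0"
    by (intro tendsto_intros LIMSEQ_power_zero) simp
  then have blim: "b \<longlonglongrightarrow> 0"
    by (intro tendsto_sandwich [of "\<lambda>_. 0" b sequentially "\<lambda>n. b 0 * (1/2) ^ n"])
       (use b0 b_le in auto)
  have "Cauchy a"
  proof (rule metric_CauchyI)
    fix e :: real assume "e > 0"
    then obtain n where n: "b n < e / 4"
      using order_tendstoD(2) [OF blim, of "e/4"] by (auto simp: eventually_sequentially)
    have "dist (a i) (a j) < e" if "i \<ge> n" "j \<ge> n" for i j
      using near [OF that(1)] near [OF that(2)] n unfolding dist_real_def by linarith
    then show "\<exists>M. \<forall>i\<ge>M. \<forall>j\<ge>M. dist (a i) (a j) < e" by blast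
  qed
  then obtain L where L: "a \<longlonglongrightarrow> L" by (meson Cauchy_convergent convergentD)
  have "\<bar>L - a n\<bar> \<le> 2 * b n" for n
  proof (rule LIMSEQ_le_const2)
    show "(\<lambda>m. \<bar>a m - a n\<bar>) \<longlonglongrightarrow> \<bar>L - a n\<bar>" by (intro tendsto_intros L)
    show "\<exists>N. \<forall>m\<ge>N. \<bar>a m - a n\<bar> \<le> 2 * b n" using near by blast
  qed
  then show thesis by (intro that [OF L]) (simp add: abs_minus_commute)
qed

definition close :: "real \<Rightarrow> (real \<Rightarrow> real) \<Rightarrow> (real \<Rightarrow> real) \<Rightarrow> bool" where
  "close \<eta> K K' \<longleftrightarrow> (\<forall>x. \<bar>K' x - K x\<bar> \<le> \<eta> * (1 + \<bar>x\<bar>))"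

context irrational_rotation
begin

text \<open>
The features of the primitive at scale \<open>(1/2) ^ n\<close> that must persist: two incompatible slopes at the
origin for the conjugated map, and strict monotonicity. They are open conditions, which is the
content of \<open>kinked_stable\<close>.
\<close>

definition kinked :: "nat \<Rightarrow> (real \<Rightarrow> real) \<Rightarrow> bool" where
  "kinked n K \<longleftrightarrow>
     (\<exists>t. 0 < t \<and> t < (1/2)^n \<and> K (t + \<alpha>) - K \<alpha> > (1 + 1/10000) * (K t - K 0)) \<and>
     (\<exists>t. 0 < t \<and> t < (1/2)^n \<and> K (t + \<alpha>) - K \<alpha> < (1 + 1/20000) * (K t - K 0)) \<and>
     (\<forall>x\<in>{0..1}. K x < K (x + (1/2)^n))"

lemma strict_inequality_stable:
  fixes f :: "real \<Rightarrow> real" and c :: real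
  assumes "f (t + \<alpha>) - f \<alpha> - c * (f t - f 0) > 0"
  obtains \<eta> where "\<eta> > 0" "\<And>f'. close \<eta> f f' \<Longrightarrow> f' (t + \<alpha>) - f' \<alpha> - c * (f' t - f' 0) > 0"
proof -
  define g where "g = f (t + \<alpha>) - f \<alpha> - c * (f t - f 0)"
  define M where "M = (1 + \<bar>t + \<alpha>\<bar>) + (1 + \<bar>\<alpha>\<bar>) + \<bar>c\<bar> * ((1 + \<bar>t\<bar>) + 1)"
  have M: "M > 0" unfolding M_def by (intro add_pos_nonneg add_pos_pos mult_nonneg_nonneg) auto
  show thesis
  proof (rule that [of "g / (2 * M)"])
    show "g / (2 * M) > 0" using assms M by (simp add: g_def)
    fix f' assume cl: "close (g / (2 * M)) f f'"
    define \<eta> where "\<eta> = g / (2 * M)"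
    define d where "d x = f' x - f x" for x
    have d: "\<bar>d x\<bar> \<le> \<eta> * (1 + \<bar>x\<bar>)" for x using cl by (simp add: close_def \<eta>_def d_def)
    have "\<bar>c * (d t - d 0)\<bar> \<le> \<bar>c\<bar> * (\<eta> * (1 + \<bar>t\<bar>) + \<eta> * 1)"
      unfolding abs_mult using d [of t] d [of 0] by (intro mult_left_mono) auto
    then have "\<bar>d (t + \<alpha>) - d \<alpha> - c * (d t - d 0)\<bar>
        \<le> \<eta> * (1 + \<bar>t + \<alpha>\<bar>) + \<eta> * (1 + \<bar>\<alpha>\<bar>) + \<bar>c\<bar> * (\<eta> * (1 + \<bar>t\<bar>) + \<eta> * 1)"
      using d [of "t + \<alpha>"] d [of \<alpha>] by linarith
    also have "\<dots> = \<eta> * M" by (simp add: M_def algebra_simps)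
    also have "\<dots> = g / 2" using M by (simp add: \<eta>_def)
    finally have "\<bar>d (t + \<alpha>) - d \<alpha> - c * (d t - d 0)\<bar> \<le> g / 2" .
    moreover have "f' (t + \<alpha>) - f' \<alpha> - c * (f' t - f' 0) = g + (d (t + \<alpha>) - d \<alpha> - c * (d t - d 0))"
      by (simp add: g_def d_def algebra_simps)
    moreover have "g > 0" using assms by (simp add: g_def)
    ultimately show "f' (t + \<alpha>) - f' \<alpha> - c * (f' t - f' 0) > 0" by linarith
  qed
qed

lemma close_mono: "close \<eta> K K' \<Longrightarrow> \<eta> \<le> \<eta>' \<Longrightarrow> close \<eta>' K K'"
  unfolding close_def
proof
  fix x assume *: "\<forall>x. \<bar>K' x - K x\<bar> \<le> \<eta> * (1 + \<bar>x\<bar>)" and "\<eta> \<le> \<eta>'"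
  have "\<bar>K' x - K x\<bar> \<le> \<eta> * (1 + \<bar>x\<bar>)" using * by blast
  also have "\<dots> \<le> \<eta>' * (1 + \<bar>x\<bar>)" using \<open>\<eta> \<le> \<eta>'\<close> by (intro mult_right_mono) auto
  finally show "\<bar>K' x - K x\<bar> \<le> \<eta>' * (1 + \<bar>x\<bar>)" .
qed

lemma kinked_stable:
  assumes kin: "kinked n K" and c: "c > 0" "\<And>x. c \<le> K (x + (1/2)^n) - K x"
  obtains \<eta> where "\<eta> > 0" "\<And>K'. close \<eta> K K' \<Longrightarrow> kinked n K'"
proof -
  obtain t where t: "0 < t" "t < (1/2)^n" "K (t + \<alpha>) - K \<alpha> > (1 + 1/10000) * (K t - K 0)"
    using kin by (auto simp: kinked_def)
  then have "K (t + \<alpha>) - K \<alpha> - (1 + 1/10000) * (K t - K 0) > 0" by linarith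
  then obtain \<eta>1 where \<eta>1: "\<eta>1 > 0"
    "\<And>K'. close \<eta>1 K K' \<Longrightarrow> K' (t + \<alpha>) - K' \<alpha> - (1 + 1/10000) * (K' t - K' 0) > 0"
    by (rule strict_inequality_stable [of K t "1 + 1/10000"]) blast
  define b :: real where "b = 1 + 1/20000"
  obtain u where u: "0 < u" "u < (1/2)^n" "K (u + \<alpha>) - K \<alpha> < b * (K u - K 0)"
    using kin by (auto simp: kinked_def b_def)
  define J where "J x = - K x" for x
  have "J (u + \<alpha>) - J \<alpha> - b * (J u - J 0) > 0" using u(3) by (simp add: J_def algebra_simps)
  then obtain \<eta>2 where \<eta>2: "\<eta>2 > 0"
    "\<And>J'. close \<eta>2 J J' \<Longrightarrow> J' (u + \<alpha>) - J' \<alpha> - b * (J' u - J' 0) > 0"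
    by (rule strict_inequality_stable [of J u b]) blast
  define \<eta> where "\<eta> = min (min \<eta>1 \<eta>2) (c / 6)"
  show thesis
  proof (rule that [of \<eta>])
    show "\<eta> > 0" using \<eta>1 \<eta>2 c by (simp add: \<eta>_def)
    fix K' assume cl: "close \<eta> K K'"
    have "close \<eta>1 K K'" using cl by (rule close_mono) (simp add: \<eta>_def)
    then have 1: "K' (t + \<alpha>) - K' \<alpha> > (1 + 1/10000) * (K' t - K' 0)" using \<eta>1 by force
    have "close \<eta>2 J (\<lambda>x. - K' x)"
      using close_mono [OF cl, of \<eta>2] by (simp add: \<eta>_def close_def J_def abs_minus_commute)
    then have 2: "K' (u + \<alpha>) - K' \<alpha> < b * (K' u - K' 0)"
      using \<eta>2(2) [of "\<lambda>x. - K' x"] by (simp add: algebra_simps)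
    have 3: "K' x < K' (x + (1/2)^n)" if x: "x \<in> {0..1}" for x
    proof -
      define h :: real where "h = (1/2)^n"
      have h: "0 < h" "h \<le> 1" by (simp_all add: h_def power_le_one)
      have cl6: "close (c/6) K K'" using cl by (rule close_mono) (simp add: \<eta>_def)
      have "\<bar>K' x - K x\<bar> \<le> c/6 * (1 + \<bar>x\<bar>)" "\<bar>K' (x + h) - K (x + h)\<bar> \<le> c/6 * (1 + \<bar>x + h\<bar>)"
        using cl6 by (simp_all add: close_def)
      moreover have "c/6 * (1 + \<bar>x\<bar>) \<le> c/6 * 2" "c/6 * (1 + \<bar>x + h\<bar>) \<le> c/6 * 3"
        using x h c by (intro mult_left_mono; simp)+
      ultimately show ?thesis using c(2) [of x] c(1) unfolding h_def [symmetric] by linarith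
    qed
    show "kinked n K'" unfolding kinked_def using 1 2 3 t u unfolding b_def by blast
  qed
qed

text \<open>
Growth followed by shear. The small slope comes for free: at every stage \<open>k 0 = k \<alpha> = 1\<close>, so that the
quotients tend to \<open>1\<close> at scales finer than those reached by the shear.
\<close>

lemma stage_step:
  assumes st: "stage n k N" and "\<eta> > 0"
    and K: "\<And>x. (K has_real_derivative k x) (at x)" "K 0 = 0"
  obtains k' K' N' where "stage (Suc n) k' N'" "\<And>x. (K' has_real_derivative k' x) (at x)" "K' 0 = 0"
    "close \<eta> K K'" "\<And>x. \<bar>potential k' x - potential k x\<bar> \<le> 6 * exp 6 * (1/2)^n" "kinked n K'"
proof -
  define \<epsilon> :: real where "\<epsilon> = (1/2)^n"
  have \<epsilon>: "0 < \<epsilon>" "\<epsilon> \<le> 1" by (simp_all add: \<epsilon>_def power_le_one)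
  have k: "weight k" "\<And>x. \<epsilon> \<le> k x" and pot: "\<And>x. potential k x \<le> 2 * exp (6 - 6 * \<epsilon>)"
    using st by (auto simp: stage_def \<epsilon>_def)
  from growth_step [OF st, of "\<eta>/2"] \<open>\<eta> > 0\<close>
  obtain k1 N1 where p1: "perturbation \<epsilon> (\<eta>/2) k k1" and N1: "1 \<le> N1" and ge: "\<And>x. k x \<le> k1 x"
    and k1: "k1 0 = 1" "k1 \<alpha> = 1"
    and far: "\<And>j::int. int N1 \<le> \<bar>j\<bar> \<Longrightarrow> \<bar>j\<bar> \<le> int N1 + 2 * 8 ^ Suc n \<Longrightarrow> 2 ^ Suc n \<le> k1 (of_int j * \<alpha>)"
    and res: "\<And>\<sigma>. \<sigma> \<in> {-1, 1} \<Longrightarrow> resistance k1 \<sigma> 0 N1 \<le> 3 - 2 * (1/2) ^ Suc n"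
    and edge: "\<And>\<sigma>. \<sigma> \<in> {-1, 1} \<Longrightarrow> 4 ^ n \<le> k1 (\<sigma> * real (N1 - 1) * \<alpha>) * k1 (\<sigma> * real N1 * \<alpha>)"
    unfolding \<epsilon>_def by (metis half_gt_zero)
  have w1: "weight k1" using p1 by (simp add: perturbation_def)
  have "(0::real) < (1/2) ^ Suc n" by simp
  then have res3: "resistance k1 \<sigma> 0 N1 < 3" if "\<sigma> \<in> {-1, 1}" for \<sigma>
    using res [OF that] by linarith
  define Q where "Q = int N1 + 2 * 8 ^ Suc n"
  have "\<eta>/2 > 0" using \<open>\<eta> > 0\<close> by simp
  from shear_step [OF w1 k1 N1 this res3 edge, of Q]
  obtain k2 where p2: "perturbation \<epsilon> (\<eta>/2) k1 k2"
    and same: "\<And>j. \<bar>j\<bar> \<le> Q \<Longrightarrow> k2 (of_int j * \<alpha>) = k1 (of_int j * \<alpha>)"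
    and steep: "\<And>K'. \<lbrakk>\<And>x. (K' has_real_derivative k2 x) (at x)\<rbrakk> \<Longrightarrow>
       \<exists>t. 0 < t \<and> t < (1/2)^n \<and> K' (t + \<alpha>) - K' \<alpha> > (1 + 1/10000) * (K' t - K' 0)"
    unfolding \<epsilon>_def by blast
  have w2: "weight k2" using p2 by (simp add: perturbation_def)
  have "(0::int) \<le> 8 ^ Suc n" by simp
  then have Q: "int N1 \<le> Q" "1 \<le> Q" using N1 unfolding Q_def by linarith+
  have k2: "k2 0 = 1" "k2 \<alpha> = 1" using same [of 0] same [of 1] k1 Q by simp_all
  have low: "\<epsilon> / 2 \<le> k2 x" for x
    using p2 ge [of x] k(2) [of x] unfolding perturbation_def by (smt (verit) divide_right_mono)
  have pos: "0 \<le> potential k x" for x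
    using k(1) by (simp add: potential_def weight_def less_imp_le)
  have pot1: "\<bar>potential k1 x - potential k x\<bar> \<le> \<epsilon> * potential k x" for x
    using p1 by (simp add: perturbation_def)
  have pot2: "\<bar>potential k2 x - potential k1 x\<bar> \<le> \<epsilon> * potential k1 x" for x
    using p2 by (simp add: perturbation_def)
  have potdiff: "\<bar>potential k2 x - potential k x\<bar> \<le> 3 * \<epsilon> * potential k x" for x
  proof -
    have "potential k1 x \<le> (1 + \<epsilon>) * potential k x"
      using pot1 [of x] by (simp add: algebra_simps abs_le_iff)
    also have "\<dots> \<le> 2 * potential k x" using pos \<epsilon> by (intro mult_right_mono) auto
    finally have "\<epsilon> * potential k1 x \<le> \<epsilon> * (2 * potential k x)" using \<epsilon> by simp
    then show ?thesis using pot1 [of x] pot2 [of x] by (simp add: algebra_simps abs_le_iff)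
  qed
  have potle: "potential k2 x \<le> 2 * exp (6 - 6 * (1/2) ^ Suc n)" for x
  proof -
    have "potential k2 x \<le> (1 + 3 * \<epsilon>) * potential k x"
      using potdiff [of x] by (simp add: algebra_simps abs_le_iff)
    also have "\<dots> \<le> exp (3 * \<epsilon>) * (2 * exp (6 - 6 * \<epsilon>))"
      using pot pos \<epsilon> by (intro mult_mono exp_ge_add_one_self) auto
    also have "\<dots> = 2 * exp (6 - 6 * (1/2) ^ Suc n)"
      by (simp add: \<epsilon>_def flip: exp_add)
    finally show ?thesis .
  qed
  have res2: "resistance k2 \<sigma> 0 N1 = resistance k1 \<sigma> 0 N1" if \<sigma>: "\<sigma> \<in> {-1, 1}" for \<sigma>
  proof -
    obtain z :: int where z: "\<sigma> = of_int z" "\<bar>z\<bar> = 1"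
      using that [of 1] that [of "-1"] \<sigma> by auto
    have "k2 (\<sigma> * real i * \<alpha>) = k1 (\<sigma> * real i * \<alpha>)" if "i \<le> N1" for i
      using same [of "z * int i"] that Q z by (simp add: abs_mult)
    then show ?thesis unfolding resistance_def by (intro sum.cong) (simp_all del: of_nat_Suc)
  qed
  have stage2: "stage (Suc n) k2 N1"
    unfolding stage_def
    using w2 N1 k2 low potle res res2 far same by (auto simp: \<epsilon>_def Q_def)
  obtain K1 where K1: "\<And>x. (K1 has_real_derivative k1 x) (at x)" "K1 0 = 0"
    using primitive_exists [of k1] w1 by (auto simp: weight_def circle_fun_def)
  obtain K2 where K2: "\<And>x. (K2 has_real_derivative k2 x) (at x)" "K2 0 = 0"
    using primitive_exists [of k2] w2 by (auto simp: weight_def circle_fun_def)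
  have cl: "close \<eta> K K2"
    unfolding close_def
  proof
    fix x
    have "\<bar>K1 x - K x\<bar> \<le> \<eta>/2 * (1 + \<bar>x\<bar>)" using p1 K K1 unfolding perturbation_def by blast
    moreover have "\<bar>K2 x - K1 x\<bar> \<le> \<eta>/2 * (1 + \<bar>x\<bar>)" using p2 K1 K2 unfolding perturbation_def by blast
    moreover have "\<eta>/2 * (1 + \<bar>x\<bar>) + \<eta>/2 * (1 + \<bar>x\<bar>) = \<eta> * (1 + \<bar>x\<bar>)" by simp
    ultimately show "\<bar>K2 x - K x\<bar> \<le> \<eta> * (1 + \<bar>x\<bar>)" by linarith
  qed
  have "kinked n K2"
    unfolding kinked_def
  proof (intro conjI ballI)
    show "\<exists>t. 0 < t \<and> t < (1/2)^n \<and> K2 (t + \<alpha>) - K2 \<alpha> > (1 + 1/10000) * (K2 t - K2 0)"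
      using steep K2 by blast
    define F where "F t = K2 (t + \<alpha>) - (1 + 1/20000) * K2 t" for t
    have "(F has_real_derivative k2 (0 + \<alpha>) - (1 + 1/20000) * k2 0) (at 0)"
      unfolding F_def [abs_def] using K2(1) [of "0 + \<alpha>"] by (intro DERIV_diff DERIV_cmult K2) (simp only: DERIV_shift)
    then obtain d where d: "d > 0" "\<And>h. 0 < h \<Longrightarrow> h < d \<Longrightarrow> F (0 + h) < F 0"
      using DERIV_neg_dec_right [of F "k2 (0 + \<alpha>) - (1 + 1/20000) * k2 0" 0] k2 by auto
    define t where "t = min (d/2) (\<epsilon>/2)"
    have t: "0 < t" "t < d" "t < \<epsilon>" using d \<epsilon> by (auto simp: t_def)
    then have "F (0 + t) < F 0" using d by blast
    then have "K2 (t + \<alpha>) - K2 \<alpha> < (1 + 1/20000) * (K2 t - K2 0)"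
      unfolding F_def by (simp add: right_diff_distrib)
    then show "\<exists>t. 0 < t \<and> t < (1/2)^n \<and> K2 (t + \<alpha>) - K2 \<alpha> < (1 + 1/20000) * (K2 t - K2 0)"
      using t by (auto simp: \<epsilon>_def)
    fix x :: real
    show "K2 x < K2 (x + (1/2)^n)"
      by (rule DERIV_pos_imp_increasing) (use K2 w2 in \<open>auto simp: weight_def\<close>)
  qed
  moreover have "\<bar>potential k2 x - potential k x\<bar> \<le> 6 * exp 6 * (1/2)^n" for x
  proof -
    have "potential k x \<le> 2 * exp (6 - 6 * \<epsilon>)" by (rule pot)
    also have "\<dots> \<le> 2 * exp 6" using \<epsilon> by simp
    finally have "3 * \<epsilon> * potential k x \<le> 3 * \<epsilon> * (2 * exp 6)" using \<epsilon> by (intro mult_left_mono) auto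
    also have "3 * \<epsilon> * (2 * exp 6) = 6 * exp 6 * (1/2)^n" by (simp add: \<epsilon>_def)
    finally show ?thesis using potdiff [of x] by linarith
  qed
  ultimately show thesis by (intro that [OF stage2 K2 cl])
qed

lemma stage_primitive_gap:
  assumes "stage n k N" and K: "\<And>x. (K has_real_derivative k x) (at x)" and "h > 0"
  shows "(1/2)^n * h \<le> K (x + h) - K x"
proof -
  have "K x - (1/2)^n * x \<le> K (x + h) - (1/2)^n * (x + h)"
  proof (rule DERIV_nonneg_imp_nondecreasing [where f = "\<lambda>x. K x - (1/2)^n * x"])
    fix y
    have "((\<lambda>x. K x - (1/2)^n * x) has_real_derivative k y - (1/2)^n * 1) (at y)"
      by (intro DERIV_diff DERIV_cmult DERIV_ident K)
    moreover have "0 \<le> k y - (1/2)^n * 1" using assms(1) by (simp add: stage_def)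
    ultimately show "\<exists>d. ((\<lambda>x. K x - (1/2)^n * x) has_real_derivative d) (at y) \<and> 0 \<le> d" by blast
  qed (use \<open>h > 0\<close> in simp)
  then show ?thesis by (simp add: algebra_simps)
qed

text \<open>
The tolerances \<open>\<tau>\<close> are chosen along with the stages: each later change is at most half the current
tolerance and tolerances halve, so that the limit stays within the tolerance of every stage and
inherits what is open there.
\<close>

lemma approximating_sequence:
  obtains k K :: "nat \<Rightarrow> real \<Rightarrow> real" and N :: "nat \<Rightarrow> nat" and \<tau> :: "nat \<Rightarrow> real" where
    "\<And>n. stage n (k n) (N n)" "\<And>n x. (K n has_real_derivative k n x) (at x)" "\<And>n. K n 0 = 0"
    "\<And>n. 0 < \<tau> n" "\<And>n. \<tau> (Suc n) \<le> \<tau> n / 2" "\<And>n. close (\<tau> n / 2) (K n) (K (Suc n))"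
    "\<And>n x. \<bar>potential (k (Suc n)) x - potential (k n) x\<bar> \<le> 6 * exp 6 * (1/2)^n"
    "\<And>n K'. close (\<tau> (Suc n)) (K (Suc n)) K' \<Longrightarrow> kinked n K'"
proof -
  define P where "P n s = (case s of (k, K, N, \<tau>) \<Rightarrow> stage n k N \<and> (\<forall>x. (K has_real_derivative k x) (at x)) \<and>
      K 0 = 0 \<and> 0 < \<tau>)" for n and s :: "(real \<Rightarrow> real) \<times> (real \<Rightarrow> real) \<times> nat \<times> real"
  define Q where "Q n s s' = (case s of (k, K, N, \<tau>) \<Rightarrow> case s' of (k', K', N', \<tau>') \<Rightarrow>
      \<tau>' \<le> \<tau> / 2 \<and> close (\<tau> / 2) K K' \<and> (\<forall>x. \<bar>potential k' x - potential k x\<bar> \<le> 6 * exp 6 * (1/2)^n) \<and>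
      (\<forall>K''. close \<tau>' K' K'' \<longrightarrow> kinked n K''))"
    for n and s s' :: "(real \<Rightarrow> real) \<times> (real \<Rightarrow> real) \<times> nat \<times> real"
  have "\<exists>f. \<forall>n. P n (f n) \<and> Q n (f n) (f (Suc n))"
  proof (rule dependent_nat_choice)
    have "P 0 (\<lambda>_. 1, \<lambda>x. x, 1, 1)" by (simp add: P_def stage_0 del: One_nat_def)
    then show "\<exists>s. P 0 s" ..
    fix s n assume "P n s"
    obtain k K N \<tau> where s: "s = (k, K, N, \<tau>)" by (cases s)
    have st: "stage n k N" "\<And>x. (K has_real_derivative k x) (at x)" "K 0 = 0" and \<tau>: "0 < \<tau>"
      using \<open>P n s\<close> by (auto simp: P_def s)
    obtain k' K' N' where st': "stage (Suc n) k' N'" "\<And>x. (K' has_real_derivative k' x) (at x)" "K' 0 = 0"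
      and cl: "close (\<tau>/2) K K'" and pot: "\<And>x. \<bar>potential k' x - potential k x\<bar> \<le> 6 * exp 6 * (1/2)^n"
      and kin: "kinked n K'"
      by (rule stage_step [OF st(1) half_gt_zero [OF \<tau>] st(2,3)]) blast
    have gap: "(1/2) ^ Suc n * (1/2) ^ n \<le> K' (x + (1/2)^n) - K' x" for x
      by (rule stage_primitive_gap [OF st'(1,2)]) simp
    obtain \<eta> where \<eta>: "\<eta> > 0" "\<And>K''. close \<eta> K' K'' \<Longrightarrow> kinked n K''"
      by (rule kinked_stable [OF kin _ gap]) simp_all
    have "P (Suc n) (k', K', N', min \<eta> (\<tau>/2))"
      using st' \<eta> \<tau> by (simp add: P_def)
    moreover have "Q n s (k', K', N', min \<eta> (\<tau>/2))"
      using cl pot \<eta>(2) close_mono [of "min \<eta> (\<tau>/2)" K' _ \<eta>] by (simp add: Q_def s)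
    ultimately show "\<exists>s'. P (Suc n) s' \<and> Q n s s'" by blast
  qed
  then obtain f where f: "\<And>n. P n (f n)" "\<And>n. Q n (f n) (f (Suc n))" by blast
  show thesis
    by (rule that [of "\<lambda>n. fst (f n)" "\<lambda>n. fst (snd (snd (f n)))" "\<lambda>n. fst (snd (f n))" "\<lambda>n. snd (snd (snd (f n)))"])
      (use f in \<open>auto simp: P_def Q_def case_prod_beta\<close>)
qed

definition rotation_sum :: "(real \<Rightarrow> real) \<Rightarrow> real \<Rightarrow> real" where
  "rotation_sum K x = K (x + \<alpha>) + K (x - \<alpha>)"

text \<open>
The relation between \<open>rotation_sum K\<close> and \<open>K\<close> says that \<open>V\<close> is the derivative of the former with respect
to the latter. At each stage the mean value theorem of Cauchy yields it in the form of an identity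
between increments, with the potential at an intermediate point, where only the uniform limit of the
potentials is needed. Strict monotonicity of the limit comes from its survival at all scales
\<open>(1/2) ^ n\<close>. The limit is finally divided by its increment over one period.
\<close>

lemma singular_conjugacy:
  obtains K V :: "real \<Rightarrow> real" and B :: real where
    "strict_mono K" "continuous_on UNIV K" "\<And>x. K (x + 1) = K x + 1"
    "continuous_on UNIV V" "\<And>x. V x \<le> B"
    "\<And>a e. e > 0 \<Longrightarrow> \<exists>d>0. \<forall>x. \<bar>x - a\<bar> < d \<longrightarrow>
        \<bar>rotation_sum K x - rotation_sum K a - V a * (K x - K a)\<bar> \<le> e * \<bar>K x - K a\<bar>"
    "\<And>e. e > 0 \<Longrightarrow> \<exists>t. 0 < t \<and> t < e \<and> K (t + \<alpha>) - K \<alpha> \<ge> (1 + 1/10000) * (K t - K 0)"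
    "\<And>e. e > 0 \<Longrightarrow> \<exists>t. 0 < t \<and> t < e \<and> K (t + \<alpha>) - K \<alpha> \<le> (1 + 1/20000) * (K t - K 0)"
proof -
  obtain k K :: "nat \<Rightarrow> real \<Rightarrow> real" and N :: "nat \<Rightarrow> nat" and \<tau> :: "nat \<Rightarrow> real" where
    st: "\<And>n. stage n (k n) (N n)" and K: "\<And>n x. (K n has_real_derivative k n x) (at x)" and K0: "\<And>n. K n 0 = 0"
    and \<tau>: "\<And>n. 0 < \<tau> n" "\<And>n. \<tau> (Suc n) \<le> \<tau> n / 2" and cl: "\<And>n. close (\<tau> n / 2) (K n) (K (Suc n))"
    and pot: "\<And>n x. \<bar>potential (k (Suc n)) x - potential (k n) x\<bar> \<le> 6 * exp 6 * (1/2)^n"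
    and kin: "\<And>n K'. close (\<tau> (Suc n)) (K (Suc n)) K' \<Longrightarrow> kinked n K'"
    by (rule approximating_sequence) blast
  have kpos: "0 < k n x" and kper: "k n (x + 1) = k n x" for n x
    using st [of n] by (auto simp: stage_def weight_def circle_fun_def)
  have "\<exists>L. (\<lambda>n. K n x) \<longlonglongrightarrow> L \<and> (\<forall>n. \<bar>K n x - L\<bar> \<le> 2 * (\<tau> n / 2 * (1 + \<bar>x\<bar>)))" for x
  proof (rule halving_limit [of "\<lambda>n. K n x" "\<lambda>n. \<tau> n / 2 * (1 + \<bar>x\<bar>)"])
    show "\<bar>K (Suc n) x - K n x\<bar> \<le> \<tau> n / 2 * (1 + \<bar>x\<bar>)" for n using cl by (simp add: close_def)
    show "\<tau> (Suc n) / 2 * (1 + \<bar>x\<bar>) \<le> \<tau> n / 2 * (1 + \<bar>x\<bar>) / 2" for n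
      using mult_right_mono [OF \<tau>(2) [of n], of "(1 + \<bar>x\<bar>) / 2"] by simp
  qed blast
  then obtain L where lim: "\<And>x. (\<lambda>n. K n x) \<longlonglongrightarrow> L x" and L: "\<And>n x. \<bar>K n x - L x\<bar> \<le> \<tau> n * (1 + \<bar>x\<bar>)"
    by (simp del: abs_le_iff) metis
  have "\<exists>W. (\<lambda>n. potential (k n) x) \<longlonglongrightarrow> W \<and> (\<forall>n. \<bar>potential (k n) x - W\<bar> \<le> 2 * (6 * exp 6 * (1/2)^n))" for x
    by (rule halving_limit [of "\<lambda>n. potential (k n) x" "\<lambda>n. 6 * exp 6 * (1/2)^n"]) (use pot in auto)
  then obtain V where Vlim: "\<And>x. (\<lambda>n. potential (k n) x) \<longlonglongrightarrow> V x"
    and V: "\<And>n x. \<bar>potential (k n) x - V x\<bar> \<le> 2 * (6 * exp 6 * (1/2)^n)" by metis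
  have half0: "(\<lambda>n. C * (1/2)^n) \<longlonglongrightarrow> 0" for C :: real
    using tendsto_mult [OF tendsto_const [of C] LIMSEQ_power_zero [of "1/2::real"]] by simp
  have \<tau>0: "\<tau> \<longlonglongrightarrow> 0"
  proof (rule tendsto_sandwich [of "\<lambda>_. 0" \<tau> sequentially "\<lambda>n. \<tau> 0 * (1/2) ^ n"])
    have "\<tau> n \<le> \<tau> 0 * (1/2) ^ n" for n
    proof (induction n)
      case (Suc n)
      then show ?case using \<tau>(2) [of n] by simp
    qed simp
    then show "\<forall>\<^sub>F n in sequentially. \<tau> n \<le> \<tau> 0 * (1/2) ^ n" by simp
  qed (use \<tau> half0 in \<open>auto simp: less_imp_le\<close>)
  have Vcont: "continuous_on UNIV V"
  proof (rule uniform_limit_theorem)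
    show "\<forall>\<^sub>F n in sequentially. continuous_on UNIV (potential (k n))"
    proof (rule always_eventually, rule)
      fix n
      have kn: "circle_fun (k n)" using st [of n] by (simp add: stage_def weight_def)
      have "k n x \<noteq> 0" for x using kpos [of n x] by simp
      then have "circle_fun (\<lambda>x. (k n (x + \<alpha>) + k n (x + - \<alpha>)) / k n x)"
        by (intro circle_fun_divide [OF circle_fun_add [OF circle_fun_shift [OF kn] circle_fun_shift [OF kn]] kn])
      then show "continuous_on UNIV (potential (k n))"
        unfolding potential_def [abs_def] by (auto dest: circle_fun_cont)
    qed
    show "uniform_limit UNIV (\<lambda>n. potential (k n)) V sequentially"
    proof (rule uniform_limitI)
      fix e :: real assume "e > 0"
      then have "\<forall>\<^sub>F n in sequentially. 2 * (6 * exp 6) * (1/2)^n < e"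
        by (rule order_tendstoD(2) [OF half0])
      then show "\<forall>\<^sub>F n in sequentially. \<forall>x\<in>UNIV. dist (potential (k n) x) (V x) < e"
      proof eventually_elim
        case (elim n)
        have "dist (potential (k n) x) (V x) < e" for x
          using V [of n x] elim unfolding dist_real_def by linarith
        then show ?case by blast
      qed
    qed
  qed simp
  have Lcont: "isCont L x" for x
  proof -
    define R where "R = \<bar>x\<bar> + 1"
    have "continuous_on {-R<..<R} L"
    proof (rule uniform_limit_theorem)
      show "\<forall>\<^sub>F n in sequentially. continuous_on {-R<..<R} (K n)"
        using K by (intro always_eventually allI DERIV_continuous_on) (blast intro: has_field_derivative_at_within)
      show "uniform_limit {-R<..<R} K L sequentially"
      proof (rule uniform_limitI)
        fix e :: real assume "e > 0"
        have "(\<lambda>n. \<tau> n * (1 + R)) \<longlonglongrightarrow> 0 * (1 + R)" by (intro tendsto_intros \<tau>0)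
        then have "\<forall>\<^sub>F n in sequentially. \<tau> n * (1 + R) < e"
          using \<open>e > 0\<close> by (intro order_tendstoD(2)) simp_all
        then show "\<forall>\<^sub>F n in sequentially. \<forall>x\<in>{-R<..<R}. dist (K n x) (L x) < e"
        proof eventually_elim
          case (elim n)
          have "dist (K n y) (L y) < e" if "y \<in> {-R<..<R}" for y
          proof -
            have "\<bar>K n y - L y\<bar> \<le> \<tau> n * (1 + \<bar>y\<bar>)" by (rule L)
            also have "\<dots> \<le> \<tau> n * (1 + R)" using \<tau>(1) [of n] that by (intro mult_left_mono) auto
            finally show ?thesis using elim by (simp add: dist_real_def)
          qed
          then show ?case by blast
        qed
      qed
    qed simp
    moreover have "x \<in> {-R<..<R}" unfolding R_def by auto
    ultimately show ?thesis using continuous_on_eq_continuous_at open_greaterThanLessThan by blast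
  qed
  have Lkin: "kinked n L" for n
    by (rule kin) (use L in \<open>simp add: close_def abs_minus_commute\<close>)
  have Kper: "K n (x + 1) - K n x = K n 1 - K n 0" for n x
    by (rule primitive_add_one [OF K kper])
  have Lper: "L (x + 1) = L x + L 1" for x
  proof -
    have "(\<lambda>n. K n (x + 1) - K n x) \<longlonglongrightarrow> L (x + 1) - L x" by (intro tendsto_diff lim)
    moreover have "(\<lambda>n. K n 1 - K n 0) \<longlonglongrightarrow> L 1 - L 0" by (intro tendsto_diff lim)
    ultimately have "L (x + 1) - L x = L 1 - L 0"
      unfolding Kper by (rule LIMSEQ_unique)
    moreover have "L 0 = 0" using lim [of 0] K0 by (simp add: LIMSEQ_const_iff)
    ultimately show ?thesis by simp
  qed
  have Lper_int: "L (x + of_int m) = L x + of_int m * L 1" for x m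
    using periodic_add_of_int [of "\<lambda>x. L x - x * L 1" x m] Lper by (simp add: algebra_simps)
  have Lmono: "L x \<le> L y" if "x \<le> y" for x y
  proof (rule LIMSEQ_le [OF lim lim])
    have "K n x \<le> K n y" for n
      by (rule DERIV_nonneg_imp_nondecreasing [OF that]) (use K kpos less_imp_le in blast)
    then show "\<exists>m. \<forall>n\<ge>m. K n x \<le> K n y" by blast
  qed
  have Lstrict: "strict_mono L"
  proof (rule strict_monoI)
    fix x y :: real assume "x < y"
    define u where "u = frac x"
    define v where "v = y - of_int \<lfloor>x\<rfloor>"
    have u: "u \<in> {0..1}" using frac_lt_1 [of x] by (simp add: u_def less_imp_le)
    have x: "x = u + of_int \<lfloor>x\<rfloor>" and y: "y = v + of_int \<lfloor>x\<rfloor>" by (simp_all add: u_def v_def frac_def)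
    have "u < v" using \<open>x < y\<close> by (simp add: u_def v_def frac_def)
    then obtain n where "(1/2)^n < v - u" using real_arch_pow_inv [of "v - u" "1/2"] by auto
    then have "L u < L (u + (1/2)^n)" "L (u + (1/2)^n) \<le> L v"
      using Lkin [of n] u by (auto simp: kinked_def intro: Lmono)
    then show "L x < L y" using Lper_int [of u "\<lfloor>x\<rfloor>"] Lper_int [of v "\<lfloor>x\<rfloor>"] x y by simp
  qed
  define I where "I = L 1"
  have "I > 0"
    using strict_monoD [OF Lstrict, of 0 1] Lper [of 0] by (simp add: I_def)
  \<comment> \<open>Cauchy's mean value theorem: \<open>potential (k n) * k n\<close> is the
    derivative of \<open>rotation_sum (K n)\<close>.\<close>
  have sum_n: "\<exists>\<xi>. a < \<xi> \<and> \<xi> < b \<and> rotation_sum (K n) b - rotation_sum (K n) a = potential (k n) \<xi> * (K n b - K n a)"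
    if "a < b" for n a b
  proof -
    have D: "(rotation_sum (K n) has_real_derivative potential (k n) x * k n x) (at x)" for x
    proof -
      have "(rotation_sum (K n) has_real_derivative k n (x + \<alpha>) + k n (x + - \<alpha>)) (at x)"
        unfolding rotation_sum_def [abs_def] diff_conv_add_uminus
        by (intro DERIV_add) (simp_all only: K DERIV_shift [symmetric])
      then show ?thesis using kpos [of n x] by (simp add: potential_def)
    qed
    have "\<exists>\<xi>>a. \<xi> < b \<and>
      (rotation_sum (K n) b - rotation_sum (K n) a) * k n \<xi> = (K n b - K n a) * (potential (k n) \<xi> * k n \<xi>)"
      by (rule GMVT' [OF that]) (use D K in \<open>auto intro: DERIV_isCont\<close>)
    then obtain \<xi> where \<xi>: "a < \<xi>" "\<xi> < b"
      and "(rotation_sum (K n) b - rotation_sum (K n) a) * k n \<xi> = (K n b - K n a) * (potential (k n) \<xi> * k n \<xi>)"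
      by blast
    then have "(rotation_sum (K n) b - rotation_sum (K n) a) * k n \<xi> = (potential (k n) \<xi> * (K n b - K n a)) * k n \<xi>"
      by (simp only: mult_ac)
    then show ?thesis using \<xi> kpos [of n \<xi>] by auto
  qed
  have incr: "\<bar>rotation_sum L x - rotation_sum L a - V a * (L x - L a)\<bar> \<le> e * \<bar>L x - L a\<bar>"
    if e: "e > 0" and near: "\<And>\<xi>. \<bar>\<xi> - a\<bar> < \<bar>x - a\<bar> \<Longrightarrow> \<bar>V \<xi> - V a\<bar> \<le> e" for x a e
  proof (rule LIMSEQ_le)
    show "(\<lambda>n. \<bar>rotation_sum (K n) x - rotation_sum (K n) a - V a * (K n x - K n a)\<bar>)
        \<longlonglongrightarrow> \<bar>rotation_sum L x - rotation_sum L a - V a * (L x - L a)\<bar>"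
      unfolding rotation_sum_def by (intro tendsto_intros lim)
    have "(\<lambda>n. (e + 2 * (6 * exp 6) * (1/2)^n) * \<bar>K n x - K n a\<bar>) \<longlonglongrightarrow> (e + 0) * \<bar>L x - L a\<bar>"
      by (intro tendsto_intros lim half0)
    then show "(\<lambda>n. (e + 2 * (6 * exp 6) * (1/2)^n) * \<bar>K n x - K n a\<bar>) \<longlonglongrightarrow> e * \<bar>L x - L a\<bar>" by simp
    have "\<bar>rotation_sum (K n) x - rotation_sum (K n) a - V a * (K n x - K n a)\<bar>
        \<le> (e + 2 * (6 * exp 6) * (1/2)^n) * \<bar>K n x - K n a\<bar>" for n
    proof -
      have ex: "\<exists>\<xi>. \<bar>\<xi> - a\<bar> < \<bar>x - a\<bar> \<and>
          rotation_sum (K n) x - rotation_sum (K n) a = potential (k n) \<xi> * (K n x - K n a)" if "x \<noteq> a"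
      proof (cases "a < x")
        case True
        then obtain \<xi> where "a < \<xi>" "\<xi> < x"
          "rotation_sum (K n) x - rotation_sum (K n) a = potential (k n) \<xi> * (K n x - K n a)"
          using sum_n [of a x n] by blast
        then show ?thesis by (intro exI [of _ \<xi>]) simp
      next
        case False
        then have "x < a" using that by simp
        then obtain \<xi> where "x < \<xi>" "\<xi> < a"
          "rotation_sum (K n) a - rotation_sum (K n) x = potential (k n) \<xi> * (K n a - K n x)"
          using sum_n [of x a n] that by blast
        then show ?thesis by (intro exI [of _ \<xi>]) (auto simp: algebra_simps)
      qed
      show ?thesis
      proof (cases "x = a")
        case False
        then obtain \<xi> where \<xi>: "\<bar>\<xi> - a\<bar> < \<bar>x - a\<bar>"
          "rotation_sum (K n) x - rotation_sum (K n) a = potential (k n) \<xi> * (K n x - K n a)"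
          using ex by blast
        have "\<bar>potential (k n) \<xi> - V a\<bar> \<le> e + 2 * (6 * exp 6) * (1/2)^n"
          using near [OF \<xi>(1)] V [of n \<xi>] by linarith
        then have "\<bar>(potential (k n) \<xi> - V a) * (K n x - K n a)\<bar> \<le> (e + 2 * (6 * exp 6) * (1/2)^n) * \<bar>K n x - K n a\<bar>"
          unfolding abs_mult by (intro mult_right_mono) auto
        then show ?thesis using \<xi>(2) by (simp add: left_diff_distrib)
      qed simp
    qed
    then show "\<exists>m. \<forall>n\<ge>m. \<bar>rotation_sum (K n) x - rotation_sum (K n) a - V a * (K n x - K n a)\<bar>
        \<le> (e + 2 * (6 * exp 6) * (1/2)^n) * \<bar>K n x - K n a\<bar>" by blast
  qed
  have small: "\<exists>n. (1/2::real)^n < e" if "e > 0" for e :: real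
    using real_arch_pow_inv [of e "1/2"] that by auto
  show thesis
  proof (rule that [of "\<lambda>x. L x / I" V "2 * exp 6"])
    show "strict_mono (\<lambda>x. L x / I)"
      using Lstrict \<open>I > 0\<close> by (auto simp: strict_mono_def divide_strict_right_mono)
    show "continuous_on UNIV (\<lambda>x. L x / I)"
      using Lcont \<open>I > 0\<close> by (intro continuous_intros continuous_at_imp_continuous_on) auto
    show "L (x + 1) / I = L x / I + 1" for x using Lper [of x] \<open>I > 0\<close> by (simp add: I_def field_simps)
    show "continuous_on UNIV V" by fact
    show "V x \<le> 2 * exp 6" for x
    proof (rule LIMSEQ_le_const2 [OF Vlim])
      have "potential (k n) x \<le> 2 * exp 6" for n
      proof -
        have "potential (k n) x \<le> 2 * exp (6 - 6 * (1/2)^n)" using st [of n] by (simp add: stage_def)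
        also have "\<dots> \<le> 2 * exp 6" by simp
        finally show ?thesis .
      qed
      then show "\<exists>m. \<forall>n\<ge>m. potential (k n) x \<le> 2 * exp 6" by blast
    qed
    fix e :: real assume e: "e > 0"
    show "\<exists>t. 0 < t \<and> t < e \<and> L (t + \<alpha>) / I - L \<alpha> / I \<ge> (1 + 1/10000) * (L t / I - L 0 / I)"
    proof -
      obtain n where n: "(1/2)^n < e" using small [OF e] by blast
      obtain t where t: "0 < t" "t < (1/2)^n" "L (t + \<alpha>) - L \<alpha> > (1 + 1/10000) * (L t - L 0)"
        using Lkin [of n] by (auto simp: kinked_def)
      then have "(L (t + \<alpha>) - L \<alpha>) / I \<ge> ((1 + 1/10000) * (L t - L 0)) / I"
        using \<open>I > 0\<close> by (intro divide_right_mono) auto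
      then show ?thesis using t n by (intro exI [of _ t]) (simp add: diff_divide_distrib right_diff_distrib)
    qed
    show "\<exists>t. 0 < t \<and> t < e \<and> L (t + \<alpha>) / I - L \<alpha> / I \<le> (1 + 1/20000) * (L t / I - L 0 / I)"
    proof -
      obtain n where n: "(1/2)^n < e" using small [OF e] by blast
      obtain t where t: "0 < t" "t < (1/2)^n" "L (t + \<alpha>) - L \<alpha> < (1 + 1/20000) * (L t - L 0)"
        using Lkin [of n] by (auto simp: kinked_def)
      then have "(L (t + \<alpha>) - L \<alpha>) / I \<le> ((1 + 1/20000) * (L t - L 0)) / I"
        using \<open>I > 0\<close> by (intro divide_right_mono) auto
      then show ?thesis using t n by (intro exI [of _ t]) (simp add: diff_divide_distrib right_diff_distrib)
    qed
    fix a :: real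
    have "isCont V a" using Vcont by (simp add: continuous_on_eq_continuous_at)
    then obtain d where d: "d > 0" "\<And>\<xi>. \<bar>\<xi> - a\<bar> < d \<Longrightarrow> \<bar>V \<xi> - V a\<bar> < e"
      using e unfolding continuous_at_eps_delta dist_real_def by blast
    have "\<bar>rotation_sum (\<lambda>x. L x / I) x - rotation_sum (\<lambda>x. L x / I) a - V a * (L x / I - L a / I)\<bar>
        \<le> e * \<bar>L x / I - L a / I\<bar>" if "\<bar>x - a\<bar> < d" for x
    proof -
      have "\<bar>rotation_sum L x - rotation_sum L a - V a * (L x - L a)\<bar> \<le> e * \<bar>L x - L a\<bar>"
        using d(2) that by (intro incr [OF e]) (meson less_imp_le less_trans)
      then have "\<bar>rotation_sum L x - rotation_sum L a - V a * (L x - L a)\<bar> / I \<le> e * \<bar>L x - L a\<bar> / I"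
        using \<open>I > 0\<close> by (intro divide_right_mono) auto
      moreover have "rotation_sum (\<lambda>x. L x / I) x - rotation_sum (\<lambda>x. L x / I) a - V a * (L x / I - L a / I)
          = (rotation_sum L x - rotation_sum L a - V a * (L x - L a)) / I"
        by (simp add: rotation_sum_def diff_divide_distrib add_divide_distrib right_diff_distrib)
      moreover have "L x / I - L a / I = (L x - L a) / I" by (simp add: diff_divide_distrib)
      ultimately show ?thesis using \<open>I > 0\<close> by (simp add: abs_divide)
    qed
    then show "\<exists>d>0. \<forall>x. \<bar>x - a\<bar> < d \<longrightarrow>
        \<bar>rotation_sum (\<lambda>x. L x / I) x - rotation_sum (\<lambda>x. L x / I) a - V a * (L x / I - L a / I)\<bar> \<le> e * \<bar>L x / I - L a / I\<bar>"
      using d(1) by blast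
  qed
qed

end

section \<open>The circle homeomorphism\<close>

lemma strict_mono_circle_lift_inverse:
  fixes K :: "real \<Rightarrow> real"
  assumes K: "strict_mono K" "continuous_on UNIV K" "\<And>x. K (x + 1) = K x + 1"
  obtains J where "\<And>x. J (K x) = x" "\<And>u. K (J u) = u" "strict_mono J" "continuous_on UNIV J" "\<And>u. J (u + 1) = J u + 1"
proof -
  have iter: "K (x + of_int m) = K x + of_int m" for x m
    using periodic_add_of_int [of "\<lambda>x. K x - x" x m] K(3) by simp
  have surj: "\<exists>x. K x = u" for u
  proof -
    define m where "m = \<lfloor>u - K 0\<rfloor>"
    have "K (0 + of_int m) \<le> u" "u \<le> K (0 + of_int (m + 1))"
      unfolding iter m_def by linarith+
    then show ?thesis
      using IVT' [of K "0 + of_int m" u "0 + of_int (m + 1)"] K(2) continuous_on_subset by force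
  qed
  have inj: "inj K" using K(1) by (rule strict_mono_imp_inj_on)
  define J where "J = inv K"
  have JK: "J (K x) = x" for x using inj by (simp add: J_def)
  have KJ: "K (J u) = u" for u unfolding J_def using surj by (metis surj_f_inv_f surjI)
  have "strict_mono J"
    by (rule strict_monoI) (metis KJ K(1) strict_mono_less)
  moreover have "continuous_on UNIV J"
  proof -
    have "isCont J (K x)" for x
      by (rule isCont_inverse_function [of 1]) (use JK K(2) in \<open>auto simp: continuous_on_eq_continuous_at\<close>)
    then show ?thesis by (metis KJ continuous_at_imp_continuous_on)
  qed
  moreover have "J (u + 1) = J u + 1" for u by (metis K(3) JK KJ)
  ultimately show thesis using that JK KJ by blast
qed

context irrational_rotation
begin

text \<open>
Both \<open>h\<close> and its inverse increase, so any increment of \<open>h\<close> is bounded by that of their sum; this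
gives the Lipschitz bound. If \<open>h\<close> were differentiable at \<open>K 0\<close>, its derivative could be
computed along \<open>K t\<close> for \<open>t\<close> decreasing to \<open>0\<close>, where the quotients are at least \<open>1 + 1/10000\<close>
for arbitrarily small \<open>t\<close> and at most \<open>1 + 1/20000\<close> for others.
\<close>

lemma circle_map_of_conjugacy:
  fixes K V :: "real \<Rightarrow> real" and B :: real
  assumes K: "strict_mono K" "continuous_on UNIV K" "\<And>x. K (x + 1) = K x + 1"
    and V: "continuous_on UNIV V" "\<And>x. V x \<le> B"
    and incr: "\<And>a e. e > 0 \<Longrightarrow> \<exists>d>0. \<forall>x. \<bar>x - a\<bar> < d \<longrightarrow>
        \<bar>rotation_sum K x - rotation_sum K a - V a * (K x - K a)\<bar> \<le> e * \<bar>K x - K a\<bar>"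
    and steep: "\<And>e. e > 0 \<Longrightarrow> \<exists>t. 0 < t \<and> t < e \<and> K (t + \<alpha>) - K \<alpha> \<ge> (1 + 1/10000) * (K t - K 0)"
    and flat: "\<And>e. e > 0 \<Longrightarrow> \<exists>t. 0 < t \<and> t < e \<and> K (t + \<alpha>) - K \<alpha> \<le> (1 + 1/20000) * (K t - K 0)"
  obtains h h' \<phi>' where "\<And>x. h (K x) = K (x + \<alpha>)" "\<And>u. h' (h u) = u" "\<And>u. h (h' u) = u"
    "\<And>u. h (u + 1) = h u + 1" "\<And>u. h' (u + 1) = h' u + 1" "continuous_on UNIV h" "continuous_on UNIV h'"
    "\<And>u. ((\<lambda>u. h u + h' u - 2 * u) has_real_derivative \<phi>' u) (at u)" "continuous_on UNIV \<phi>'"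
    "\<And>u v. \<bar>h u - h v\<bar> \<le> B * \<bar>u - v\<bar>" "\<not> h differentiable (at (K 0))"
proof -
  obtain J where JK: "\<And>x. J (K x) = x" and KJ: "\<And>u. K (J u) = u"
    and J: "strict_mono J" "continuous_on UNIV J" "\<And>u. J (u + 1) = J u + 1"
    by (rule strict_mono_circle_lift_inverse [OF K]) blast
  define h where "h u = K (J u + \<alpha>)" for u
  define h' where "h' u = K (J u - \<alpha>)" for u
  have cont: "continuous_on UNIV h" "continuous_on UNIV h'"
    unfolding h_def h'_def
    by (intro continuous_on_compose2 [OF K(2)] continuous_intros J(2) subset_UNIV)+
  have mono: "h u \<le> h v" "h' u \<le> h' v" if "u \<le> v" for u v
    using that by (auto simp: h_def h'_def strict_mono_less_eq [OF K(1)] strict_mono_less_eq [OF J(1)])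
  define S where "S u = h u + h' u" for u
  have SD: "(S has_real_derivative V (J u)) (at u)" for u
    unfolding has_field_derivative_def has_derivative_at_alt
  proof (intro conjI allI impI)
    show "bounded_linear ((*) (V (J u)))" by (rule bounded_linear_mult_right)
    fix e :: real assume "e > 0"
    then obtain d where d: "d > 0" "\<And>x. \<bar>x - J u\<bar> < d \<Longrightarrow>
        \<bar>rotation_sum K x - rotation_sum K (J u) - V (J u) * (K x - K (J u))\<bar> \<le> e * \<bar>K x - K (J u)\<bar>"
      using incr by blast
    have "isCont J u" using J(2) by (simp add: continuous_on_eq_continuous_at)
    then obtain d' where d': "d' > 0" "\<And>v. \<bar>v - u\<bar> < d' \<Longrightarrow> \<bar>J v - J u\<bar> < d"
      using d(1) unfolding continuous_at_eps_delta dist_real_def by blast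
    have "norm (S v - S u - V (J u) * (v - u)) \<le> e * norm (v - u)" if "norm (v - u) < d'" for v
    proof -
      have "\<bar>J v - J u\<bar> < d" using d'(2) that by simp
      from d(2) [OF this] show ?thesis
        unfolding KJ rotation_sum_def S_def h_def h'_def real_norm_def .
    qed
    then show "\<exists>d>0. \<forall>v. norm (v - u) < d \<longrightarrow> norm (S v - S u - V (J u) * (v - u)) \<le> e * norm (v - u)"
      using d'(1) by blast
  qed
  have lip: "h v - h u \<le> B * (v - u)" if "u \<le> v" for u v
  proof -
    have "S v - B * v \<le> S u - B * u"
    proof (rule DERIV_nonpos_imp_nonincreasing [OF that, where f = "\<lambda>x. S x - B * x"])
      fix x
      have "((\<lambda>x. S x - B * x) has_real_derivative V (J x) - B * 1) (at x)"
        by (intro DERIV_diff DERIV_cmult DERIV_ident SD)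
      then show "\<exists>y. ((\<lambda>x. S x - B * x) has_real_derivative y) (at x) \<and> y \<le> 0" using V(2) [of "J x"] by auto
    qed
    then show ?thesis using mono(2) [OF that] by (simp add: S_def algebra_simps)
  qed
  show thesis
  proof (rule that [of h h' "\<lambda>u. V (J u) - 2 * 1"])
    show "h (K x) = K (x + \<alpha>)" for x by (simp add: h_def JK)
    show "h' (h u) = u" "h (h' u) = u" for u by (simp_all add: h_def h'_def JK KJ)
    show "h (u + 1) = h u + 1" for u using K(3) [of "J u + \<alpha>"] unfolding h_def J(3) by (simp add: add_ac)
    show "h' (u + 1) = h' u + 1" for u using K(3) [of "J u - \<alpha>"] unfolding h'_def J(3) by (simp add: algebra_simps)
    show "continuous_on UNIV h" "continuous_on UNIV h'" by fact+
    show "((\<lambda>u. h u + h' u - 2 * u) has_real_derivative V (J u) - 2 * 1) (at u)" for u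
      using SD [of u] unfolding S_def by (intro DERIV_diff DERIV_cmult DERIV_ident)
    show "continuous_on UNIV (\<lambda>u. V (J u) - 2 * 1)"
      by (intro continuous_intros continuous_on_compose2 [OF V(1)] J(2)) auto
    show "\<bar>h u - h v\<bar> \<le> B * \<bar>u - v\<bar>" for u v
      using lip [of u v] lip [of v u] mono(1) [of u v] mono(1) [of v u] by (cases "u \<le> v") auto
    show "\<not> h differentiable (at (K 0))"
    proof
      assume "h differentiable (at (K 0))"
      then obtain D where "(h has_real_derivative D) (at (K 0))" by (auto simp: real_differentiable_def)
      then have "((\<lambda>u. (h u - h (K 0)) / (u - K 0)) \<longlongrightarrow> D) (at (K 0))" by (simp add: has_field_derivative_iff)
      moreover have "filterlim K (at (K 0)) (at_right 0)"
      proof -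
        have "(K \<longlongrightarrow> K 0) (at_right 0)"
          by (rule tendsto_mono [OF at_le [OF subset_UNIV]])
            (use K(2) in \<open>simp add: continuous_on_eq_continuous_at isCont_def\<close>)
        moreover have "\<forall>\<^sub>F t in at_right 0. K t \<noteq> K 0"
          using strict_mono_eq [OF K(1)] by (auto simp: eventually_at_filter)
        ultimately show ?thesis by (simp add: filterlim_at)
      qed
      ultimately have "((\<lambda>t. (h (K t) - h (K 0)) / (K t - K 0)) \<longlongrightarrow> D) (at_right 0)"
        by (rule filterlim_compose)
      then have lim: "((\<lambda>t. (K (t + \<alpha>) - K \<alpha>) / (K t - K 0)) \<longlongrightarrow> D) (at_right 0)"
        by (simp add: h_def JK)
      have pos: "K t - K 0 > 0" if "t > 0" for t using strict_monoD [OF K(1) that] by simp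
      have "D \<ge> 1 + 1/10000"
      proof (rule ccontr)
        assume "\<not> D \<ge> 1 + 1/10000"
        then have "\<forall>\<^sub>F t in at_right 0. (K (t + \<alpha>) - K \<alpha>) / (K t - K 0) < 1 + 1/10000"
          by (intro order_tendstoD(2) [OF lim]) simp
        then obtain e where e: "e > 0" "\<And>t. 0 < t \<Longrightarrow> t < e \<Longrightarrow> (K (t + \<alpha>) - K \<alpha>) / (K t - K 0) < 1 + 1/10000"
          by (auto simp: eventually_at_right_field)
        obtain t where t: "0 < t" "t < e" "K (t + \<alpha>) - K \<alpha> \<ge> (1 + 1/10000) * (K t - K 0)" using steep [OF e(1)] by blast
        show False using e(2) [OF t(1,2)] t(3) pos [OF t(1)] by (simp only: pos_divide_less_eq)
      qed
      moreover have "D \<le> 1 + 1/20000"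
      proof (rule ccontr)
        assume "\<not> D \<le> 1 + 1/20000"
        then have "\<forall>\<^sub>F t in at_right 0. (K (t + \<alpha>) - K \<alpha>) / (K t - K 0) > 1 + 1/20000"
          by (intro order_tendstoD(1) [OF lim]) simp
        then obtain e where e: "e > 0" "\<And>t. 0 < t \<Longrightarrow> t < e \<Longrightarrow> (K (t + \<alpha>) - K \<alpha>) / (K t - K 0) > 1 + 1/20000"
          by (auto simp: eventually_at_right_field)
        obtain t where t: "0 < t" "t < e" "K (t + \<alpha>) - K \<alpha> \<le> (1 + 1/20000) * (K t - K 0)" using flat [OF e(1)] by blast
        show False using e(2) [OF t(1,2)] t(3) pos [OF t(1)] by (simp only: pos_less_divide_eq)
      qed
      ultimately show False by simp
    qed
  qed
qed

end

section \<open>Maps of the annulus and their lifts\<close>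

lemma to_circle_rep_circle [simp]: "to_circle (rep_circle c) = c"
  by (metis Quotient_circle Quotient_abs_rep)

lemma continuous_on_circle:
  fixes f :: "circle \<Rightarrow> 'a::topological_space"
  assumes "continuous_on UNIV (\<lambda>x. f (to_circle x))"
  shows "continuous_on UNIV f"
  unfolding continuous_on_open_vimage [OF open_UNIV]
proof (intro allI impI)
  fix U :: "'a set" assume "open U"
  then have "open ((\<lambda>x. f (to_circle x)) -` U)"
    using assms by (simp add: continuous_on_open_vimage)
  then show "open (f -` U \<inter> UNIV)" by (simp add: open_circle_def vimage_def)
qed

definition circle_lift :: "(real \<Rightarrow> 'a) \<Rightarrow> circle \<Rightarrow> 'a" where
  "circle_lift f c = f (rep_circle c)"

lemma circle_lift_to_circle:
  assumes "\<And>x. f (x + 1) = f x"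
  shows "circle_lift f (to_circle x) = f x"
proof -
  have "rep_circle (to_circle x) - x \<in> \<int>"
    by (subst to_circle_eq_iff [symmetric]) simp
  then obtain m where "rep_circle (to_circle x) - x = of_int m" by (rule Ints_cases)
  then have "rep_circle (to_circle x) = x + of_int m" by simp
  then show ?thesis unfolding circle_lift_def using periodic_add_of_int [of f, OF assms] by simp
qed

lemma to_circle_add_one [simp]: "to_circle (x + 1) = to_circle x"
  by (simp add: to_circle_eq_iff)

text \<open>
The condition for inducing a map of the annulus homotopic to the identity.
\<close>

definition equivariant :: "(real \<times> real \<Rightarrow> real \<times> real) \<Rightarrow> bool" where
  "equivariant G \<longleftrightarrow> continuous_on UNIV G \<and> (\<forall>x r. G (x + 1, r) = G (x, r) + (1, 0))"

definition descend :: "(real \<times> real \<Rightarrow> real \<times> real) \<Rightarrow> annulus \<Rightarrow> annulus" where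
  "descend G z = circle_lift (\<lambda>x. to_annulus (G (x, snd z))) (fst z)"

lemma descend_to_annulus:
  assumes "equivariant G"
  shows "descend G (to_annulus z) = to_annulus (G z)"
proof -
  have "to_annulus (G (x + 1, r)) = to_annulus (G (x, r))" for x r
    using assms by (simp add: equivariant_def to_annulus_def)
  then show ?thesis
    by (simp add: descend_def to_annulus_def circle_lift_to_circle)
qed

lemma to_annulus_surj: "\<exists>x r. z = to_annulus (x, r)"
  by (rule exI [of _ "rep_circle (fst z)"], rule exI [of _ "snd z"]) (simp add: to_annulus_def)

lemma is_lift_descend: "equivariant G \<Longrightarrow> is_lift G (descend G)"
  by (auto simp: is_lift_def equivariant_def descend_to_annulus [unfolded equivariant_def])

lemma descend_inverse:
  assumes "equivariant G" "equivariant G'" "\<And>z. G' (G z) = z" "\<And>z. G (G' z) = z"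
  shows "bij (descend G)" "inv (descend G) = descend G'"
proof -
  have 1: "descend G' (descend G z) = z" "descend G (descend G' z) = z" for z
    using to_annulus_surj [of z] assms by (auto simp: descend_to_annulus)
  then show "bij (descend G)" by (intro o_bij [of "descend G'"]) auto
  show "inv (descend G) = descend G'" using 1 by (intro inv_equality) auto
qed

text \<open>
The difference of the first coordinates is continuous with integer values on the connected plane.
This reduces a statement about all lifts to one about a single lift.
\<close>

lemma lifts_differ_by_translation:
  assumes "is_lift G g" "is_lift H g"
  obtains c where "\<And>z. fst (H z) = fst (G z) + c"
proof -
  define d where "d z = fst (H z) - fst (G z)" for z
  have "d z \<in> \<int>" for z
  proof -
    have "to_annulus (H z) = to_annulus (G z)"
      using assms by (metis is_lift_def comp_apply)
    then show ?thesis by (simp add: to_annulus_def to_circle_eq_iff d_def)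
  qed
  moreover have "continuous_on UNIV d"
    unfolding d_def using assms by (intro continuous_intros) (auto simp: is_lift_def)
  ultimately have "d constant_on UNIV"
  proof (intro continuous_discrete_range_constant)
    fix z assume d: "\<And>z. d z \<in> \<int>"
    have "1 \<le> norm (d y - d z)" if "d y \<noteq> d z" for y
      using Ints_nonzero_abs_ge1 [of "d y - d z"] d that by (simp add: Ints_diff)
    then show "\<exists>e>0. \<forall>y. y \<in> UNIV \<and> d y \<noteq> d z \<longrightarrow> e \<le> norm (d y - d z)"
      by (intro exI [of _ 1]) auto
  qed auto
  then obtain c where "\<And>z. d z = c" by (auto simp: constant_on_def)
  then show thesis using that [of c] unfolding d_def by (metis add.commute diff_add_cancel)
qed


section \<open>Standard maps\<close>

text \<open>
The linear map with matrix rows \<open>(a, b)\<close> and \<open>(c, d)\<close>; continuity of a derivative then amounts to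
continuity of the four entries.
\<close>

definition matrix_blinfun :: "real \<Rightarrow> real \<Rightarrow> real \<Rightarrow> real \<Rightarrow> (real \<times> real) \<Rightarrow>\<^sub>L (real \<times> real)" where
  "matrix_blinfun a b c d = Blinfun (\<lambda>v. (a * fst v + b * snd v, c * fst v + d * snd v))"

lemma matrix_blinfun_apply:
  "blinfun_apply (matrix_blinfun a b c d) = (\<lambda>v. (a * fst v + b * snd v, c * fst v + d * snd v))"
  unfolding matrix_blinfun_def
  by (rule bounded_linear_Blinfun_apply)
     (intro bounded_linear_intros bounded_linear_Pair bounded_linear_add
       bounded_linear_compose [OF bounded_linear_mult_right] bounded_linear_fst bounded_linear_snd)

lemma continuous_on_matrix_blinfun [continuous_intros]:
  fixes a b c d :: "'a::t2_space \<Rightarrow> real"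
  assumes "continuous_on S a" "continuous_on S b" "continuous_on S c" "continuous_on S d"
  shows "continuous_on S (\<lambda>x. matrix_blinfun (a x) (b x) (c x) (d x))"
  by (rule continuous_on_blinfun_componentwise)
     (use assms in \<open>auto simp: matrix_blinfun_apply intro!: continuous_intros\<close>)

text \<open>
A shear in the first coordinate followed by one in the second, which makes it invertible and area
preserving. The parameter \<open>t\<close> scales both shears, so that \<open>t\<close> from \<open>0\<close> to \<open>1\<close> is the isotopy from the
identity.
\<close>

definition standard_lift :: "(real \<Rightarrow> real) \<Rightarrow> real \<Rightarrow> real \<times> real \<Rightarrow> real \<times> real" where
  "standard_lift \<phi> t z = (fst z + t * snd z, snd z + t * \<phi> (fst z + t * snd z))"

definition standard_lift_inverse :: "(real \<Rightarrow> real) \<Rightarrow> real \<Rightarrow> real \<times> real \<Rightarrow> real \<times> real" where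
  "standard_lift_inverse \<phi> t z = (fst z - t * (snd z - t * \<phi> (fst z)), snd z - t * \<phi> (fst z))"

definition standard_map :: "(real \<Rightarrow> real) \<Rightarrow> real \<Rightarrow> annulus \<Rightarrow> annulus" where
  "standard_map \<phi> t = descend (standard_lift \<phi> t)"

locale periodic_forcing =
  fixes \<phi> \<phi>' :: "real \<Rightarrow> real"
  assumes periodic: "\<phi> (x + 1) = \<phi> x"
    and deriv: "(\<phi> has_real_derivative \<phi>' x) (at x)"
    and deriv_cont: "continuous_on UNIV \<phi>'"
begin

lemma continuous_forcing: "continuous_on UNIV \<phi>"
  by (intro continuous_at_imp_continuous_on ballI DERIV_isCont [OF deriv])

lemma standard_lift_derivative:
  "(standard_lift \<phi> t has_derivative
      matrix_blinfun 1 t (t * \<phi>' (fst z + t * snd z)) (1 + t\<^sup>2 * \<phi>' (fst z + t * snd z))) (at z)"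
proof -
  have 1: "((\<lambda>z. fst z + t * snd z) has_derivative (\<lambda>v. fst v + t * snd v)) (at z)"
    by (auto intro!: derivative_eq_intros)
  have 2: "((\<lambda>z. \<phi> (fst z + t * snd z)) has_derivative (\<lambda>v. (fst v + t * snd v) * \<phi>' (fst z + t * snd z))) (at z)"
    by (rule DERIV_compose_FDERIV [OF deriv 1])
  have 3: "((\<lambda>z. snd z + t * \<phi> (fst z + t * snd z)) has_derivative
      (\<lambda>v. snd v + t * ((fst v + t * snd v) * \<phi>' (fst z + t * snd z)))) (at z)"
    by (intro has_derivative_add has_derivative_snd has_derivative_ident has_derivative_mult_right 2)
  show ?thesis
    unfolding standard_lift_def [abs_def] matrix_blinfun_apply
    by (rule has_derivative_eq_rhs [OF has_derivative_Pair [OF 1 3]])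
       (simp add: fun_eq_iff algebra_simps power2_eq_square)
qed

lemma standard_lift_inverse_derivative:
  "(standard_lift_inverse \<phi> t has_derivative
      matrix_blinfun (1 + t\<^sup>2 * \<phi>' (fst z)) (- t) (- (t * \<phi>' (fst z))) 1) (at z)"
proof -
  have 2: "((\<lambda>z. \<phi> (fst z)) has_derivative (\<lambda>v. fst v * \<phi>' (fst z))) (at z)"
    by (rule DERIV_compose_FDERIV [OF deriv]) (auto intro!: derivative_eq_intros)
  have 3: "((\<lambda>z. snd z - t * \<phi> (fst z)) has_derivative (\<lambda>v. snd v - t * (fst v * \<phi>' (fst z)))) (at z)"
    by (intro has_derivative_diff has_derivative_snd has_derivative_ident has_derivative_mult_right 2)
  have 4: "((\<lambda>z. fst z - t * (snd z - t * \<phi> (fst z))) has_derivative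
      (\<lambda>v. fst v - t * (snd v - t * (fst v * \<phi>' (fst z))))) (at z)"
    by (intro has_derivative_diff has_derivative_fst has_derivative_ident has_derivative_mult_right 3)
  show ?thesis
    unfolding standard_lift_inverse_def [abs_def] matrix_blinfun_apply
    by (rule has_derivative_eq_rhs [OF has_derivative_Pair [OF 4 3]])
       (simp add: fun_eq_iff algebra_simps power2_eq_square)
qed

lemma standard_lift_C1: "C1_map (standard_lift \<phi> t)"
  unfolding C1_map_def
  by (intro exI [of _ "\<lambda>z. matrix_blinfun 1 t (t * \<phi>' (fst z + t * snd z)) (1 + t\<^sup>2 * \<phi>' (fst z + t * snd z))"]
      conjI allI standard_lift_derivative continuous_intros continuous_on_compose2 [OF deriv_cont]) auto

lemma standard_lift_inverse_C1: "C1_map (standard_lift_inverse \<phi> t)"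
  unfolding C1_map_def
  by (intro exI [of _ "\<lambda>z. matrix_blinfun (1 + t\<^sup>2 * \<phi>' (fst z)) (- t) (- (t * \<phi>' (fst z))) 1"]
      conjI allI standard_lift_inverse_derivative continuous_intros continuous_on_compose2 [OF deriv_cont]) auto

lemma equivariant_standard_lift: "equivariant (standard_lift \<phi> t)"
  unfolding equivariant_def
proof (intro conjI allI)
  show "continuous_on UNIV (standard_lift \<phi> t)"
    by (rule has_derivative_continuous_on) (rule has_derivative_at_withinI [OF standard_lift_derivative])
  show "standard_lift \<phi> t (x + 1, r) = standard_lift \<phi> t (x, r) + (1, 0)" for x r
    using periodic [of "x + t * r"] by (simp add: standard_lift_def add_ac)
qed

lemma equivariant_standard_lift_inverse: "equivariant (standard_lift_inverse \<phi> t)"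
  unfolding equivariant_def
proof (intro conjI allI)
  show "continuous_on UNIV (standard_lift_inverse \<phi> t)"
    by (rule has_derivative_continuous_on) (rule has_derivative_at_withinI [OF standard_lift_inverse_derivative])
  show "standard_lift_inverse \<phi> t (x + 1, r) = standard_lift_inverse \<phi> t (x, r) + (1, 0)" for x r
    using periodic [of x] by (simp add: standard_lift_inverse_def)
qed

lemma standard_map_to_annulus:
  "standard_map \<phi> t (to_annulus z) = to_annulus (standard_lift \<phi> t z)"
  unfolding standard_map_def by (rule descend_to_annulus [OF equivariant_standard_lift])

lemma is_lift_standard_map: "is_lift (standard_lift \<phi> t) (standard_map \<phi> t)"
  unfolding standard_map_def by (rule is_lift_descend [OF equivariant_standard_lift])

lemma standard_map_diffeo: "annulus_C1_diffeo (standard_map \<phi> t)"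
proof -
  have "standard_lift_inverse \<phi> t (standard_lift \<phi> t z) = z" "standard_lift \<phi> t (standard_lift_inverse \<phi> t z) = z" for z
    by (cases z; simp add: standard_lift_def standard_lift_inverse_def algebra_simps)+
  note inv = descend_inverse [OF equivariant_standard_lift equivariant_standard_lift_inverse this]
  show ?thesis
    unfolding annulus_C1_diffeo_def annulus_C1_map_def standard_map_def inv(2)
    using inv(1) is_lift_descend equivariant_standard_lift equivariant_standard_lift_inverse
      standard_lift_C1 standard_lift_inverse_C1 by blast
qed

lemma standard_map_isotopic: "isotopic_to_id (standard_map \<phi> 1)"
  unfolding isotopic_to_id_def
proof (intro exI conjI ballI allI)
  show "standard_map \<phi> 0 = id"
  proof
    fix z
    show "standard_map \<phi> 0 z = id z"
      using to_annulus_surj [of z] by (auto simp: standard_map_to_annulus standard_lift_def)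
  qed
  show "standard_map \<phi> 1 = standard_map \<phi> 1" ..
  show "annulus_C1_diffeo (standard_map \<phi> t)" for t by (rule standard_map_diffeo)
  show "is_lift (standard_lift \<phi> t) (standard_map \<phi> t)" for t by (rule is_lift_standard_map)
  show "(standard_lift \<phi> t has_derivative
      matrix_blinfun 1 t (t * \<phi>' (fst z + t * snd z)) (1 + t\<^sup>2 * \<phi>' (fst z + t * snd z))) (at z)" for t z
    by (rule standard_lift_derivative)
  show "continuous_on ({0..1} \<times> UNIV) (\<lambda>(t, z). standard_lift \<phi> t z)"
    unfolding standard_lift_def case_prod_beta
    by (intro continuous_intros continuous_on_compose2 [OF continuous_forcing]) auto
  show "continuous_on ({0..1} \<times> UNIV) (\<lambda>(t, z).
      matrix_blinfun 1 t (t * \<phi>' (fst z + t * snd z)) (1 + t\<^sup>2 * \<phi>' (fst z + t * snd z)))"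
    unfolding case_prod_beta
    by (intro continuous_intros continuous_on_compose2 [OF deriv_cont]) auto
qed

lemma C1_diffeo_translation: "C1_diffeo (\<lambda>r::real. b + r)"
proof -
  have C1: "C1_map (\<lambda>r::real. c + r)" for c
    unfolding C1_map_def by (rule exI [of _ "\<lambda>_. id_blinfun"]) (auto intro!: derivative_eq_intros)
  have inv: "inv (\<lambda>r. b + r) = (\<lambda>r. - b + r)" by (rule inv_equality) auto
  have "bij (\<lambda>r. b + r)" by (rule o_bij [of "\<lambda>r. - b + r"]) auto
  then show ?thesis unfolding C1_diffeo_def inv using C1 by blast
qed

lemma standard_map_twist: "twist_map (standard_map \<phi> 1)"
proof -
  have "C1_diffeo (\<lambda>r. fst (G (\<theta>, r))) \<and> strict_mono (\<lambda>r. fst (G (\<theta>, r)))"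
    if lift: "is_lift G (standard_map \<phi> 1)" for G \<theta>
  proof -
    obtain c where "\<And>z. fst (G z) = fst (standard_lift \<phi> 1 z) + c"
      by (rule lifts_differ_by_translation [OF is_lift_standard_map lift]) blast
    then have "(\<lambda>r. fst (G (\<theta>, r))) = (\<lambda>r. (\<theta> + c) + r)" by (simp add: standard_lift_def add_ac)
    then show ?thesis using C1_diffeo_translation by (simp add: strict_mono_def)
  qed
  then show ?thesis
    using standard_map_diffeo standard_map_isotopic by (simp add: twist_map_def positive_twist_map_def)
qed

lemma standard_map_symplectic: "symplectic (standard_map \<phi> 1)"
  unfolding symplectic_def
proof (intro exI conjI allI)
  show "is_lift (standard_lift \<phi> 1) (standard_map \<phi> 1)" by (rule is_lift_standard_map)
  show "(standard_lift \<phi> 1 has_derivative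
      matrix_blinfun 1 1 (1 * \<phi>' (fst z + 1 * snd z)) (1 + 1\<^sup>2 * \<phi>' (fst z + 1 * snd z))) (at z)" for z
    by (rule standard_lift_derivative)
  show "area_form (matrix_blinfun 1 1 (1 * \<phi>' (fst z + 1 * snd z)) (1 + 1\<^sup>2 * \<phi>' (fst z + 1 * snd z)) u)
      (matrix_blinfun 1 1 (1 * \<phi>' (fst z + 1 * snd z)) (1 + 1\<^sup>2 * \<phi>' (fst z + 1 * snd z)) v) = area_form u v" for u v z
    by (simp add: area_form_def matrix_blinfun_apply algebra_simps)
qed

end

section \<open>The invariant graph\<close>

text \<open>
Projecting to the circle turns the graph into the unit circle of the complex plane, whose winding
number around \<open>0\<close> is \<open>1\<close>; a null homotopy would force it to vanish.
\<close>

lemma graph_essential: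
  assumes "continuous_on UNIV \<psi>" "\<And>x. \<psi> (x + 1) = \<psi> x"
  shows "essential_curve (range (\<lambda>x. to_annulus (x, \<psi> x)))"
proof -
  define \<gamma> where "\<gamma> x = to_annulus (x, \<psi> x)" for x
  have cont: "continuous_on S \<gamma>" for S
    unfolding \<gamma>_def to_annulus_def fst_conv snd_conv
    by (rule continuous_on_Pair [OF continuous_on_to_circle continuous_on_subset [OF assms(1) subset_UNIV]])
  have \<gamma>_eq: "\<gamma> x = \<gamma> y \<Longrightarrow> x - y \<in> \<int>" for x y
    by (auto simp: \<gamma>_def to_annulus_def to_circle_eq_iff)
  have \<gamma>_int: "\<gamma> (x + of_int m) = \<gamma> x" for x m
    by (rule periodic_add_of_int) (simp add: \<gamma>_def to_annulus_def assms)
  have "simple_path \<gamma>"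
    unfolding simple_path_def loop_free_def path_def
  proof (intro conjI ballI impI cont)
    fix x y :: real assume xy: "x \<in> {0..1}" "y \<in> {0..1}" "\<gamma> x = \<gamma> y"
    then obtain m where m: "x - y = of_int m" using \<gamma>_eq by (blast elim: Ints_cases)
    \<comment> \<open>Equal points differ by an integer, and within the unit interval only the end
      points can do so.\<close>
    then have "-1 \<le> m" "m \<le> 1" using xy by auto
    then have "m = -1 \<or> m = 0 \<or> m = 1" by linarith
    then show "x = y \<or> x = 0 \<and> y = 1 \<or> x = 1 \<and> y = 0" using m xy by auto
  qed
  moreover have "pathfinish \<gamma> = pathstart \<gamma>"
    using \<gamma>_int [of 0 1] by (simp add: pathfinish_def pathstart_def)
  moreover have "path_image \<gamma> = range \<gamma>"
  proof -
    have "\<gamma> x \<in> \<gamma> ` {0..1}" for x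
    proof -
      have "\<gamma> x = \<gamma> (frac x)" using \<gamma>_int [of "frac x" "\<lfloor>x\<rfloor>"] by (simp add: frac_def)
      then show ?thesis using frac_lt_1 [of x] by (simp add: less_imp_le)
    qed
    then show ?thesis unfolding path_image_def by blast
  qed
  moreover have "\<not> (\<exists>a. homotopic_loops UNIV \<gamma> (\<lambda>_. a))"
  proof
    assume "\<exists>a. homotopic_loops UNIV \<gamma> (\<lambda>_. a)"
    then obtain a where a: "homotopic_loops UNIV \<gamma> (\<lambda>_. a)" ..
    define e where "e = circle_lift (\<lambda>x. exp (2 * of_real pi * \<i> * of_real x))"
    have e: "e (to_circle x) = exp (2 * of_real pi * \<i> * of_real x)" for x
      unfolding e_def
    proof (rule circle_lift_to_circle)
      show "exp (2 * of_real pi * \<i> * of_real (x + 1)) = exp (2 * of_real pi * \<i> * of_real x)" for x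
        by (simp add: ring_distribs exp_add)
    qed
    have "continuous_on UNIV e"
      by (rule continuous_on_circle) (auto simp: e intro!: continuous_intros)
    then have "continuous_on UNIV (\<lambda>z :: annulus. e (fst z))"
      by (rule continuous_on_compose2 [OF _ continuous_on_fst [OF continuous_on_id]]) auto
    moreover have "e (fst z) \<noteq> 0" for z :: annulus
      using to_annulus_surj [of z] by (auto simp: to_annulus_def e)
    ultimately have "homotopic_loops (- {0}) ((\<lambda>z. e (fst z)) \<circ> \<gamma>) ((\<lambda>z. e (fst z)) \<circ> (\<lambda>_. a))"
      by (intro homotopic_loops_continuous_image [OF a]) auto
    then have "winding_number ((\<lambda>z. e (fst z)) \<circ> \<gamma>) 0 = winding_number ((\<lambda>z. e (fst z)) \<circ> (\<lambda>_. a)) 0"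
      by (rule winding_number_homotopic_loops)
    moreover have "(\<lambda>z. e (fst z)) \<circ> \<gamma> = circlepath 0 1"
      by (auto simp: fun_eq_iff \<gamma>_def to_annulus_def e circlepath)
    moreover have "winding_number ((\<lambda>z. e (fst z)) \<circ> (\<lambda>_. a)) 0 = 0"
      using winding_number_zero_const [of "e (fst a)" 0] \<open>e (fst a) \<noteq> 0\<close> by (simp add: comp_def)
    ultimately show False by (simp add: winding_number_circlepath_centre)
  qed
  ultimately show ?thesis unfolding essential_curve_def \<gamma>_def by blast
qed


lemma continuous_on_circle_lift:
  fixes f :: "real \<Rightarrow> 'a::topological_space"
  assumes "continuous_on UNIV f" "\<And>x. f (x + 1) = f x"
  shows "continuous_on UNIV (circle_lift f)"
  by (rule continuous_on_circle) (use assms in \<open>simp add: circle_lift_to_circle\<close>)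

text \<open>
Along the curve the map is conjugate to the rotation by \<open>\<alpha>\<close>, whose forward orbits are dense by
Kronecker's theorem. On the curve, \<open>g\<close> and its inverse factor through the first coordinate, which
gives their continuity without inspecting the topology of the annulus.
\<close>

lemma minimal_of_rotation_conjugacy:
  fixes P :: "real \<Rightarrow> annulus" and h h' K :: "real \<Rightarrow> real" and \<alpha> :: real
  assumes irr: "\<alpha> \<notin> \<rat>"
    and P: "continuous_on UNIV P" "\<And>x. P (x + 1) = P x" "\<And>x. fst (P x) = to_circle x"
    and g: "\<And>x. g (P x) = P (h x)"
    and h: "continuous_on UNIV h" "\<And>x. h (x + 1) = h x + 1" "\<And>x. h (h' x) = x"
    and h': "continuous_on UNIV h'" "\<And>x. h' (x + 1) = h' x + 1" "\<And>x. h' (h x) = x"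
    and K: "continuous_on UNIV K" "\<And>x. K (x + 1) = K x + 1" "surj K" "\<And>x. h (K x) = K (x + \<alpha>)"
  shows "minimal_homeomorphism_on (range P) g"
proof -
  define f where "f q z = circle_lift (\<lambda>x. P (q x)) (fst z)" for q and z :: annulus
  have f: "f q (P x) = P (q x)" and f_cont: "continuous_on S (f q)"
    if q: "continuous_on UNIV q" "\<And>x. q (x + 1) = q x + 1" for q x S
  proof -
    have per: "P (q (x + 1)) = P (q x)" for x by (simp add: q(2) P(2))
    show "f q (P x) = P (q x)" unfolding f_def P(3) by (rule circle_lift_to_circle) (rule per)
    have "continuous_on UNIV (circle_lift (\<lambda>x. P (q x)))"
      by (rule continuous_on_circle_lift [OF continuous_on_compose2 [OF P(1) q(1) subset_UNIV] per])
    then show "continuous_on S (f q)"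
      unfolding f_def by (rule continuous_on_compose2 [OF _ continuous_on_fst [OF continuous_on_id]]) auto
  qed
  have fh': "f h' (P x) = P (h' x)" for x by (rule f [OF h'(1,2)])
  have gf: "g z = f h z" if "z \<in> range P" for z using that g f [OF h(1,2)] by auto
  have image: "q ` range P = range P" if "\<And>x. q (P x) = P (r x)" "\<And>x. r (r' x) = x" for q r r'
  proof
    show "q ` range P \<subseteq> range P" using that(1) by auto
    have "P x = q (P (r' x))" for x using that by simp
    then show "range P \<subseteq> q ` range P" by blast
  qed
  have homeo: "homeomorphism (range P) (range P) g (f h')"
    unfolding homeomorphism_def
  proof (intro conjI ballI)
    show "continuous_on (range P) g"
      using f_cont [OF h(1,2)] gf by (simp cong: continuous_on_cong)
    show "continuous_on (range P) (f h')" by (rule f_cont [OF h'(1,2)])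
    show "g ` range P = range P" by (rule image [of g h h']) (use g h in auto)
    show "f h' ` range P = range P" by (rule image [of _ h' h]) (use fh' h' in auto)
  qed (auto simp: g fh' h h')
  have PK: "P (K (x + of_int m)) = P (K x)" for x m
    by (rule periodic_add_of_int [of "\<lambda>x. P (K x)"]) (simp add: K P)
  have orbit: "(g ^^ n) (P (K x)) = P (K (x + real n * \<alpha>))" for n x
    by (induction n) (auto simp: g K algebra_simps)
  have dense: "range P \<subseteq> closure (range (\<lambda>n. (g ^^ n) z))" if z: "z \<in> range P" for z
  proof
    fix y assume "y \<in> range P"
    have "\<exists>u. x = P (K u)" if x: "x \<in> range P" for x
    proof -
      from x obtain a where "x = P a" ..
      moreover obtain u where "a = K u" using K(3) by (rule surjE)
      ultimately show ?thesis by blast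
    qed
    then obtain u v where u: "z = P (K u)" and v: "y = P (K v)"
      using \<open>y \<in> range P\<close> z by meson
    show "y \<in> closure (range (\<lambda>n. (g ^^ n) z))"
      unfolding closure_iff_nhds_not_empty
    proof (intro allI impI)
      fix A U assume U: "U \<subseteq> A" "open U" "y \<in> U"
      have "continuous_on UNIV (\<lambda>x. P (K x))"
        by (rule continuous_on_compose2 [OF P(1) K(1) subset_UNIV])
      then have "open ((\<lambda>x. P (K x)) -` U)" using U by (simp add: continuous_on_open_vimage)
      moreover have "v \<in> (\<lambda>x. P (K x)) -` U" using U v by simp
      ultimately obtain e where e: "e > 0" "\<And>x. \<bar>x - v\<bar> < e \<Longrightarrow> P (K x) \<in> U"
        unfolding open_dist dist_real_def by blast
      obtain m n where n: "n > 0" "\<bar>of_int n * \<alpha> - of_int m - (v - u)\<bar> < e"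
        by (rule sequence_of_fractional_parts_is_dense [OF irr e(1), of "v - u"]) blast
      have "P (K ((u + of_int n * \<alpha>) + of_int (- m))) \<in> U"
        by (rule e(2)) (use n(2) in \<open>simp add: algebra_simps\<close>)
      then have "P (K (u + real (nat n) * \<alpha>)) \<in> U" unfolding PK using n(1) by simp
      then have "(g ^^ nat n) z \<in> U" by (simp add: u orbit)
      then show "range (\<lambda>n. (g ^^ n) z) \<inter> A \<noteq> {}" using U(1) by blast
    qed
  qed
  show ?thesis
    unfolding minimal_homeomorphism_on_def
  proof (intro exI conjI ballI)
    show "homeomorphism (range P) (range P) g (f h')" by (rule homeo)
    fix z assume "z \<in> range P"
    from dense [OF this] closure_mono [OF Un_upper1]
    show "range P \<subseteq> closure (range (\<lambda>n. (g ^^ n) z) \<union> range (\<lambda>n. (f h' ^^ n) z))"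
      by (rule order_trans)
  qed
qed

lemma graph_nondifferentiable:
  assumes per: "\<And>x. \<psi> (x + 1) = \<psi> x" and lip: "L-lipschitz_on UNIV \<psi>"
    and "\<not> \<psi> differentiable (at \<theta>)"
  shows "nondifferentiable_curve (range (\<lambda>x. to_annulus (x, \<psi> x)))"
proof -
  have eq: "circle_lift \<psi> \<circ> to_circle = \<psi>" by (auto simp: circle_lift_to_circle [of \<psi>, OF per])
  have "range (\<lambda>x. to_annulus (x, \<psi> x)) = range (\<lambda>t. (t, circle_lift \<psi> t))"
  proof (intro equalityI subsetI)
    fix z assume "z \<in> range (\<lambda>x. to_annulus (x, \<psi> x))"
    then obtain x where "z = (to_circle x, circle_lift \<psi> (to_circle x))"
      by (auto simp: to_annulus_def circle_lift_to_circle [of \<psi>, OF per])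
    then show "z \<in> range (\<lambda>t. (t, circle_lift \<psi> t))" by blast
  next
    fix z assume "z \<in> range (\<lambda>t. (t, circle_lift \<psi> t))"
    then obtain t where "z = (t, circle_lift \<psi> t)" by blast
    then have "z = to_annulus (rep_circle t, \<psi> (rep_circle t))"
      by (simp add: to_annulus_def circle_lift_def)
    then show "z \<in> range (\<lambda>x. to_annulus (x, \<psi> x))" by blast
  qed
  then show ?thesis
    unfolding nondifferentiable_curve_def using assms(2,3) eq by metis
qed

text \<open>
For \<open>\<phi> = h + inverse h - 2 id\<close> one has \<open>x + (h x - x) = h x\<close> and
\<open>(h x - x) + \<phi> (h x) = h (h x) - h x\<close>, so the standard map carries the point of the graph of \<open>h - id\<close>
over \<open>x\<close> to the one over \<open>h x\<close>.
\<close>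

lemma circle_map_to_twist_map:
  fixes h h' \<phi>' K :: "real \<Rightarrow> real" and \<alpha> B a :: real
  assumes irr: "\<alpha> \<notin> \<rat>"
    and K: "continuous_on UNIV K" "\<And>x. K (x + 1) = K x + 1" "surj K" "\<And>x. h (K x) = K (x + \<alpha>)"
    and inv: "\<And>u. h' (h u) = u" "\<And>u. h (h' u) = u"
    and per: "\<And>u. h (u + 1) = h u + 1" "\<And>u. h' (u + 1) = h' u + 1"
    and cont: "continuous_on UNIV h" "continuous_on UNIV h'"
    and der: "\<And>u. ((\<lambda>u. h u + h' u - 2 * u) has_real_derivative \<phi>' u) (at u)" "continuous_on UNIV \<phi>'"
    and lip: "\<And>u v. \<bar>h u - h v\<bar> \<le> B * \<bar>u - v\<bar>" and nondiff: "\<not> h differentiable (at a)"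
  shows "\<exists>(g :: annulus \<Rightarrow> annulus) (\<Gamma> :: annulus set).
     twist_map g \<and> symplectic g \<and>
     essential_invariant_curve g \<Gamma> \<and> nondifferentiable_curve \<Gamma> \<and>
     minimal_homeomorphism_on \<Gamma> g"
proof -
  define \<phi> where "\<phi> u = h u + h' u - 2 * u" for u
  interpret periodic_forcing \<phi> \<phi>'
  proof
    show "\<phi> (x + 1) = \<phi> x" for x by (simp add: \<phi>_def per)
    show "(\<phi> has_real_derivative \<phi>' x) (at x)" for x unfolding \<phi>_def by (rule der(1))
    show "continuous_on UNIV \<phi>'" by (rule der(2))
  qed
  define \<psi> where "\<psi> x = h x - x" for x
  define P where "P x = to_annulus (x, \<psi> x)" for x
  define g where "g = standard_map \<phi> 1"
  have \<psi>_per: "\<psi> (x + 1) = \<psi> x" for x by (simp add: \<psi>_def per)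
  have \<psi>_cont: "continuous_on UNIV \<psi>" unfolding \<psi>_def by (intro continuous_intros cont)
  have gP: "g (P x) = P (h x)" for x
    by (simp add: g_def P_def standard_map_to_annulus standard_lift_def \<psi>_def \<phi>_def inv)
  have rangeP: "range P = range (\<lambda>x. to_annulus (x, \<psi> x))" by (simp add: P_def [abs_def])
  have "g ` range P = range P"
  proof
    show "g ` range P \<subseteq> range P" using gP by auto
    have "P x = g (P (h' x))" for x by (simp add: gP inv)
    then show "range P \<subseteq> g ` range P" by blast
  qed
  then have "essential_invariant_curve g (range P)"
    using graph_essential [of \<psi>, OF \<psi>_cont \<psi>_per] by (simp add: essential_invariant_curve_def rangeP)
  moreover have "nondifferentiable_curve (range P)"
    unfolding rangeP
  proof (rule graph_nondifferentiable [of \<psi>, OF \<psi>_per])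
    show "(B + 1)-lipschitz_on UNIV \<psi>"
    proof (rule lipschitz_onI)
      show "0 \<le> B + 1" using lip [of 1 0] by simp
      show "dist (\<psi> u) (\<psi> v) \<le> (B + 1) * dist u v" for u v
        using lip [of u v] by (simp add: dist_real_def \<psi>_def algebra_simps)
    qed
    show "\<not> \<psi> differentiable (at a)"
    proof
      assume "\<psi> differentiable (at a)"
      then have "(\<lambda>x. \<psi> x + x) differentiable (at a)" by (intro differentiable_add) auto
      then show False using nondiff by (simp add: \<psi>_def)
    qed
  qed
  moreover have "minimal_homeomorphism_on (range P) g"
  proof (rule minimal_of_rotation_conjugacy [where P = P and g = g and h = h and h' = h' and K = K, OF irr _ _ _ gP cont(1) per(1) inv(2) cont(2) per(2) inv(1) K])
    show "continuous_on UNIV P"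
      unfolding P_def to_annulus_def fst_conv snd_conv
      by (rule continuous_on_Pair [OF continuous_on_to_circle \<psi>_cont])
    show "P (x + 1) = P x" "fst (P x) = to_circle x" for x
      by (simp_all add: P_def to_annulus_def \<psi>_per)
  qed
  ultimately show ?thesis
    using standard_map_twist standard_map_symplectic unfolding g_def by blast
qed

theorem theorem1:
  "\<exists>(g :: annulus \<Rightarrow> annulus) (\<Gamma> :: annulus set).
     twist_map g \<and> symplectic g \<and>
     essential_invariant_curve g \<Gamma> \<and> nondifferentiable_curve \<Gamma> \<and>
     minimal_homeomorphism_on \<Gamma> g"
proof -
  have "\<rat> \<noteq> (UNIV :: real set)"
    using countable_rat uncountable_UNIV_real by metis
  then obtain \<alpha> :: real where \<alpha>: "\<alpha> \<notin> \<rat>" by blast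
  interpret irrational_rotation \<alpha> by standard (rule \<alpha>)
  obtain K V :: "real \<Rightarrow> real" and B :: real where
    K: "strict_mono K" "continuous_on UNIV K" "\<And>x. K (x + 1) = K x + 1"
    and V: "continuous_on UNIV V" "\<And>x. V x \<le> B"
    and sum: "\<And>a e. e > 0 \<Longrightarrow> \<exists>d>0. \<forall>x. \<bar>x - a\<bar> < d \<longrightarrow>
        \<bar>rotation_sum K x - rotation_sum K a - V a * (K x - K a)\<bar> \<le> e * \<bar>K x - K a\<bar>"
    and steep: "\<And>e. e > 0 \<Longrightarrow> \<exists>t. 0 < t \<and> t < e \<and> K (t + \<alpha>) - K \<alpha> \<ge> (1 + 1/10000) * (K t - K 0)"
    and flat: "\<And>e. e > 0 \<Longrightarrow> \<exists>t. 0 < t \<and> t < e \<and> K (t + \<alpha>) - K \<alpha> \<le> (1 + 1/20000) * (K t - K 0)"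
    by (rule singular_conjugacy) blast
  obtain h h' \<phi>' where h: "\<And>x. h (K x) = K (x + \<alpha>)" "\<And>u. h' (h u) = u" "\<And>u. h (h' u) = u"
    "\<And>u. h (u + 1) = h u + 1" "\<And>u. h' (u + 1) = h' u + 1" "continuous_on UNIV h" "continuous_on UNIV h'"
    "\<And>u. ((\<lambda>u. h u + h' u - 2 * u) has_real_derivative \<phi>' u) (at u)" "continuous_on UNIV \<phi>'"
    "\<And>u v. \<bar>h u - h v\<bar> \<le> B * \<bar>u - v\<bar>" "\<not> h differentiable (at (K 0))"
    by (rule circle_map_of_conjugacy [OF K V sum steep flat]; (assumption | (rule that; assumption)))
  obtain J where "\<And>u. K (J u) = u"
    by (rule strict_mono_circle_lift_inverse [OF K]) blast
  then have "surj K" by (rule surjI)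
  show ?thesis
    by (rule circle_map_to_twist_map [OF \<alpha> K(2,3) \<open>surj K\<close> h])
qed

end
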